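(* Let $k$ be a perfect field of characteristic $p>0$, $d\ge1$, $A=k[t_1,\dots,t_d]$, and $n\ge1$. Let $r\ge0$ be an integer and $1\le j\le d$. Then $$\partial_{j,n}^{[r/p]}\circ R=R\circ\partial_{j,n+1}^{[r]},$$ $$\partial_{j,n+1}^{[r]}\circ\Phi_A=\Phi_A\circ\partial_{j,n+1}^{[r/p]},$$ $$\partial_{j,n+1}^{[r]}\circ V=V\circ\partial_{j,n}^{[r]},$$ $$\partial_{j,n+1}^{[r]}(V^i\mathrm W_{n+1}(A))\subset V^i\mathrm W_{n+1}(A)\quad\text{for all }0\le i<n+1,$$ where an operator with exponent $[r/p]$ is meant to be $0$ if $p\nmid r$. Consequently, the analogous relations hold for $\partial_{n+1}^{[\mathbf r]}$ for any $\mathbf r\in\mathbb N^d$.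
   Context: $\mathrm W_m(A)$ is the ring of $p$-typical Witt vectors of length $m$; $R:\mathrm W_{n+1}(A)\to\mathrm W_n(A)$ is the restriction, $V$ the Verschiebung (so $V:\mathrm W_n(A)\to\mathrm W_{n+1}(A)$ in the third relation), $\Phi_A:\mathrm W_{n+1}(A)\to\mathrm W_{n+1}(A)$ the Frobenius induced by $x\mapsto x^p$ on $A$, and $V^i\mathrm W_{n+1}(A)$ the ideal of Witt vectors whose first $i$ components vanish. Let $A_{m}=\mathrm W_{m}(k)[t_1,\dots,t_d]$ and, for $m\ge 1$, let $\tilde w_{m-1}:\mathrm W_{m}(A)\to A_{m}$ be the injective ring homomorphism $(f_1,\dots,f_{m})\mapsto\sum_{i=0}^{m-1}p^i\tilde f_{i+1}^{\,p^{m-1-i}}$ ($\tilde f_i\in A_m$ any lift of $f_i$). On $A_m$ let $\partial_{j,m}^{[r]}=\frac1{r!}\partial_{t_j}^r$ ($t_j^s\mapsto\binom srt_j^{s-r}$, linear over $\mathrm W_m(k)$ and the other variables). The operator $\partial_{j,m}^{[r]}$ on $\mathrm W_m(A)$ appearing in the claim is the unique map with $\tilde w_{m-1}\circ\partial_{j,m}^{[r]}=\partial_{j,m}^{[r]}\circ\tilde w_{m-1}$. For $\mathbf r=(r_1,\dots,r_d)\in\mathbb N^d$, $\partial_m^{[\mathbf r]}=\partial_{1,m}^{[r_1]}\circ\dots\circ\partial_{d,m}^{[r_d]}$, and $\partial_m^{[\mathbf r/p]}$ is the operator with exponents $r_j/p$, meant to be $0$ if $p\nmid r_j$ for some $j$.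 *)

theory Defs
  imports
    "HOL-Algebra.Indexed_Polynomials"
    "HOL-Library.Poly_Mapping"
    "HOL-Computational_Algebra.Primes"
begin

section \<open>Polynomial rings and divided power derivations\<close>

text \<open>
  A polynomial is a function from monomials to coefficients. A monomial is a multiset of indices: the
  multiplicity of \<open>j\<close> is the exponent of \<open>t\<^sub>j\<close>. The library provides the carrier of
  \<open>R[t\<^sub>j | j \<in> I]\<close>, the constants and the addition; the product is added here.
\<close>

definition mpoly_ring :: "('a, 'b) ring_scheme \<Rightarrow> 'v set \<Rightarrow> ('v multiset \<Rightarrow> 'a) ring" where
  "mpoly_ring R I = \<lparr>
     carrier = ring.indexed_pset R I (carrier R),
     monoid.mult = (\<lambda>f g M. \<Oplus>\<^bsub>R\<^esub>N \<in> {N. N \<subseteq># M}. f N \<otimes>\<^bsub>R\<^esub> g (M - N)),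
     one = ring.indexed_const R \<one>\<^bsub>R\<^esub>,
     zero = ring.indexed_const R \<zero>\<^bsub>R\<^esub>,
     add = ring.indexed_padd R\<rparr>"

text \<open>
  The \<open>R\<close>-linear operator \<open>\<partial>\<^sub>j\<^bsup>[r]\<^esup>\<close> with \<open>t\<^sub>j\<^bsup>s\<^esup> \<mapsto> (s choose r) t\<^sub>j\<^bsup>s-r\<^esup>\<close>, linear
  over the other variables as well: the coefficient of the monomial \<open>M\<close> in the derivative comes
  from the monomial \<open>M t\<^sub>j\<^bsup>r\<^esup>\<close> alone. Lemma \<open>hasse_deriv_monomial\<close> is the formula on monomials.
\<close>

definition hasse_deriv ::
  "('a, 'b) ring_scheme \<Rightarrow> 'v \<Rightarrow> nat \<Rightarrow> ('v multiset \<Rightarrow> 'a) \<Rightarrow> ('v multiset \<Rightarrow> 'a)" where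
  "hasse_deriv R j r f =
     (\<lambda>M. [((count M j + r) choose r)] \<cdot>\<^bsub>R\<^esub> f (M + replicate_mset r j))"

lemma (in ring) hasse_deriv_monomial:
  fixes N :: "'v multiset"
  assumes "c \<in> carrier R"
  shows "hasse_deriv R j r (\<lambda>M. if M = N then c else \<zero>) =
    (\<lambda>M. if M = N - replicate_mset r j then [(count N j choose r)] \<cdot> c else \<zero>)"
proof
  fix M :: "'v multiset"
  have z: "[m] \<cdot> \<zero> = \<zero>" for m :: nat
    by (induction m) (auto simp: add_pow_def)
  have n0: "[(0::nat)] \<cdot> c = \<zero>"
    by (simp add: add_pow_def)
  consider "M + replicate_mset r j = N" | "M + replicate_mset r j \<noteq> N" by blast
  then show "hasse_deriv R j r (\<lambda>M. if M = N then c else \<zero>) M =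
    (if M = N - replicate_mset r j then [(count N j choose r)] \<cdot> c else \<zero>)"
  proof cases
    case 1
    then show ?thesis by (auto simp: hasse_deriv_def)
  next
    case 2
    have "count N j < r" if "M = N - replicate_mset r j"
      using 2 that by (metis count_le_replicate_mset_subset_eq not_le subset_mset.diff_add)
    then show ?thesis using 2 by (auto simp: hasse_deriv_def z n0 binomial_eq_0)
  qed
qed


section \<open>Truncated Witt vectors\<close>

type_synonym 'v int_mpoly = "('v \<Rightarrow>\<^sub>0 nat) \<Rightarrow>\<^sub>0 int"

definition int_mpoly_var :: "'v \<Rightarrow> 'v int_mpoly" where
  "int_mpoly_var v = Poly_Mapping.single (Poly_Mapping.single v 1) 1"

definition int_mpoly_eval :: "('a, 'b) ring_scheme \<Rightarrow> ('v \<Rightarrow> 'a) \<Rightarrow> 'v int_mpoly \<Rightarrow> 'a" where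
  "int_mpoly_eval R x P =
     (\<Oplus>\<^bsub>R\<^esub>M \<in> Poly_Mapping.keys P. [(Poly_Mapping.lookup P M)] \<cdot>\<^bsub>R\<^esub>
        (\<Otimes>\<^bsub>R\<^esub>v \<in> Poly_Mapping.keys M. x v [^]\<^bsub>R\<^esub> Poly_Mapping.lookup M v))"

definition ghost_poly :: "nat \<Rightarrow> nat \<Rightarrow> (nat \<Rightarrow> 'v int_mpoly) \<Rightarrow> 'v int_mpoly" where
  "ghost_poly p n x = (\<Sum>i\<le>n. of_nat p ^ i * x i ^ (p ^ (n - i)))"

text \<open>
  The integral polynomials giving the sum and the product of Witt vectors: the unique solutions of
  \<open>w\<^sub>n(S) = w\<^sub>n(X) + w\<^sub>n(Y)\<close> and \<open>w\<^sub>n(P) = w\<^sub>n(X) w\<^sub>n(Y)\<close> for all \<open>n\<close>. The \<open>i\<close>-th member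
  involves only the variables \<open>X\<^sub>0, \<dots>, X\<^sub>i\<close> (\<open>Inl\<close>) and \<open>Y\<^sub>0, \<dots>, Y\<^sub>i\<close> (\<open>Inr\<close>).
\<close>

definition witt_sum_poly :: "nat \<Rightarrow> nat \<Rightarrow> (nat + nat) int_mpoly" where
  "witt_sum_poly p = (THE S. \<forall>n. ghost_poly p n S =
     ghost_poly p n (\<lambda>i. int_mpoly_var (Inl i)) + ghost_poly p n (\<lambda>i. int_mpoly_var (Inr i)))"

definition witt_prod_poly :: "nat \<Rightarrow> nat \<Rightarrow> (nat + nat) int_mpoly" where
  "witt_prod_poly p = (THE P. \<forall>n. ghost_poly p n P =
     ghost_poly p n (\<lambda>i. int_mpoly_var (Inl i)) * ghost_poly p n (\<lambda>i. int_mpoly_var (Inr i)))"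

definition witt_ring :: "nat \<Rightarrow> nat \<Rightarrow> ('a, 'b) ring_scheme \<Rightarrow> 'a list ring" where
  "witt_ring p m R = \<lparr>
     carrier = {xs. length xs = m \<and> set xs \<subseteq> carrier R},
     monoid.mult = (\<lambda>xs ys. map (\<lambda>i. int_mpoly_eval R (case_sum (nth xs) (nth ys)) (witt_prod_poly p i)) [0..<m]),
     one = map (\<lambda>i. if i = 0 then \<one>\<^bsub>R\<^esub> else \<zero>\<^bsub>R\<^esub>) [0..<m],
     zero = replicate m \<zero>\<^bsub>R\<^esub>,
     add = (\<lambda>xs ys. map (\<lambda>i. int_mpoly_eval R (case_sum (nth xs) (nth ys)) (witt_sum_poly p i)) [0..<m])\<rparr>"

definition witt_restriction :: "'a list \<Rightarrow> 'a list" where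
  "witt_restriction xs = butlast xs"

definition witt_verschiebung :: "('a, 'b) ring_scheme \<Rightarrow> 'a list \<Rightarrow> 'a list" where
  "witt_verschiebung R xs = \<zero>\<^bsub>R\<^esub> # xs"

definition witt_frobenius :: "nat \<Rightarrow> ('a, 'b) ring_scheme \<Rightarrow> 'a list \<Rightarrow> 'a list" where
  "witt_frobenius p R xs = map (\<lambda>x. x [^]\<^bsub>R\<^esub> p) xs"

definition witt_V_ideal :: "nat \<Rightarrow> nat \<Rightarrow> ('a, 'b) ring_scheme \<Rightarrow> nat \<Rightarrow> 'a list set" where
  "witt_V_ideal p m R i = {xs \<in> carrier (witt_ring p m R). \<forall>l<i. xs ! l = \<zero>\<^bsub>R\<^esub>}"


section \<open>The operators on the Witt vectors of a polynomial ring\<close>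

text \<open>\<open>A = k[t\<^sub>1, \<dots>, t\<^sub>d]\<close> and \<open>A\<^sub>m = W\<^sub>m(k)[t\<^sub>1, \<dots>, t\<^sub>d]\<close>.\<close>

abbreviation poly_A :: "('a, 'b) ring_scheme \<Rightarrow> nat \<Rightarrow> (nat multiset \<Rightarrow> 'a) ring" where
  "poly_A k d \<equiv> mpoly_ring k {1..d}"

abbreviation poly_W ::
  "nat \<Rightarrow> ('a, 'b) ring_scheme \<Rightarrow> nat \<Rightarrow> nat \<Rightarrow> (nat multiset \<Rightarrow> 'a list) ring" where
  "poly_W p k d m \<equiv> mpoly_ring (witt_ring p m k) {1..d}"

abbreviation witt_A ::
  "nat \<Rightarrow> ('a, 'b) ring_scheme \<Rightarrow> nat \<Rightarrow> nat \<Rightarrow> (nat multiset \<Rightarrow> 'a) list ring" where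
  "witt_A p k d m \<equiv> witt_ring p m (poly_A k d)"

text \<open>
  The reduction \<open>A\<^sub>m \<rightarrow> A\<close> is the first Witt component (\<open>hd\<close>) on every coefficient. The choice
  of the lift does not affect \<open>ghost_lift\<close> below.
\<close>

definition poly_lift ::
  "nat \<Rightarrow> ('a, 'b) ring_scheme \<Rightarrow> nat \<Rightarrow> nat \<Rightarrow> (nat multiset \<Rightarrow> 'a) \<Rightarrow> (nat multiset \<Rightarrow> 'a list)" where
  "poly_lift p k d m f = (SOME g. g \<in> carrier (poly_W p k d m) \<and> (\<forall>M. hd (g M) = f M))"

text \<open>The map \<open>W\<^sub>m(A) \<rightarrow> A\<^sub>m\<close> built from the ghost component of index \<open>m - 1\<close>.\<close>

definition ghost_lift ::
  "nat \<Rightarrow> ('a, 'b) ring_scheme \<Rightarrow> nat \<Rightarrow> nat \<Rightarrow> (nat multiset \<Rightarrow> 'a) list \<Rightarrow> (nat multiset \<Rightarrow> 'a list)" where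
  "ghost_lift p k d m fs =
     (\<Oplus>\<^bsub>poly_W p k d m\<^esub>i \<in> {..<m}.
        [(p ^ i)] \<cdot>\<^bsub>poly_W p k d m\<^esub>
          (poly_lift p k d m (fs ! i) [^]\<^bsub>poly_W p k d m\<^esub> (p ^ (m - 1 - i))))"

definition witt_deriv ::
  "nat \<Rightarrow> ('a, 'b) ring_scheme \<Rightarrow> nat \<Rightarrow> nat \<Rightarrow> nat \<Rightarrow> nat \<Rightarrow>
     (nat multiset \<Rightarrow> 'a) list \<Rightarrow> (nat multiset \<Rightarrow> 'a) list" where
  "witt_deriv p k d m j r =
     (THE D. D \<in> carrier (witt_A p k d m) \<rightarrow>\<^sub>E carrier (witt_A p k d m) \<and>
        (\<forall>x \<in> carrier (witt_A p k d m).
           ghost_lift p k d m (D x) = hasse_deriv (witt_ring p m k) j r (ghost_lift p k d m x)))"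

text \<open>The operator with exponent \<open>r/p\<close>.\<close>

definition witt_deriv_div ::
  "nat \<Rightarrow> ('a, 'b) ring_scheme \<Rightarrow> nat \<Rightarrow> nat \<Rightarrow> nat \<Rightarrow> nat \<Rightarrow>
     (nat multiset \<Rightarrow> 'a) list \<Rightarrow> (nat multiset \<Rightarrow> 'a) list" where
  "witt_deriv_div p k d m j r =
     (if p dvd r then witt_deriv p k d m j (r div p) else (\<lambda>x. \<zero>\<^bsub>witt_A p k d m\<^esub>))"

text \<open>
  \<open>\<partial>\<^sub>1\<^bsup>[r\<^sub>1]\<^esup> \<circ> \<dots> \<circ> \<partial>\<^sub>d\<^bsup>[r\<^sub>d]\<^esup>\<close>; only the values of \<open>r\<close> on \<open>{1..d}\<close> matter.
\<close>

definition witt_multi_deriv ::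
  "nat \<Rightarrow> ('a, 'b) ring_scheme \<Rightarrow> nat \<Rightarrow> nat \<Rightarrow> (nat \<Rightarrow> nat) \<Rightarrow>
     (nat multiset \<Rightarrow> 'a) list \<Rightarrow> (nat multiset \<Rightarrow> 'a) list" where
  "witt_multi_deriv p k d m r = foldr (\<lambda>j D. witt_deriv p k d m j (r j) \<circ> D) [1..<Suc d] id"

definition witt_multi_deriv_div ::
  "nat \<Rightarrow> ('a, 'b) ring_scheme \<Rightarrow> nat \<Rightarrow> nat \<Rightarrow> (nat \<Rightarrow> nat) \<Rightarrow>
     (nat multiset \<Rightarrow> 'a) list \<Rightarrow> (nat multiset \<Rightarrow> 'a) list" where
  "witt_multi_deriv_div p k d m r =
     (if \<forall>j\<in>{1..d}. p dvd r j then witt_multi_deriv p k d m (\<lambda>j. r j div p)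
      else (\<lambda>x. \<zero>\<^bsub>witt_A p k d m\<^esub>))"

end

theory Submission
  imports
    Defs
    "HOL-Computational_Algebra.Polynomial"
    "HOL-Library.Function_Algebras"
begin

text \<open>
  Write \<open>W\<^sub>m\<close> for the Witt vectors of length \<open>m\<close> of \<open>k\<close>, and \<open>A\<^sub>m = W\<^sub>m[t\<^sub>1, \<dots>, t\<^sub>d]\<close>. Division by \<open>p\<close> is ambiguous
  in \<open>A\<^sub>m\<close>, so the argument takes place over a torsion-free ring. Let \<open>P\<close> be the polynomial ring over
  the integers with one indeterminate for each sequence of elements of \<open>k\<close>. It maps onto every
  \<open>W\<^sub>m\<close>; let \<open>J\<^sub>m\<close> be the kernel. Then \<open>p a \<in> J\<^sub>m\<^sub>+\<^sub>1\<close> iff \<open>a \<in> J\<^sub>m\<close>, and \<open>J\<^sub>1 = p P + J\<^sub>m\<close> for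
  \<open>m \<ge> 1\<close> because \<open>k\<close> is perfect. The substitution that raises all sequences to the \<open>p\<close>-th
  power is an endomorphism \<open>\<sigma>\<close> of \<open>P\<close> that lifts the Frobenius. An equation in \<open>A\<^sub>m\<close> is a congruence modulo \<open>J\<^sub>m\<close> in
  \<open>D = P[t\<^sub>1, \<dots>, t\<^sub>d]\<close>, and a Witt vector over \<open>A = k[t\<^sub>1, \<dots>, t\<^sub>d]\<close> is a family \<open>g\<close> of elements of \<open>D\<close>
  modulo \<open>J\<^sub>1\<close>. Its ghost component is \<open>w\<^sub>m(g) = \<Sum>i<m. p\<^sup>i g\<^sub>i^(p^(m-1-i))\<close>, and
  \<open>w\<^sub>m\<^sub>+\<^sub>1(g) = g\<^sub>0^(p^m) + p w\<^sub>m(g\<^sub>1, g\<^sub>2, \<dots>)\<close>. By induction along this recursion, \<open>w\<^sub>m\<close> is well defined and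
  injective as a map to \<open>D\<close> modulo \<open>J\<^sub>m\<close> (\<open>mcong_witt_ghost\<close>, \<open>mcong_witt_ghost_inj\<close>).

  The key point is a description of the image of \<open>w\<^sub>m\<close>: modulo \<open>J\<^sub>m\<close>, it consists of the polynomials
  whose coefficient \<open>h\<^sub>s\<close> at each monomial \<open>t\<^sup>s\<close> satisfies \<open>p^(m-1) dvd s\<^sub>j h\<^sub>s\<close> for all \<open>j\<close>. The Euler
  operators \<open>t\<^sub>j \<partial>/\<partial>t\<^sub>j\<close> show that the image satisfies this condition (\<open>ghost_divisible_witt_ghost\<close>);
  the converse (\<open>ghost_divisible_imp_ex_witt_ghost\<close>) uses that \<open>k\<close> is perfect. The condition is
  stable under \<open>\<partial>\<^sub>j\<^bsup>[r]\<^esup>\<close>, because \<open>s (s + r choose r) = (s + r) (s + r - 1 choose s - 1)\<close>. Hence the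
  operators on Witt vectors exist.

  The relation with \<open>V\<close> is the formula \<open>w\<^sub>m\<^sub>+\<^sub>1(0, g) = p w\<^sub>m(g)\<close>, and the statement on \<open>V\<^sup>i\<close> is its
  iteration. For the other two relations let \<open>\<phi>\<close> be the endomorphism of \<open>D\<close> that is \<open>\<sigma>\<close> on \<open>P\<close> and
  sends \<open>t\<^sub>j\<close> to \<open>t\<^sub>j\<^sup>p\<close>. It represents the Frobenius of \<open>A\<close>, so that \<open>w\<^sub>m(\<phi> g) = \<phi> w\<^sub>m(g)\<close>, and
  \<open>w\<^sub>m\<^sub>+\<^sub>1(g)\<close> is congruent to \<open>\<phi> w\<^sub>m(g)\<close> modulo \<open>J\<^sub>m\<close>. Both relations therefore reduce to the congruence
  of \<open>\<partial>\<^sub>j\<^bsup>[r]\<^esup> \<phi>\<close> with \<open>\<phi> \<partial>\<^sub>j\<^bsup>[r/p]\<^esup>\<close> on the image of \<open>w\<^sub>m\<close> (\<open>mcong_mpoly_hasse_frob_dvd\<close>,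
  \<open>mcong_mpoly_hasse_frob_not_dvd\<close>). It follows from the description of the image and from two facts
  on binomial coefficients: \<open>p a choose p r\<close> is congruent to \<open>a choose r\<close> modulo \<open>p^(v+1)\<close> if \<open>p^v\<close>
  divides \<open>a\<close>, and \<open>r (p a choose r)\<close> is a multiple of \<open>p a\<close>.

  That the sum and product polynomials define a commutative ring \<open>W\<^sub>m(R)\<close> at all is Dwork's lemma: over
  a polynomial ring over the integers, the sequences of ghost components form a subring of the product
  ring, and \<open>W\<^sub>m(R)\<close> is an image of such a subring (\<open>ring_image_witt_eval\<close>).
\<close>

section \<open>Congruences modulo powers of a prime\<close>

abbreviation lookup :: "('m \<Rightarrow>\<^sub>0 'c::zero) \<Rightarrow> 'm \<Rightarrow> 'c" where
  "lookup \<equiv> Poly_Mapping.lookup"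

lemma freshmans_dream:
  fixes a b :: "'c::comm_ring_1"
  assumes "prime p"
  shows "of_nat p dvd (a + b) ^ p - (a ^ p + b ^ p)"
proof -
  have p: "p > 1" using assms prime_gt_1_nat by blast
  have "{..p} = insert 0 (insert p {1..<p})" using p by auto
  then have "(a + b) ^ p = a ^ p + b ^ p
      + (\<Sum>i\<in>{1..<p}. of_nat (p choose i) * a ^ i * b ^ (p - i))"
    using p by (simp add: binomial_ring algebra_simps)
  moreover have "of_nat p dvd (\<Sum>i\<in>{1..<p}. of_nat (p choose i) * a ^ i * b ^ (p - i))"
  proof (rule dvd_sum)
    fix i assume i: "i \<in> {1..<p}"
    then have "p dvd (p choose i)" using assms by (intro dvd_choose_prime) auto
    then have "of_nat p dvd (of_nat (p choose i) :: 'c)" by (metis dvd_def of_nat_mult)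
    then show "of_nat p dvd of_nat (p choose i) * a ^ i * b ^ (p - i)" by auto
  qed
  ultimately show ?thesis by simp
qed

lemma dvd_power_diff:
  fixes a b :: "'c::comm_ring_1"
  assumes "d dvd a - b"
  shows "d dvd a ^ n - b ^ n"
  using assms by (metis dvd_mult2 power_diff_sumr2)

lemma p_power_dvd_power_diff_Suc:
  fixes a b :: "'c::comm_ring_1"
  assumes "of_nat p ^ Suc l dvd a - b"
  shows "of_nat p ^ Suc (Suc l) dvd a ^ p - b ^ p"
proof -
  have d: "of_nat p dvd a - b" using assms by (metis dvd_mult_left power_Suc)
  have "of_nat p dvd (\<Sum>i<p. b ^ (p - Suc i) * a ^ i)"
  proof -
    have "(\<Sum>i<p. b ^ (p - Suc i) * a ^ i) =
        (\<Sum>i<p. b ^ (p - Suc i) * (a ^ i - b ^ i)) + (\<Sum>i<p. b ^ (p - 1))"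
      by (simp add: sum.distrib [symmetric] algebra_simps power_add [symmetric] del: sum_constant)
    moreover have "of_nat p dvd (\<Sum>i<p. b ^ (p - Suc i) * (a ^ i - b ^ i))"
      by (intro dvd_sum dvd_mult dvd_power_diff d)
    ultimately show ?thesis by simp
  qed
  then show ?thesis
    using assms
      mult_dvd_mono[of "of_nat p ^ Suc l" "a - b" "of_nat p" "\<Sum>i<p. b ^ (p - Suc i) * a ^ i"]
    by (simp only: power_diff_sumr2 power_Suc2 [of _ "Suc l"])
qed

lemma p_power_dvd_power_diff:
  fixes a b :: "'c::comm_ring_1"
  assumes "of_nat p dvd a - b"
  shows "of_nat p ^ Suc l dvd a ^ (p ^ l) - b ^ (p ^ l)"
proof (induction l)
  case (Suc l)
  then show ?case
    using p_power_dvd_power_diff_Suc[OF Suc] by (simp add: power_mult [symmetric] mult.commute)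
qed (use assms in simp)

text \<open>
  Compare the coefficients of \<open>X^(p r)\<close> in \<open>((1 + X)^p)^a\<close> and \<open>(1 + X^p)^a\<close>, where \<open>(1 + X)^p\<close> and
  \<open>1 + X^p\<close> agree modulo \<open>p\<close>.
\<close>

lemma p_power_dvd_binomial_diff:
  assumes "prime p" "p ^ v dvd a"
  shows "int p ^ Suc v dvd int ((p * a) choose (p * r)) - int (a choose r)"
proof -
  obtain u where u: "a = p ^ v * u" using assms(2) by blast
  define F G :: "int poly" where "F = 1 + Polynomial.monom 1 1" and "G = 1 + Polynomial.monom 1 p"
  have p0: "p > 0" using assms(1) prime_gt_0_nat by blast
  have "of_nat p dvd F ^ p - G"
    using freshmans_dream[OF assms(1), of 1 "Polynomial.monom 1 1 :: int poly"]
    by (simp add: F_def G_def monom_power)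
  then have "of_nat p ^ Suc v dvd (F ^ p) ^ (p ^ v) - G ^ (p ^ v)"
    by (rule p_power_dvd_power_diff)
  then have "of_nat p ^ Suc v dvd ((F ^ p) ^ (p ^ v)) ^ u - (G ^ (p ^ v)) ^ u"
    by (rule dvd_power_diff)
  then have "of_nat p ^ Suc v dvd F ^ (p * a) - G ^ a"
    by (simp only: power_mult [symmetric] u mult.assoc)
  then have "[:int p ^ Suc v:] dvd F ^ (p * a) - G ^ a"
    by (simp only: of_nat_poly poly_const_pow of_nat_id)
  then have d: "int p ^ Suc v dvd Polynomial.coeff (F ^ (p * a) - G ^ a) (p * r)"
    by (simp only: const_poly_dvd_iff)
  have coeff_binom: "Polynomial.coeff ((1 + Polynomial.monom 1 q :: int poly) ^ N) (q * s) =
    int (N choose s)"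
    if "q > 0" for q N s :: nat
  proof -
    have "(1 + Polynomial.monom 1 q :: int poly) ^ N = (Polynomial.monom 1 q + 1) ^ N"
      by (simp add: add.commute)
    also have "\<dots> = (\<Sum>i\<le>N. of_nat (N choose i) * Polynomial.monom 1 (q * i))"
      by (simp add: binomial_ring monom_power)
    also have "Polynomial.coeff \<dots> (q * s) = (\<Sum>i\<le>N. if i = s then int (N choose i) else 0)"
      unfolding coeff_sum using that by (intro sum.cong refl) (auto simp: of_nat_poly)
    also have "\<dots> = int (N choose s)" by (simp add: binomial_eq_0)
    finally show ?thesis .
  qed
  have "Polynomial.coeff (F ^ (p * a)) (p * r) = int ((p * a) choose (p * r))"
    using coeff_binom[of 1 "p * a" "p * r"] by (simp add: F_def)
  moreover have "Polynomial.coeff (G ^ a) (p * r) = int (a choose r)"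
    using coeff_binom[OF p0] by (simp add: G_def)
  ultimately show ?thesis using d by simp
qed

lemma dvd_of_nat_mult_coprime:
  fixes x :: "'c::comm_ring_1"
  assumes "coprime u q" "of_nat q dvd of_nat u * x"
  shows "of_nat q dvd x"
proof -
  have "coprime (int u) (int q)" using assms(1) by simp
  then obtain a b where ab: "a * int u + b * int q = 1"
    by (metis bezout_int coprime_imp_gcd_eq_1)
  have "x = of_int (a * int u + b * int q) * x" by (simp add: ab)
  also have "\<dots> = of_int a * (of_nat u * x) + of_nat q * (of_int b * x)"
    by (simp add: algebra_simps)
  finally show ?thesis using assms(2) by (metis dvd_add dvd_mult dvd_triv_left)
qed

section \<open>Polynomials as finitely supported functions on monomials\<close>

lemma poly_mapping_add_induct [case_names zero single add]:
  fixes f :: "'m \<Rightarrow>\<^sub>0 'c::comm_monoid_add"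
  assumes "P 0" "\<And>s c. P (Poly_Mapping.single s c)" "\<And>f g. P f \<Longrightarrow> P g \<Longrightarrow> P (f + g)"
  shows "P f"
proof (induction f rule: Poly_Mapping.update_induct)
  case (update f a b)
  have "Poly_Mapping.update a b f = f + Poly_Mapping.single a b"
    using update(1) by (intro poly_mapping_eqI)
      (auto simp: lookup_update lookup_add lookup_single when_def in_keys_iff)
  then show ?case using assms update by metis
qed (use assms in simp)

lemma finite_submultisets: "finite {N. N \<subseteq># M}"
proof (induction M)
  case (add x M)
  have "{N. N \<subseteq># add_mset x M} \<subseteq> {N. N \<subseteq># M} \<union> add_mset x ` {N. N \<subseteq># M}"
  proof
    fix N assume N: "N \<in> {N. N \<subseteq># add_mset x M}"
    show "N \<in> {N. N \<subseteq># M} \<union> add_mset x ` {N. N \<subseteq># M}"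
    proof (cases "x \<in># N")
      case True
      then obtain N' where "N = add_mset x N'" by (metis insert_DiffM)
      then show ?thesis using N by auto
    next
      case False
      then have "N \<subseteq># M" using N
        by (metis Diff_eq_empty_iff_mset add_mset_remove_trivial diff_single_trivial mem_Collect_eq
            minus_add_mset_if_not_in_lhs)
      then show ?thesis by auto
    qed
  qed
  then show ?case using add by (meson finite_UnI finite_imageI finite_subset)
qed simp

lemma repeat_mset_eq_iff: "p > 0 \<Longrightarrow> repeat_mset p M = repeat_mset p N \<longleftrightarrow> M = N"
  by (metis multiset_eqI count_repeat_mset mult_cancel1 neq0_conv)

lemma ex_repeat_mset_iff:
  assumes "q > 0"
  shows "(\<exists>t. s = repeat_mset q t) \<longleftrightarrow> (\<forall>j. q dvd count s j)"
proof
  assume dvd: "\<forall>j. q dvd count s j"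
  have "finite {j. 0 < count s j div q}"
    by (rule finite_subset[OF _ finite_set_mset[of s]])
      (auto simp: div_greater_zero_iff intro!: count_inI)
  then have "s = repeat_mset q (Abs_multiset (\<lambda>j. count s j div q))"
    using dvd by (intro multiset_eqI) (simp add: Abs_multiset_inverse)
  then show "\<exists>t. s = repeat_mset q t" by blast
qed auto

lemma lookup_times_mset:
  fixes f g :: "'v multiset \<Rightarrow>\<^sub>0 'c::comm_ring_1"
  shows "lookup (f * g) M = (\<Sum>N\<in>{N. N \<subseteq># M}. lookup f N * lookup g (M - N))"
proof (induction f rule: poly_mapping_add_induct)
  case (single s c)
  show ?case
  proof (induction g rule: poly_mapping_add_induct)
    case (single t d)
    have "(\<Sum>N\<in>{N. N \<subseteq># M}. lookup (Poly_Mapping.single s c) N * lookup (Poly_Mapping.single t d)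
      (M - N))
      = (\<Sum>N\<in>{N. N \<subseteq># M}. if N = s then (if M = s + t then c * d else 0) else 0)"
      by (intro sum.cong) (auto simp: lookup_single when_def)
    also have "\<dots> = (if M = s + t then c * d else 0)"
      by (auto simp: finite_submultisets)
    finally show ?case by (simp add: mult_single lookup_single when_def)
  next
    case (add f g)
    then show ?case by (simp add: lookup_add algebra_simps sum.distrib)
  qed auto
next
  case (add f g)
  then show ?case by (simp add: lookup_add algebra_simps sum.distrib)
qed auto

text \<open>
  The ghost component of index \<open>m - 1\<close>, which involves the first \<open>m\<close> members of \<open>g\<close>. Counting
  members instead of using the index makes \<open>m = 0\<close> the start of inductions.
\<close>

definition witt_ghost :: "nat \<Rightarrow> nat \<Rightarrow> (nat \<Rightarrow> 'c::comm_ring_1) \<Rightarrow> 'c" where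
  "witt_ghost p m g = (\<Sum>i<m. of_nat p ^ i * g i ^ (p ^ (m - 1 - i)))"

lemma witt_ghost_0 [simp]: "witt_ghost p 0 g = 0"
  by (simp add: witt_ghost_def)

lemma witt_ghost_Suc:
  "witt_ghost p (Suc m) g = g 0 ^ (p ^ m) + of_nat p * witt_ghost p m (\<lambda>i. g (Suc i))"
  unfolding witt_ghost_def
  by (simp add: sum.lessThan_Suc_shift sum_distrib_left mult.assoc del: sum.lessThan_Suc)

lemma witt_ghost_Suc_powers:
  "witt_ghost p (Suc m) g = witt_ghost p m (\<lambda>i. g i ^ p) + of_nat p ^ m * g m"
proof -
  have "of_nat p ^ i * g i ^ (p ^ (m - i)) = of_nat p ^ i * (g i ^ p) ^ (p ^ (m - 1 - i))"
    if "i < m" for i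
    using that by (simp add: power_mult [symmetric] power_Suc [symmetric] Suc_diff_Suc del: power_Suc)
  then show ?thesis by (simp add: witt_ghost_def)
qed

text \<open>
  Polynomials in the variables of \<open>I\<close>. The coefficient ring is a type, while the set of variables is
  not, since \<open>{1..d}\<close> depends on \<open>d\<close>.
\<close>

definition supported_in :: "'v set \<Rightarrow> ('v multiset \<Rightarrow>\<^sub>0 'c::zero) \<Rightarrow> bool" where
  "supported_in I f \<longleftrightarrow> (\<forall>s. \<not> set_mset s \<subseteq> I \<longrightarrow> lookup f s = 0)"

lemma supported_in_0 [simp]: "supported_in I 0"
  by (simp add: supported_in_def)

lemma supported_in_single: "set_mset s \<subseteq> I \<Longrightarrow> supported_in I (Poly_Mapping.single s c)"
  by (auto simp: supported_in_def lookup_single when_def)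

lemma supported_in_of_nat [simp]:
  "supported_in I (of_nat n :: 'v multiset \<Rightarrow>\<^sub>0 'c::comm_ring_1)"
  by (auto simp: supported_in_def lookup_of_nat when_def)

lemma supported_in_1 [simp]:
  "supported_in I (1 :: 'v multiset \<Rightarrow>\<^sub>0 'c::comm_ring_1)"
  using supported_in_of_nat[of I 1] by simp

lemma supported_in_add: "supported_in I f \<Longrightarrow> supported_in I g \<Longrightarrow> supported_in I (f + g)"
  by (auto simp: supported_in_def lookup_add)

lemma supported_in_uminus:
  fixes f :: "'v multiset \<Rightarrow>\<^sub>0 'c::comm_ring_1"
  shows "supported_in I f \<Longrightarrow> supported_in I (- f)"
  by (auto simp: supported_in_def)

lemma supported_in_mult:
  fixes f g :: "'v multiset \<Rightarrow>\<^sub>0 'c::comm_ring_1"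
  assumes "supported_in I f" "supported_in I g"
  shows "supported_in I (f * g)"
  unfolding supported_in_def
proof (intro allI impI)
  fix s assume s: "\<not> set_mset s \<subseteq> I"
  have "lookup f N * lookup g (s - N) = 0" if "N \<subseteq># s" for N
  proof (cases "set_mset N \<subseteq> I")
    case True
    then have "\<not> set_mset (s - N) \<subseteq> I"
      using s that by (metis Un_subset_iff set_mset_union subset_mset.add_diff_inverse)
    then show ?thesis using assms by (simp add: supported_in_def)
  qed (use assms in \<open>simp add: supported_in_def\<close>)
  then show "lookup (f * g) s = 0" by (simp add: lookup_times_mset)
qed

lemma supported_in_sum:
  "(\<And>i. i \<in> A \<Longrightarrow> supported_in I (f i)) \<Longrightarrow> supported_in I (sum f A)"
  by (induction A rule: infinite_finite_induct) (auto intro: supported_in_add)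

lemma supported_in_power:
  fixes f :: "'v multiset \<Rightarrow>\<^sub>0 'c::comm_ring_1"
  shows "supported_in I f \<Longrightarrow> supported_in I (f ^ n)"
  by (induction n) (auto intro: supported_in_mult)

lemma supported_in_witt_ghost:
  fixes g :: "nat \<Rightarrow> 'v multiset \<Rightarrow>\<^sub>0 'c::comm_ring_1"
  assumes "\<And>i. i < m \<Longrightarrow> supported_in I (g i)"
  shows "supported_in I (witt_ghost p m g)"
  unfolding witt_ghost_def
  using assms by (intro supported_in_sum supported_in_mult supported_in_power) auto

lemma lookup_of_nat_mult:
  fixes f :: "'m::comm_monoid_add \<Rightarrow>\<^sub>0 'c::comm_ring_1"
  shows "lookup (of_nat n * f) s = of_nat n * lookup f s"
  by (induction n) (auto simp: lookup_add algebra_simps)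

text \<open>
  The operator \<open>\<partial>\<^sub>j\<^bsup>[r]\<^esup>\<close>, in the form of \<open>hasse_deriv\<close>, for coefficients in a type.
\<close>

definition mpoly_hasse :: "'v \<Rightarrow> nat \<Rightarrow> ('v multiset \<Rightarrow>\<^sub>0 'c::comm_ring_1) \<Rightarrow> 'v multiset \<Rightarrow>\<^sub>0 'c" where
  "mpoly_hasse j r f = Poly_Mapping.mapp (\<lambda>M c. of_nat ((count M j + r) choose r) * c)
     (Poly_Mapping.map_key (\<lambda>M. M + replicate_mset r j) f)"

lemma lookup_mpoly_hasse:
  "lookup (mpoly_hasse j r f) M =
     of_nat ((count M j + r) choose r) * lookup f (M + replicate_mset r j)"
proof -
  have "inj (\<lambda>M. M + replicate_mset r j)" by (simp add: inj_def)
  then show ?thesis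
    by (auto simp: mpoly_hasse_def lookup_mapp when_def in_keys_iff map_key.rep_eq)
qed

lemma supported_in_mpoly_hasse: "supported_in I f \<Longrightarrow> supported_in I (mpoly_hasse j r f)"
  by (auto simp: supported_in_def lookup_mpoly_hasse)

text \<open>
  The Euler operator \<open>t\<^sub>j \<partial>/\<partial>t\<^sub>j\<close>, a derivation that multiplies each monomial by its exponent of \<open>t\<^sub>j\<close>.
\<close>

definition mpoly_euler :: "'v \<Rightarrow> ('v multiset \<Rightarrow>\<^sub>0 'c::comm_ring_1) \<Rightarrow> 'v multiset \<Rightarrow>\<^sub>0 'c" where
  "mpoly_euler j f = Poly_Mapping.mapp (\<lambda>M c. of_nat (count M j) * c) f"

lemma lookup_mpoly_euler: "lookup (mpoly_euler j f) M = of_nat (count M j) * lookup f M"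
  by (auto simp: mpoly_euler_def lookup_mapp when_def in_keys_iff)

lemma mpoly_euler_mult: "mpoly_euler j (f * g) = mpoly_euler j f * g + f * mpoly_euler j g"
proof (rule poly_mapping_eqI)
  fix M
  have "of_nat (count M j) * (lookup f N * lookup g (M - N)) =
      of_nat (count N j) * lookup f N * lookup g (M - N)
      + lookup f N * (of_nat (count (M - N) j) * lookup g (M - N))" if "N \<subseteq># M" for N
  proof -
    have "count M j = count N j + count (M - N) j"
      using that by (metis count_union subset_mset.add_diff_inverse)
    then show ?thesis by (simp add: algebra_simps)
  qed
  then show "lookup (mpoly_euler j (f * g)) M = lookup (mpoly_euler j f * g + f * mpoly_euler j g) M"
    by (simp add: lookup_mpoly_euler lookup_add lookup_times_mset sum_distrib_left sum.distrib
      [symmetric])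
qed

lemma mpoly_euler_power: "mpoly_euler j (f ^ n) = of_nat n * (f ^ (n - 1) * mpoly_euler j f)"
proof (induction n)
  case 0
  show ?case by (intro poly_mapping_eqI) (auto simp: lookup_mpoly_euler lookup_one when_def)
next
  case (Suc n)
  then show ?case
    by (cases n) (simp_all add: mpoly_euler_mult algebra_simps)
qed

section \<open>Torsion-free rings with a lift of the Frobenius\<close>

text \<open>
  The properties of the kernels \<open>J m\<close> of compatible surjections of a torsion-free ring onto the rings
  \<open>W\<^sub>m\<close> of a perfect ring, and of an endomorphism \<open>\<sigma>\<close> that induces the Frobenius on them.
\<close>

locale frobenius_lift =
  fixes p :: nat and J :: "nat \<Rightarrow> 'c::comm_ring_1 set" and \<sigma> :: "'c \<Rightarrow> 'c"
  assumes prime_p: "prime p"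
    and p_torsion_free: "of_nat p * a = 0 \<Longrightarrow> a = 0"
    and J_zero: "0 \<in> J m"
    and J_add: "a \<in> J m \<Longrightarrow> b \<in> J m \<Longrightarrow> a + b \<in> J m"
    and J_mult: "a \<in> J m \<Longrightarrow> c * a \<in> J m"
    and J_0: "J 0 = UNIV"
    and J_Suc: "J (Suc m) \<subseteq> J m"
    and p_mult_J: "of_nat p * a \<in> J (Suc m) \<longleftrightarrow> a \<in> J m"
    and J_1: "a \<in> J 1 \<Longrightarrow> \<exists>b. a - of_nat p * b \<in> J m"
    and \<sigma>_add: "\<sigma> (a + b) = \<sigma> a + \<sigma> b"
    and \<sigma>_mult: "\<sigma> (a * b) = \<sigma> a * \<sigma> b"
    and \<sigma>_one: "\<sigma> 1 = 1"
    and \<sigma>_J: "\<sigma> a \<in> J m \<longleftrightarrow> a \<in> J m"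
    and \<sigma>_power: "\<sigma> a - a ^ p \<in> J 1"
    and perfect: "\<exists>b. a - b ^ p \<in> J 1"
begin

lemma p_pos: "p > 0" and p_gt_1: "p > 1"
  using prime_p prime_gt_0_nat prime_gt_1_nat by auto

lemma J_uminus: "a \<in> J m \<Longrightarrow> - a \<in> J m"
  using J_mult[of a m "-1"] by simp

lemma J_diff: "a \<in> J m \<Longrightarrow> b \<in> J m \<Longrightarrow> a - b \<in> J m"
  using J_add[of a m "- b"] J_uminus by simp

lemma J_sum: "(\<And>i. i \<in> A \<Longrightarrow> f i \<in> J m) \<Longrightarrow> sum f A \<in> J m"
  by (induction A rule: infinite_finite_induct) (auto intro: J_add J_zero)

lemma J_mono: "m \<le> n \<Longrightarrow> J n \<subseteq> J m"
  by (rule lift_Suc_antimono_le[of J]) (use J_Suc in auto)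

lemma p_power_in_J: "of_nat p ^ m \<in> J m"
  by (induction m) (auto simp: J_0 p_mult_J)

lemma p_power_dvd_in_J: "of_nat p ^ m dvd a \<Longrightarrow> a \<in> J m"
  using J_mult[OF p_power_in_J] by (auto simp: dvd_def mult.commute)

lemma \<sigma>_0: "\<sigma> 0 = 0"
  using \<sigma>_add[of 0 0] by simp

lemma \<sigma>_of_nat: "\<sigma> (of_nat n) = of_nat n"
  by (induction n) (auto simp: \<sigma>_0 \<sigma>_add \<sigma>_one)

lemma \<sigma>_uminus: "\<sigma> (- a) = - \<sigma> a"
  by (metis \<sigma>_0 \<sigma>_add add.right_inverse minus_unique)

lemma \<sigma>_diff: "\<sigma> (a - b) = \<sigma> a - \<sigma> b"
  by (metis \<sigma>_add \<sigma>_uminus diff_conv_add_uminus)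

lemma p_power_Suc_dvd_cancel:
  assumes "of_nat p ^ Suc i dvd of_nat p * (a :: 'c)"
  shows "of_nat p ^ i dvd a"
proof -
  obtain b where "of_nat p * a = of_nat p ^ Suc i * b" using assms by blast
  then have "of_nat p * (a - of_nat p ^ i * b) = 0" by (simp add: algebra_simps)
  then have "a = of_nat p ^ i * b" using p_torsion_free by force
  then show ?thesis by simp
qed

lemma p_power_dvd_coprime_cancel:
  assumes "\<not> p dvd u" "of_nat p ^ i dvd of_nat u * (a :: 'c)"
  shows "of_nat p ^ i dvd a"
proof -
  have "coprime u (p ^ i)"
    using assms(1) prime_p by (metis coprime_commute coprime_power_left_iff prime_imp_coprime)
  then show ?thesis using assms(2) dvd_of_nat_mult_coprime[of u "p ^ i" a] by simp
qed

lemma p_dvd_if_p_power_dvd_mult: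
  assumes "of_nat p ^ m dvd of_nat c * (a :: 'c)" "\<not> p ^ m dvd c"
  shows "of_nat p dvd a"
  using assms
proof (induction m arbitrary: c)
  case 0
  then show ?case by (simp only: power_0 one_dvd)
next
  case (Suc m)
  show ?case
  proof (cases "p dvd c")
    case True
    then obtain c' where c: "c = p * c'" by blast
    have "of_nat p ^ Suc m dvd of_nat p * (of_nat c' * a)"
      using Suc.prems(1) unfolding c of_nat_mult mult.assoc .
    then have "of_nat p ^ m dvd of_nat c' * a" by (rule p_power_Suc_dvd_cancel)
    moreover have "\<not> p ^ m dvd c'"
    proof
      assume "p ^ m dvd c'"
      then have "p ^ Suc m dvd c" unfolding c power_Suc by (intro mult_dvd_mono) auto
      then show False using Suc.prems(2) by contradiction
    qed
    ultimately show ?thesis using Suc.IH by blast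
  next
    case False
    then have "of_nat p ^ Suc m dvd a" using Suc.prems(1) by (rule p_power_dvd_coprime_cancel)
    then show ?thesis by (metis dvd_mult_left power_Suc)
  qed
qed

text \<open>
  The next two lemmas apply with \<open>a\<close> an exponent and \<open>h\<close> the coefficient of a polynomial in the image
  of the ghost map: the divisibility assumed is then the one that characterizes the image.
\<close>

lemma binomial_mult_p_not_dvd:
  assumes "of_nat p ^ i dvd of_nat a * (h :: 'c)" "\<not> p dvd r"
  shows "of_nat p ^ Suc i dvd of_nat ((p * a) choose r) * h"
proof (rule p_power_dvd_coprime_cancel[OF assms(2)])
  have "r > 0" using assms(2) by (metis dvd_0_right gr0I)
  then have *: "r * ((p * a) choose r) = p * a * ((p * a - 1) choose (r - 1))"
    by (rule times_binomial_minus1_eq)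
  have "of_nat r * (of_nat ((p * a) choose r) * h) = of_nat (r * ((p * a) choose r)) * h"
    by (simp add: algebra_simps)
  also have "\<dots> = of_nat p * (of_nat a * h) * of_nat ((p * a - 1) choose (r - 1))"
    unfolding * by (simp add: algebra_simps)
  finally show "of_nat p ^ Suc i dvd of_nat r * (of_nat ((p * a) choose r) * h)"
    using assms(1) by (simp add: mult_dvd_mono)
qed

lemma binomial_mult_p_dvd:
  assumes "of_nat p ^ i dvd of_nat a * (h :: 'c)"
  shows "of_nat p ^ Suc i dvd of_nat ((p * a) choose (p * r)) * h - of_nat (a choose r) * h"
proof (cases "a = 0")
  case True
  then show ?thesis using p_pos by (cases "r = 0") (auto simp: binomial_eq_0)
next
  case False
  define v where "v = multiplicity p a"
  obtain u where u: "a = p ^ v * u" "\<not> p dvd u"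
    using multiplicity_decompose'[of a p] False p_gt_1 unfolding v_def by auto
  have "int p ^ Suc v dvd int ((p * a) choose (p * r)) - int (a choose r)"
    using prime_p u by (intro p_power_dvd_binomial_diff) auto
  then obtain q where q: "int ((p * a) choose (p * r)) - int (a choose r) = int p ^ Suc v * q"
    by blast
  have q': "of_nat ((p * a) choose (p * r)) - of_nat (a choose r) =
    (of_nat p ^ Suc v * of_int q :: 'c)"
    using arg_cong[OF q, of "of_int :: int \<Rightarrow> 'c"] by simp
  \<comment> \<open>The factor \<open>u\<close> turns the missing power of \<open>p\<close> into \<open>a\<close>, which the hypothesis on \<open>h\<close> can absorb.\<close>
  have "of_nat u * (of_nat ((p * a) choose (p * r)) * h - of_nat (a choose r) * h)
      = (of_nat ((p * a) choose (p * r)) - of_nat (a choose r)) * (of_nat u * h)"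
    by (simp add: algebra_simps)
  also have "\<dots> = of_nat p * (of_nat a * h) * of_int q"
    unfolding q' by (simp add: u(1) algebra_simps)
  finally have "of_nat p ^ Suc i dvd
      of_nat u * (of_nat ((p * a) choose (p * r)) * h - of_nat (a choose r) * h)"
    using assms by (simp add: mult_dvd_mono)
  then show ?thesis using u(2) by (rule p_power_dvd_coprime_cancel[rotated])
qed

text \<open>
  Congruence modulo \<open>J m\<close>, coefficient by coefficient.
\<close>

definition mcong :: "nat \<Rightarrow> ('v multiset \<Rightarrow>\<^sub>0 'c) \<Rightarrow> ('v multiset \<Rightarrow>\<^sub>0 'c) \<Rightarrow> bool" where
  "mcong m f g \<longleftrightarrow> (\<forall>s. lookup f s - lookup g s \<in> J m)"

lemma mcong_refl [simp]: "mcong m f f"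
  by (simp add: mcong_def J_zero)

lemma mcong_sym: "mcong m f g \<Longrightarrow> mcong m g f"
  unfolding mcong_def using J_uminus by (metis minus_diff_eq)

lemma mcong_trans: "mcong m f g \<Longrightarrow> mcong m g h \<Longrightarrow> mcong m f h"
  unfolding mcong_def using J_add by (metis diff_add_cancel add_diff_eq)

lemma mcong_add: "mcong m f g \<Longrightarrow> mcong m f' g' \<Longrightarrow> mcong m (f + f') (g + g')"
  unfolding mcong_def lookup_add by (metis J_add add_diff_add)

lemma mcong_mult_left: "mcong m f g \<Longrightarrow> mcong m (h * f) (h * g)"
  unfolding mcong_def lookup_times_mset sum_subtractf [symmetric] right_diff_distrib [symmetric]
  by (intro allI J_sum J_mult) auto

lemma mcong_mult: "mcong m f g \<Longrightarrow> mcong m f' g' \<Longrightarrow> mcong m (f * f') (g * g')"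
  by (metis mcong_mult_left mcong_trans mult.commute)

lemma mcong_power: "mcong m f g \<Longrightarrow> mcong m (f ^ n) (g ^ n)"
  by (induction n) (auto intro: mcong_mult)

lemma mcong_mono: "m \<le> n \<Longrightarrow> mcong n f g \<Longrightarrow> mcong m f g"
  unfolding mcong_def using J_mono by blast

lemma mcong_0: "mcong 0 f g"
  by (simp add: mcong_def J_0)

lemma mcong_p_mult_iff: "mcong (Suc m) (of_nat p * f) (of_nat p * g) \<longleftrightarrow> mcong m f g"
  by (simp add: mcong_def lookup_of_nat_mult right_diff_distrib [symmetric] p_mult_J)

lemma mcong_diff: "mcong m f g \<Longrightarrow> mcong m f' g' \<Longrightarrow> mcong m (f - f') (g - g')"
  unfolding mcong_def lookup_minus using J_diff by (fastforce simp: algebra_simps)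

lemma mcong_if_p_power_dvd:
  assumes "of_nat p ^ m dvd f - g"
  shows "mcong m f g"
proof -
  obtain h where "f - g = of_nat p ^ m * h" using assms by blast
  then have "lookup f s - lookup g s = of_nat p ^ m * lookup h s" for s
    using lookup_of_nat_mult[of "p ^ m" h s] by (simp flip: lookup_minus)
  then show ?thesis by (simp add: mcong_def p_power_dvd_in_J)
qed

text \<open>
  The lift \<open>\<phi>\<close> of the Frobenius to polynomials: \<open>\<sigma>\<close> on coefficients, \<open>t\<^sub>j \<mapsto> t\<^sub>j\<^sup>p\<close> on variables.
\<close>

definition mpoly_frob :: "('v multiset \<Rightarrow>\<^sub>0 'c) \<Rightarrow> 'v multiset \<Rightarrow>\<^sub>0 'c" where
  "mpoly_frob f = (\<Sum>s\<in>Poly_Mapping.keys f. Poly_Mapping.single (repeat_mset p s) (\<sigma> (lookup f s)))"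

lemma mpoly_frob_altdef:
  assumes "finite K" "Poly_Mapping.keys f \<subseteq> K"
  shows "mpoly_frob f = (\<Sum>s\<in>K. Poly_Mapping.single (repeat_mset p s) (\<sigma> (lookup f s)))"
  unfolding mpoly_frob_def using assms
  by (intro sum.mono_neutral_left) (auto simp: in_keys_iff \<sigma>_0)

lemma mpoly_frob_0 [simp]: "mpoly_frob 0 = 0"
  by (simp add: mpoly_frob_def)

lemma mpoly_frob_single: "mpoly_frob (Poly_Mapping.single s c) =
  Poly_Mapping.single (repeat_mset p s) (\<sigma> c)"
  by (subst mpoly_frob_altdef[of "{s}"]) auto

lemma mpoly_frob_add: "mpoly_frob (f + g) = mpoly_frob f + mpoly_frob g"
proof -
  let ?K = "Poly_Mapping.keys f \<union> Poly_Mapping.keys g"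
  have K: "finite ?K" "Poly_Mapping.keys f \<subseteq> ?K" "Poly_Mapping.keys g \<subseteq> ?K"
      "Poly_Mapping.keys (f + g) \<subseteq> ?K"
    using keys_add[of f g] by auto
  show ?thesis
    unfolding mpoly_frob_altdef[OF K(1,2)] mpoly_frob_altdef[OF K(1,3)] mpoly_frob_altdef[OF K(1,4)]
    by (simp add: lookup_add \<sigma>_add single_add sum.distrib)
qed

lemma mpoly_frob_mult: "mpoly_frob (f * g) = mpoly_frob f * mpoly_frob g"
proof (induction f rule: poly_mapping_add_induct)
  case (single s c)
  show ?case
  proof (induction g rule: poly_mapping_add_induct)
    case (single t d)
    have "repeat_mset p (s + t) = repeat_mset p s + repeat_mset p t"
      by (intro multiset_eqI) (simp add: algebra_simps)
    then show ?case by (simp add: mult_single mpoly_frob_single \<sigma>_mult)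
  qed (auto simp: mpoly_frob_add algebra_simps)
qed (auto simp: mpoly_frob_add algebra_simps)

lemma mpoly_frob_1 [simp]: "mpoly_frob 1 = 1"
  using mpoly_frob_single[of "{#}" 1] by (simp add: \<sigma>_one flip: zero_multiset_def)

lemma mpoly_frob_power: "mpoly_frob (f ^ n) = mpoly_frob f ^ n"
  by (induction n) (auto simp: mpoly_frob_mult)

lemma mpoly_frob_of_nat: "mpoly_frob (of_nat n) = of_nat n"
  by (induction n) (auto simp: mpoly_frob_add)

lemma mpoly_frob_sum: "mpoly_frob (sum f A) = (\<Sum>i\<in>A. mpoly_frob (f i))"
  by (induction A rule: infinite_finite_induct) (auto simp: mpoly_frob_add)

lemma mpoly_frob_witt_ghost: "mpoly_frob (witt_ghost p m g) = witt_ghost p m (\<lambda>i. mpoly_frob (g i))"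
  by (simp add: witt_ghost_def mpoly_frob_sum mpoly_frob_mult mpoly_frob_power mpoly_frob_of_nat)

lemma lookup_mpoly_frob_repeat: "lookup (mpoly_frob f) (repeat_mset p s) = \<sigma> (lookup f s)"
  by (induction f rule: poly_mapping_add_induct)
     (auto simp: \<sigma>_0 mpoly_frob_single mpoly_frob_add lookup_add \<sigma>_add lookup_single when_def
        repeat_mset_eq_iff[OF p_pos])

lemma lookup_mpoly_frob_eq_0: "\<not> (\<exists>t. s = repeat_mset p t) \<Longrightarrow> lookup (mpoly_frob f) s = 0"
  by (induction f rule: poly_mapping_add_induct)
     (auto simp: mpoly_frob_single mpoly_frob_add lookup_add lookup_single when_def)

lemma mcong_mpoly_frob_iff: "mcong m (mpoly_frob f) (mpoly_frob g) \<longleftrightarrow> mcong m f g"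
proof
  assume "mcong m (mpoly_frob f) (mpoly_frob g)"
  then have "\<sigma> (lookup f s - lookup g s) \<in> J m" for s
    unfolding mcong_def \<sigma>_diff lookup_mpoly_frob_repeat [symmetric] by blast
  then show "mcong m f g" by (simp add: mcong_def \<sigma>_J)
next
  assume fg: "mcong m f g"
  show "mcong m (mpoly_frob f) (mpoly_frob g)"
    unfolding mcong_def
  proof
    fix s
    show "lookup (mpoly_frob f) s - lookup (mpoly_frob g) s \<in> J m"
    proof (cases "\<exists>t. s = repeat_mset p t")
      case True
      then show ?thesis using fg by (auto simp: lookup_mpoly_frob_repeat mcong_def \<sigma>_J simp flip:
        \<sigma>_diff)
    qed (simp add: lookup_mpoly_frob_eq_0 J_zero)
  qed
qed

lemma mcong_1_mpoly_frob: "mcong 1 (mpoly_frob f) (f ^ p)"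
proof (induction f rule: poly_mapping_add_induct)
  case zero
  then show ?case using p_pos by (simp add: power_0_left)
next
  case (single s c)
  have "Poly_Mapping.single s c ^ n = Poly_Mapping.single (repeat_mset n s) (c ^ n)" for n
    by (induction n) (auto simp: mult_single add.commute simp flip: zero_multiset_def)
  then show ?case
    using \<sigma>_power by (auto simp: mcong_def mpoly_frob_single lookup_single when_def J_zero)
next
  case (add f g)
  have "mcong 1 ((f + g) ^ p) (f ^ p + g ^ p)"
    using freshmans_dream[OF prime_p, of f g] by (intro mcong_if_p_power_dvd) simp
  then show ?case
    using mcong_add[OF add] by (metis mpoly_frob_add mcong_sym mcong_trans)
qed

lemma mcong_1_mpoly_frob_funpow: "mcong 1 ((mpoly_frob ^^ n) f) (f ^ (p ^ n))"
proof (induction n)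
  case (Suc n)
  have "mcong 1 ((mpoly_frob ^^ Suc n) f) (((mpoly_frob ^^ n) f) ^ p)"
    using mcong_1_mpoly_frob by simp
  moreover have "mcong 1 (((mpoly_frob ^^ n) f) ^ p) ((f ^ (p ^ n)) ^ p)"
    using Suc by (rule mcong_power)
  ultimately have "mcong 1 ((mpoly_frob ^^ Suc n) f) ((f ^ (p ^ n)) ^ p)" by (rule mcong_trans)
  then show ?case by (simp only: power_mult [symmetric] mult.commute power_Suc)
qed simp

text \<open>
  The quotient by \<open>J 1\<close> need not be a domain for this: a \<open>p\<close>-th power is congruent to an image of
  \<open>\<phi>\<close>, and \<open>\<phi>\<close> is injective modulo \<open>J 1\<close>.
\<close>

lemma mcong_1_p_power_cancel:
  assumes "mcong 1 (f ^ (p ^ n)) (g ^ (p ^ n))"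
  shows "mcong 1 f g"
proof -
  have "mcong 1 ((mpoly_frob ^^ n) f) ((mpoly_frob ^^ n) g)"
    by (meson assms mcong_1_mpoly_frob_funpow mcong_sym mcong_trans)
  then show ?thesis by (induction n) (auto simp: mcong_mpoly_frob_iff)
qed

lemma mcong_1_obtain:
  assumes "mcong 1 f g"
  obtains h where "mcong m f (g + of_nat p * h)"
proof -
  have "\<exists>b. lookup (f - g) s - of_nat p * b \<in> J m" for s
    using assms J_1 by (auto simp: mcong_def lookup_minus)
  then obtain b where b: "lookup (f - g) s - of_nat p * b s \<in> J m" for s by metis
  define h where "h = Poly_Mapping.mapp (\<lambda>s _. b s) (f - g)"
  have "lookup f s - lookup (g + of_nat p * h) s \<in> J m" for s
  proof (cases "s \<in> Poly_Mapping.keys (f - g)")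
    case True
    then show ?thesis
      using b[of s] by (simp add: h_def lookup_add lookup_of_nat_mult lookup_mapp lookup_minus
        algebra_simps)
  next
    case False
    then have "lookup f s = lookup g s" by (simp add: in_keys_iff lookup_minus)
    then show ?thesis
      using False by (simp add: h_def lookup_add lookup_of_nat_mult lookup_mapp J_zero)
  qed
  then show ?thesis by (intro that[of h]) (simp add: mcong_def)
qed

lemma mcong_p_power:
  assumes "mcong 1 f g"
  shows "mcong (Suc n) (f ^ (p ^ n)) (g ^ (p ^ n))"
proof -
  obtain h where h: "mcong (Suc n) f (g + of_nat p * h)" using mcong_1_obtain[OF assms] .
  have "of_nat p ^ Suc n dvd (g + of_nat p * h) ^ (p ^ n) - g ^ (p ^ n)"
    by (rule p_power_dvd_power_diff) simp
  then show ?thesis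
    using mcong_power[OF h] mcong_if_p_power_dvd mcong_trans by blast
qed

section \<open>The ghost map and its image\<close>

text \<open>
  The ghost map is well defined on families modulo \<open>J 1\<close>.
\<close>

lemma mcong_witt_ghost:
  assumes "\<And>i. i < m \<Longrightarrow> mcong 1 (f i) (g i)"
  shows "mcong m (witt_ghost p m f) (witt_ghost p m g)"
  using assms
proof (induction m arbitrary: f g)
  case (Suc m)
  have "mcong (Suc m) (f 0 ^ (p ^ m)) (g 0 ^ (p ^ m))"
    using Suc.prems by (intro mcong_p_power) auto
  moreover have "mcong m (witt_ghost p m (\<lambda>i. f (Suc i))) (witt_ghost p m (\<lambda>i. g (Suc i)))"
    using Suc.prems by (intro Suc.IH) auto
  ultimately show ?case
    unfolding witt_ghost_Suc by (intro mcong_add) (auto simp: mcong_p_mult_iff)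
qed (simp add: mcong_0)

lemma mcong_witt_ghost_inj:
  assumes "mcong m (witt_ghost p m f) (witt_ghost p m g)" "i < m"
  shows "mcong 1 (f i) (g i)"
  using assms
proof (induction m arbitrary: f g i)
  case (Suc m)
  have p1: "mcong 1 (h + of_nat p * h') h" for h h' :: "'d multiset \<Rightarrow>\<^sub>0 'c"
    by (intro mcong_if_p_power_dvd) simp
  have "mcong 1 (f 0 ^ (p ^ m)) (g 0 ^ (p ^ m))"
    using mcong_mono[OF _ Suc.prems(1), of 1] mcong_trans[OF mcong_sym[OF p1] mcong_trans[OF _ p1]]
    unfolding witt_ghost_Suc by simp
  then have 0: "mcong 1 (f 0) (g 0)" by (rule mcong_1_p_power_cancel)
  have "mcong (Suc m) (of_nat p * witt_ghost p m (\<lambda>i. f (Suc i))) (of_nat p * witt_ghost p m (\<lambda>i. g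
    (Suc i)))"
    using mcong_diff[OF Suc.prems(1) mcong_p_power[OF 0, of m]] unfolding witt_ghost_Suc by simp
  then have "mcong m (witt_ghost p m (\<lambda>i. f (Suc i))) (witt_ghost p m (\<lambda>i. g (Suc i)))"
    by (simp add: mcong_p_mult_iff)
  then show ?case using 0 Suc.IH[of "\<lambda>i. f (Suc i)" "\<lambda>i. g (Suc i)"] Suc.prems(2)
    by (cases i) auto
qed simp

text \<open>
  Modulo \<open>J m\<close> the last summand \<open>p\<^sup>m f\<^sub>m\<close> vanishes, and in the others one factor \<open>p\<close> of the exponent is
  replaced by \<open>\<phi>\<close>.
\<close>

lemma mcong_witt_ghost_Suc_mpoly_frob:
  "mcong m (witt_ghost p (Suc m) f) (mpoly_frob (witt_ghost p m f))"
proof -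
  have "mcong m (witt_ghost p (Suc m) f) (witt_ghost p m (\<lambda>i. f i ^ p))"
    by (intro mcong_if_p_power_dvd) (simp add: witt_ghost_Suc_powers)
  moreover have "mcong m (witt_ghost p m (\<lambda>i. f i ^ p)) (witt_ghost p m (\<lambda>i. mpoly_frob (f i)))"
    by (intro mcong_witt_ghost mcong_sym[OF mcong_1_mpoly_frob])
  ultimately show ?thesis unfolding mpoly_frob_witt_ghost by (rule mcong_trans)
qed

text \<open>
  The condition that characterizes the image of the ghost map modulo \<open>J m\<close>. It says that the coefficient at \<open>t\<^sup>s\<close>
  is divisible by \<open>p^(m - 1 - v)\<close> if \<open>p^v\<close> is the highest power of \<open>p\<close> that divides all exponents
  \<open>s\<^sub>j\<close> and \<open>v < m\<close>; this form avoids valuations.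
\<close>

definition ghost_divisible :: "nat \<Rightarrow> ('v multiset \<Rightarrow>\<^sub>0 'c) \<Rightarrow> bool" where
  "ghost_divisible m h \<longleftrightarrow> (\<forall>s j. of_nat p ^ (m - 1) dvd of_nat (count s j) * lookup h s)"

lemma ghost_divisible_add: "ghost_divisible m f \<Longrightarrow> ghost_divisible m g \<Longrightarrow> ghost_divisible m (f + g)"
  by (simp add: ghost_divisible_def lookup_add distrib_left)

text \<open>
  The Euler operator applied to a \<open>p\<^sup>m\<close>-th power yields a multiple of \<open>p\<^sup>m\<close>.
\<close>

lemma ghost_divisible_p_power: "ghost_divisible (Suc m) (f ^ (p ^ m))"
  unfolding ghost_divisible_def
proof (intro allI)
  fix s j
  have "of_nat (count s j) * lookup (f ^ (p ^ m)) s =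
      of_nat (p ^ m) * lookup (f ^ (p ^ m - 1) * mpoly_euler j f) s"
    unfolding lookup_mpoly_euler [symmetric] mpoly_euler_power lookup_of_nat_mult ..
  then show "of_nat p ^ (Suc m - 1) dvd of_nat (count s j) * lookup (f ^ (p ^ m)) s" by simp
qed

lemma ghost_divisible_Suc_p_mult:
  assumes "ghost_divisible m f"
  shows "ghost_divisible (Suc m) (of_nat p * f)"
  unfolding ghost_divisible_def
proof (intro allI)
  fix s j
  have "of_nat p ^ m dvd of_nat p * (of_nat (count s j) * lookup f s)"
    using assms by (cases m) (auto simp: ghost_divisible_def intro: mult_dvd_mono)
  then show "of_nat p ^ (Suc m - 1) dvd of_nat (count s j) * lookup (of_nat p * f) s"
    by (simp add: lookup_of_nat_mult mult.left_commute)
qed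

lemma ghost_divisible_witt_ghost: "ghost_divisible m (witt_ghost p m f)"
proof (induction m arbitrary: f)
  case 0
  show ?case by (simp add: ghost_divisible_def)
next
  case (Suc m)
  then show ?case unfolding witt_ghost_Suc
    by (intro ghost_divisible_add ghost_divisible_p_power ghost_divisible_Suc_p_mult)
qed

lemma ghost_divisible_mpoly_hasse:
  assumes "ghost_divisible m f"
  shows "ghost_divisible m (mpoly_hasse j r f)"
  unfolding ghost_divisible_def
proof (intro allI)
  fix s i
  let ?t = "s + replicate_mset r j"
  have d: "of_nat p ^ (m - 1) dvd of_nat (count ?t i) * lookup f ?t"
    using assms by (simp only: ghost_divisible_def)
  show "of_nat p ^ (m - 1) dvd of_nat (count s i) * lookup (mpoly_hasse j r f) s"
  proof (cases "i = j")
    case False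
    then have "of_nat (count s i) * lookup (mpoly_hasse j r f) s =
        of_nat ((count s j + r) choose r) * (of_nat (count ?t i) * lookup f ?t)"
      by (simp add: lookup_mpoly_hasse)
    then show ?thesis using d by simp
  next
    case [simp]: True
    show ?thesis
    proof (cases "count s j = 0")
      case False
      \<comment> \<open>\<open>s (s + r choose r) = (s + r) (s + r - 1 choose s - 1)\<close> moves the factor to the exponent before
        differentiation.\<close>
      have "count s j * ((count s j + r) choose r) =
          count s j * ((count s j + r) choose (count s j))"
        by (simp add: binomial_symmetric[of r "count s j + r"])
      also have "\<dots> = (count s j + r) * ((count s j + r - 1) choose (count s j - 1))"
        using False by (intro times_binomial_minus1_eq) auto
      finally have "of_nat (count s i) * lookup (mpoly_hasse j r f) s =
          of_nat ((count s j + r - 1) choose (count s j - 1)) * (of_nat (count ?t i) * lookup f ?t)"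
        by (simp add: lookup_mpoly_hasse mult.assoc [symmetric] flip: of_nat_mult of_nat_add)
          (simp add: mult.commute)
      then show ?thesis using d by simp
    qed simp
  qed
qed

lemma perfect_power: "\<exists>b. a - b ^ (p ^ n) \<in> J 1"
proof (induction n arbitrary: a)
  case 0
  show ?case by (intro exI[of _ a]) (simp add: J_zero)
next
  case (Suc n)
  obtain b where b: "a - b ^ p \<in> J 1" using perfect by blast
  obtain c where c: "b - c ^ (p ^ n) \<in> J 1" using Suc by blast
  have "b ^ p - (c ^ (p ^ n)) ^ p = (\<Sum>i<p. (c ^ (p ^ n)) ^ (p - Suc i) * b ^ i) * (b - c ^ (p ^ n))"
    by (simp add: power_diff_sumr2)
  then have "b ^ p - (c ^ (p ^ n)) ^ p \<in> J 1" using J_mult[OF c] by simp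
  then have "a - (c ^ (p ^ n)) ^ p \<in> J 1" using J_add[OF b] by fastforce
  then show ?case by (intro exI[of _ c]) (simp add: power_mult [symmetric] mult.commute)
qed

lemma \<sigma>_funpow_power: "(\<sigma> ^^ n) a - a ^ (p ^ n) \<in> J 1"
proof -
  have "mcong 1 ((mpoly_frob ^^ n) (Poly_Mapping.single {#} a)) (Poly_Mapping.single {#} a ^ (p ^ n))"
    by (rule mcong_1_mpoly_frob_funpow)
  moreover have "(mpoly_frob ^^ n) (Poly_Mapping.single {#} a) = Poly_Mapping.single {#} ((\<sigma> ^^ n) a)"
    by (induction n) (auto simp: mpoly_frob_single)
  moreover have "Poly_Mapping.single {#} a ^ k = Poly_Mapping.single {#} (a ^ k)" for k
    by (induction k) (auto simp: mult_single simp flip: zero_multiset_def)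
  ultimately show ?thesis unfolding mcong_def by (metis lookup_single_eq)
qed

lemma lookup_mpoly_frob_funpow:
  "lookup ((mpoly_frob ^^ n) f) (repeat_mset (p ^ n) s) = (\<sigma> ^^ n) (lookup f s)"
proof (induction n)
  case (Suc n)
  have "repeat_mset (p ^ Suc n) s = repeat_mset p (repeat_mset (p ^ n) s)" by simp
  then show ?case using Suc by (simp only: funpow.simps comp_apply lookup_mpoly_frob_repeat)
qed simp

text \<open>
  An approximation of the \<open>p\<^sup>m\<close>-th root of the part of \<open>h\<close> that involves only \<open>p\<^sup>m\<close>-th powers of the
  variables: the roots of the coefficients exist modulo \<open>J 1\<close>.
\<close>

lemma approximate_p_power_root:
  fixes h :: "'v multiset \<Rightarrow>\<^sub>0 'c"
  assumes "supported_in I h"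
  obtains g where "supported_in I g"
    "\<And>s. lookup (h - g ^ (p ^ m)) (repeat_mset (p ^ m) s) \<in> J 1"
proof -
  have q: "p ^ m > 0" using p_pos by simp
  have "\<forall>a. \<exists>b. a - b ^ (p ^ m) \<in> J 1" using perfect_power by blast
  then obtain \<rho> where \<rho>: "a - \<rho> a ^ (p ^ m) \<in> J 1" for a by metis
  have inj: "inj (repeat_mset (p ^ m) :: 'v multiset \<Rightarrow> _)"
    using repeat_mset_eq_iff[OF q] by (auto simp: inj_def)
  define g where "g = Poly_Mapping.mapp (\<lambda>_. \<rho>) (Poly_Mapping.map_key (repeat_mset (p ^ m)) h)"
  have g: "lookup g s = (if lookup h (repeat_mset (p ^ m) s) =
    0 then 0 else \<rho> (lookup h (repeat_mset (p ^ m) s)))" for s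
    using inj by (auto simp: g_def lookup_mapp map_key.rep_eq in_keys_iff)
  have "set_mset (repeat_mset (p ^ m) s) = set_mset s" for s :: "'v multiset"
    using q by (intro Set.set_eqI) (simp flip: count_greater_zero_iff)
  then have "supported_in I g" using assms by (simp add: supported_in_def g)
  moreover have "lookup (h - g ^ (p ^ m)) (repeat_mset (p ^ m) s) \<in> J 1" for s
  proof -
    let ?t = "repeat_mset (p ^ m) s"
    have 1: "lookup h ?t - lookup g s ^ (p ^ m) \<in> J 1"
      using \<rho> q by (auto simp: g J_zero power_0_left)
    have 2: "(\<sigma> ^^ m) (lookup g s) - lookup (g ^ (p ^ m)) ?t \<in> J 1"
      using mcong_1_mpoly_frob_funpow[of m g] unfolding mcong_def lookup_mpoly_frob_funpow
        [symmetric] by blast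
    have "lookup (h - g ^ (p ^ m)) ?t = (lookup h ?t - lookup g s ^ (p ^ m))
        - ((\<sigma> ^^ m) (lookup g s) - lookup g s ^ (p ^ m))
        + ((\<sigma> ^^ m) (lookup g s) - lookup (g ^ (p ^ m)) ?t)"
      by (simp add: lookup_minus)
    also have "\<dots> \<in> J 1"
      by (intro J_add J_diff 1 2 \<sigma>_funpow_power)
    finally show ?thesis .
  qed
  ultimately show ?thesis using that by blast
qed

lemma ghost_divisible_uminus: "ghost_divisible m f \<Longrightarrow> ghost_divisible m (- f)"
  by (simp add: ghost_divisible_def)

text \<open>
  Modulo \<open>J n\<close>, a polynomial in the image condition at level \<open>m + 1\<close> is divisible by \<open>p\<close>, with
  quotient in the image condition at level \<open>m\<close>, provided that its coefficients at \<open>p\<^sup>m\<close>-th powers lie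
  in \<open>J 1\<close>. All other coefficients are divisible by \<open>p\<close> exactly.
\<close>

lemma ghost_divisible_divide_p:
  fixes f :: "'v multiset \<Rightarrow>\<^sub>0 'c"
  assumes "ghost_divisible (Suc m) f" "supported_in I f"
    and "\<And>s. lookup f (repeat_mset (p ^ m) s) \<in> J 1"
  obtains g where "ghost_divisible m g" "supported_in I g" "mcong n f (of_nat p * g)"
proof -
  have "\<exists>b. lookup f s - of_nat p * b \<in> J n \<and> (\<forall>j. of_nat p ^ (m - 1) dvd of_nat (count s j) * b)
      \<and> (lookup f s = 0 \<longrightarrow> b = 0)" for s
  proof (cases "lookup f s = 0")
    case True
    then show ?thesis by (intro exI[of _ 0]) (simp add: J_zero)
  next
    case nz: False
    show ?thesis
    proof (cases "\<forall>j. p ^ m dvd count s j")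
      case True
      then obtain t where t: "s = repeat_mset (p ^ m) t"
        using ex_repeat_mset_iff[of "p ^ m" s] p_pos by auto
      obtain b where b: "lookup f s - of_nat p * b \<in> J n" using J_1[OF assms(3)[of t]] t by auto
      have "of_nat p ^ (m - 1) dvd of_nat (count s j) * b" for j
      proof -
        have "p ^ (m - 1) dvd count s j" using True by (meson diff_le_self dvd_trans le_imp_power_dvd)
        then have "of_nat (p ^ (m - 1)) dvd (of_nat (count s j) :: 'c)"
          by (metis dvd_def of_nat_mult)
        then show ?thesis by simp
      qed
      then show ?thesis using b nz by blast
    next
      case False
      then obtain j0 where j0: "\<not> p ^ m dvd count s j0" by blast
      then obtain m' where m': "m = Suc m'" by (cases m) auto
      have d: "of_nat p ^ m dvd of_nat (count s j) * lookup f s" for j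
        using assms(1) by (simp add: ghost_divisible_def)
      obtain b where b: "lookup f s = of_nat p * b"
        using p_dvd_if_p_power_dvd_mult[OF d j0] by blast
      have "of_nat p ^ (m - 1) dvd of_nat (count s j) * b" for j
      proof (rule p_power_Suc_dvd_cancel)
        show "of_nat p ^ Suc (m - 1) dvd of_nat p * (of_nat (count s j) * b)"
          using d[of j] by (simp add: b m' mult.left_commute)
      qed
      then show ?thesis using b nz by (intro exI[of _ b]) (simp add: J_zero)
    qed
  qed
  then obtain b where b: "lookup f s - of_nat p * b s \<in> J n"
      "of_nat p ^ (m - 1) dvd of_nat (count s j) * b s" "lookup f s = 0 \<Longrightarrow> b s = 0" for s j
    by metis
  define g where "g = Poly_Mapping.mapp (\<lambda>s _. b s) f"
  have g: "lookup g s = b s" for s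
    using b(3)[of s] by (auto simp: g_def lookup_mapp when_def in_keys_iff)
  show ?thesis
  proof (rule that[of g])
    show "ghost_divisible m g" using b(2) by (simp add: ghost_divisible_def g)
    show "supported_in I g" using assms(2) b(3) by (simp add: supported_in_def g)
    show "mcong n f (of_nat p * g)" by (simp add: mcong_def lookup_of_nat_mult g b(1))
  qed
qed

text \<open>
  The image condition suffices: subtract the \<open>p\<^sup>m\<close>-th power of an approximate root, divide by \<open>p\<close>, and
  continue with the quotient.
\<close>

lemma ghost_divisible_imp_ex_witt_ghost:
  assumes "ghost_divisible m h" "supported_in I h"
  shows "\<exists>g. (\<forall>i. supported_in I (g i)) \<and> mcong m h (witt_ghost p m g)"
  using assms
proof (induction m arbitrary: h)
  case 0
  show ?case by (intro exI[of _ "\<lambda>_. 0"]) (simp add: mcong_0)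
next
  case (Suc m)
  obtain g0 where g0: "supported_in I g0"
      "\<And>s. lookup (h - g0 ^ (p ^ m)) (repeat_mset (p ^ m) s) \<in> J 1"
    using approximate_p_power_root[OF Suc.prems(2), of m] by blast
  define f where "f = h + - (g0 ^ (p ^ m))"
  have "ghost_divisible (Suc m) f"
    unfolding f_def using Suc.prems(1) by (intro ghost_divisible_add ghost_divisible_uminus
      ghost_divisible_p_power)
  moreover have "supported_in I f"
    unfolding f_def using Suc.prems(2) g0(1) by (intro supported_in_add supported_in_uminus
      supported_in_power)
  moreover have "lookup f (repeat_mset (p ^ m) s) \<in> J 1" for s
    using g0(2)[of s] by (simp add: f_def)
  ultimately obtain h' where h': "ghost_divisible m h'" "supported_in I h'" "mcong (Suc m) f
    (of_nat p * h')"
    using ghost_divisible_divide_p[of m f I "Suc m"] by blast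
  obtain g where g: "\<And>i. supported_in I (g i)" "mcong m h' (witt_ghost p m g)"
    using Suc.IH[OF h'(1,2)] by blast
  let ?g = "case_nat g0 g"
  have "mcong (Suc m) f (of_nat p * witt_ghost p m g)"
    using h'(3) g(2) mcong_p_mult_iff mcong_trans by blast
  then have "mcong (Suc m) (g0 ^ (p ^ m) + f) (g0 ^ (p ^ m) + of_nat p * witt_ghost p m g)"
    by (intro mcong_add mcong_refl)
  then have "mcong (Suc m) h (witt_ghost p (Suc m) ?g)"
    by (simp add: f_def witt_ghost_Suc)
  moreover have "supported_in I (?g i)" for i using g0(1) g(1) by (cases i) auto
  ultimately show ?case by blast
qed

section \<open>Divided power derivations on the image of the ghost map\<close>

lemma mcong_mpoly_hasse: "mcong m f g \<Longrightarrow> mcong m (mpoly_hasse j r f) (mpoly_hasse j r g)"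
  by (simp add: mcong_def lookup_mpoly_hasse J_mult flip: right_diff_distrib)

lemma mpoly_hasse_0 [simp]: "mpoly_hasse j r 0 = 0"
  by (intro poly_mapping_eqI) (simp add: lookup_mpoly_hasse)

lemma mpoly_hasse_of_nat_mult:
  "mpoly_hasse j r (of_nat n * f) = of_nat n * mpoly_hasse j r f"
  by (intro poly_mapping_eqI) (simp add: lookup_mpoly_hasse lookup_of_nat_mult mult.left_commute)

lemma ghost_divisible_\<sigma>:
  assumes "ghost_divisible m f"
  shows "of_nat p ^ (m - 1) dvd of_nat (count t j) * \<sigma> (lookup f t)"
proof -
  obtain b where "of_nat (count t j) * lookup f t = of_nat p ^ (m - 1) * b"
    using assms unfolding ghost_divisible_def by blast
  then have "\<sigma> (of_nat (count t j) * lookup f t) = \<sigma> (of_nat (p ^ (m - 1)) * b)" by simp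
  then show ?thesis by (simp only: \<sigma>_mult \<sigma>_of_nat) simp
qed

lemma mcong_mpoly_hasse_frob_not_dvd:
  assumes "ghost_divisible m f" "\<not> p dvd r" "m > 0"
  shows "mcong m (mpoly_hasse j r (mpoly_frob f)) 0"
  unfolding mcong_def
proof
  fix s
  show "lookup (mpoly_hasse j r (mpoly_frob f)) s - lookup 0 s \<in> J m"
  proof (cases "\<exists>t. s + replicate_mset r j = repeat_mset p t")
    case True
    then obtain t where t: "s + replicate_mset r j = repeat_mset p t" ..
    have "count s j + r = p * count t j" using arg_cong[OF t, of "\<lambda>M. count M j"] by simp
    then have "lookup (mpoly_hasse j r (mpoly_frob f)) s =
        of_nat ((p * count t j) choose r) * \<sigma> (lookup f t)"
      by (simp add: lookup_mpoly_hasse t lookup_mpoly_frob_repeat)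
    then show ?thesis
      using binomial_mult_p_not_dvd[OF ghost_divisible_\<sigma>[OF assms(1), of t j] assms(2)] assms(3)
      by (simp add: p_power_dvd_in_J)
  next
    case False
    then show ?thesis by (simp add: lookup_mpoly_hasse lookup_mpoly_frob_eq_0 J_zero)
  qed
qed

lemma mcong_mpoly_hasse_frob_dvd:
  assumes "ghost_divisible m f" "m > 0"
  shows "mcong m (mpoly_hasse j (p * r) (mpoly_frob f)) (mpoly_frob (mpoly_hasse j r f))"
  unfolding mcong_def
proof
  fix s
  show "lookup (mpoly_hasse j (p * r) (mpoly_frob f)) s - lookup (mpoly_frob (mpoly_hasse j r f)) s \<in>
    J m"
  proof (cases "\<exists>u. s = repeat_mset p u")
    case True
    then obtain u where u: "s = repeat_mset p u" ..
    define t where "t = u + replicate_mset r j"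
    have t: "s + replicate_mset (p * r) j = repeat_mset p t"
      by (intro multiset_eqI) (auto simp: u t_def algebra_simps)
    have "count s j + p * r = p * count t j" by (simp add: u t_def algebra_simps)
    then have 1: "lookup (mpoly_hasse j (p * r) (mpoly_frob f)) s =
        of_nat ((p * count t j) choose (p * r)) * \<sigma> (lookup f t)"
      by (simp add: lookup_mpoly_hasse t lookup_mpoly_frob_repeat)
    have 2: "lookup (mpoly_frob (mpoly_hasse j r f)) s = of_nat (count t j choose r) * \<sigma> (lookup f t)"
      by (simp add: u lookup_mpoly_frob_repeat lookup_mpoly_hasse \<sigma>_mult \<sigma>_of_nat flip: t_def)
         (simp add: t_def)
    show ?thesis
      using binomial_mult_p_dvd[OF ghost_divisible_\<sigma>[OF assms(1), of t j], of r] assms(2)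
      unfolding 1 2 by (simp add: p_power_dvd_in_J)
  next
    case False
    have "p dvd count s i \<longleftrightarrow> p dvd count (s + replicate_mset (p * r) j) i" for i
      by (cases "i = j") (simp_all add: dvd_add_left_iff)
    then have "\<not> (\<exists>t. s + replicate_mset (p * r) j = repeat_mset p t)"
      using False unfolding ex_repeat_mset_iff[OF p_pos] by blast
    then show ?thesis using False by (simp add: lookup_mpoly_hasse lookup_mpoly_frob_eq_0 J_zero)
  qed
qed

text \<open>
  The family \<open>y\<close> represents the image under \<open>\<partial>\<^sub>j\<^bsup>[r]\<^esup>\<close> of the Witt vector represented by \<open>x\<close>.
\<close>

definition ghost_deriv_rel :: "nat \<Rightarrow> 'v \<Rightarrow> nat \<Rightarrow> (nat \<Rightarrow> 'v multiset \<Rightarrow>\<^sub>0 'c) \<Rightarrow>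
  (nat \<Rightarrow> 'v multiset \<Rightarrow>\<^sub>0 'c) \<Rightarrow> bool" where
  "ghost_deriv_rel m j r x y \<longleftrightarrow> mcong m (witt_ghost p m y) (mpoly_hasse j r (witt_ghost p m x))"

lemma ex_ghost_deriv_rel:
  assumes "\<And>i. i < m \<Longrightarrow> supported_in I (x i)"
  shows "\<exists>y. (\<forall>i. supported_in I (y i)) \<and> ghost_deriv_rel m j r x y"
proof -
  have "ghost_divisible m (mpoly_hasse j r (witt_ghost p m x))"
    by (intro ghost_divisible_mpoly_hasse ghost_divisible_witt_ghost)
  moreover have "supported_in I (mpoly_hasse j r (witt_ghost p m x))"
    using assms by (intro supported_in_mpoly_hasse supported_in_witt_ghost)
  ultimately show ?thesis
    using ghost_divisible_imp_ex_witt_ghost mcong_sym unfolding ghost_deriv_rel_def by blast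
qed

text \<open>
  For the restriction, both ghost components at level \<open>m + 1\<close> are rewritten modulo \<open>J m\<close> by means of
  \<open>\<phi>\<close>; in the next two lemmas \<open>\<phi>\<close> is moved past \<open>\<partial>\<^sub>j\<^bsup>[r]\<^esup>\<close> and cancelled.
\<close>

lemma ghost_deriv_rel_restrict_frob:
  assumes "ghost_deriv_rel (Suc m) j r x y"
  shows "mcong m (mpoly_frob (witt_ghost p m y)) (mpoly_hasse j r (mpoly_frob (witt_ghost p m x)))"
proof -
  have "mcong m (mpoly_frob (witt_ghost p m y)) (witt_ghost p (Suc m) y)"
    by (rule mcong_sym[OF mcong_witt_ghost_Suc_mpoly_frob])
  moreover have "mcong m (witt_ghost p (Suc m) y) (mpoly_hasse j r (witt_ghost p (Suc m) x))"
    using assms mcong_mono[of m "Suc m"] by (simp add: ghost_deriv_rel_def)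
  moreover have "mcong m (mpoly_hasse j r (witt_ghost p (Suc m) x)) (mpoly_hasse j r (mpoly_frob
    (witt_ghost p m x)))"
    by (intro mcong_mpoly_hasse mcong_witt_ghost_Suc_mpoly_frob)
  ultimately show ?thesis using mcong_trans by blast
qed

lemma ghost_deriv_rel_restrict_dvd:
  assumes "ghost_deriv_rel (Suc m) j (p * r) x y" "m > 0"
  shows "ghost_deriv_rel m j r x y"
proof -
  have "mcong m (mpoly_frob (witt_ghost p m y)) (mpoly_frob (mpoly_hasse j r (witt_ghost p m x)))"
    using ghost_deriv_rel_restrict_frob[OF assms(1)]
      mcong_mpoly_hasse_frob_dvd[OF ghost_divisible_witt_ghost assms(2)] by (rule mcong_trans)
  then show ?thesis by (simp add: ghost_deriv_rel_def mcong_mpoly_frob_iff)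
qed

lemma ghost_deriv_rel_restrict_not_dvd:
  assumes "ghost_deriv_rel (Suc m) j r x y" "\<not> p dvd r" "m > 0"
  shows "mcong m (witt_ghost p m y) 0"
proof -
  have "mcong m (mpoly_frob (witt_ghost p m y)) (mpoly_frob 0)"
    unfolding mpoly_frob_0
    using ghost_deriv_rel_restrict_frob[OF assms(1)]
      mcong_mpoly_hasse_frob_not_dvd[OF ghost_divisible_witt_ghost assms(2,3)]
    by (rule mcong_trans)
  then show ?thesis by (simp only: mcong_mpoly_frob_iff)
qed

lemma ghost_deriv_rel_frob_dvd:
  assumes "ghost_deriv_rel m j r x y" "m > 0"
  shows "ghost_deriv_rel m j (p * r) (\<lambda>i. mpoly_frob (x i)) (\<lambda>i. mpoly_frob (y i))"
proof -
  have "mcong m (mpoly_frob (witt_ghost p m y)) (mpoly_frob (mpoly_hasse j r (witt_ghost p m x)))"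
    using assms(1) by (simp add: ghost_deriv_rel_def mcong_mpoly_frob_iff)
  then show ?thesis
    unfolding ghost_deriv_rel_def mpoly_frob_witt_ghost [symmetric]
    using mcong_sym[OF mcong_mpoly_hasse_frob_dvd[OF ghost_divisible_witt_ghost assms(2)]]
    by (rule mcong_trans)
qed

lemma ghost_deriv_rel_frob_not_dvd:
  fixes x :: "nat \<Rightarrow> 'v multiset \<Rightarrow>\<^sub>0 'c"
  assumes "\<not> p dvd r" "m > 0"
  shows "ghost_deriv_rel m j r (\<lambda>i. mpoly_frob (x i)) (\<lambda>_. 0)"
proof -
  have [simp]: "witt_ghost p m (\<lambda>_. 0 :: 'v multiset \<Rightarrow>\<^sub>0 'c) = 0"
    using p_pos by (simp add: witt_ghost_def power_0_left)
  show ?thesis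
    using mcong_sym[OF mcong_mpoly_hasse_frob_not_dvd[OF ghost_divisible_witt_ghost assms]]
    by (simp add: ghost_deriv_rel_def flip: mpoly_frob_witt_ghost)
qed

lemma ghost_deriv_rel_shift:
  assumes "ghost_deriv_rel m j r x y"
  shows "ghost_deriv_rel (Suc m) j r (case_nat 0 x) (case_nat 0 y)"
  using assms p_pos
  by (simp add: ghost_deriv_rel_def witt_ghost_Suc mpoly_hasse_of_nat_mult mcong_p_mult_iff
    power_0_left)

end

section \<open>Images of commutative rings\<close>

text \<open>
  A structure \<open>R\<close> that is the image of a subring \<open>S\<close> of a type class ring under a map compatible with
  the operations. Such an \<open>R\<close> is a commutative ring, although none of the ring axioms is assumed; this
  is how the ring axioms are obtained for Witt vectors and for polynomial rings.
\<close>

locale ring_image =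
  fixes S :: "'c::comm_ring_1 set" and f :: "'c \<Rightarrow> 'x" and R :: "('x, 'r) ring_scheme" (structure)
  assumes S_0: "0 \<in> S" and S_1: "1 \<in> S"
    and S_add: "a \<in> S \<Longrightarrow> b \<in> S \<Longrightarrow> a + b \<in> S"
    and S_mult: "a \<in> S \<Longrightarrow> b \<in> S \<Longrightarrow> a * b \<in> S"
    and S_uminus: "a \<in> S \<Longrightarrow> - a \<in> S"
    and f_0: "f 0 = \<zero>" and f_1: "f 1 = \<one>"
    and f_add: "a \<in> S \<Longrightarrow> b \<in> S \<Longrightarrow> f (a + b) = f a \<oplus> f b"
    and f_mult: "a \<in> S \<Longrightarrow> b \<in> S \<Longrightarrow> f (a * b) = f a \<otimes> f b"
    and carrier_eq: "carrier R = f ` S"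
begin

lemma is_cring: "cring R"
proof (rule cringI)
  show "abelian_group R"
  proof (rule abelian_groupI)
    show "\<exists>y\<in>carrier R. y \<oplus> x = \<zero>" if "x \<in> carrier R" for x
      using that S_uminus f_add f_0 unfolding carrier_eq
        by (metis (no_types) imageE imageI left_minus)
  qed (auto simp: carrier_eq f_add [symmetric] f_0 [symmetric] S_add S_0 algebra_simps)
  show "comm_monoid R"
    by (rule comm_monoidI) (auto simp: carrier_eq f_mult [symmetric] f_1 [symmetric] S_mult S_1
      algebra_simps)
qed (auto simp: carrier_eq f_mult [symmetric] f_add [symmetric] S_mult S_add algebra_simps)

end

sublocale ring_image \<subseteq> cring R
  by (rule is_cring)

context ring_image
begin

lemma f_closed [simp]: "a \<in> S \<Longrightarrow> f a \<in> carrier R"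
  by (simp add: carrier_eq)

lemma S_of_nat: "of_nat n \<in> S"
  by (induction n) (auto intro: S_0 S_1 S_add)

lemma S_sum: "(\<And>i. i \<in> A \<Longrightarrow> g i \<in> S) \<Longrightarrow> sum g A \<in> S"
  by (induction A rule: infinite_finite_induct) (auto intro: S_0 S_add)

lemma S_power: "a \<in> S \<Longrightarrow> a ^ n \<in> S"
  by (induction n) (auto intro: S_1 S_mult)

lemma f_power: "a \<in> S \<Longrightarrow> f (a ^ n) = f a [^] n"
  by (induction n) (auto simp: f_1 f_mult S_power m_comm)

lemma f_of_nat_mult: "a \<in> S \<Longrightarrow> f (of_nat n * a) = [n] \<cdot> f a"
  by (induction n) (auto simp: f_0 f_add S_mult S_of_nat algebra_simps a_comm)

lemma f_uminus: "a \<in> S \<Longrightarrow> f (- a) = \<ominus> f a"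
  using f_add[of "- a" a] f_0 S_uminus by (intro minus_equality [symmetric]) auto

lemma f_diff: "a \<in> S \<Longrightarrow> b \<in> S \<Longrightarrow> f (a - b) = f a \<ominus> f b"
  using f_add[of a "- b"] by (simp add: f_uminus S_uminus a_minus_def)

lemma f_sum:
  assumes "\<And>i. i \<in> A \<Longrightarrow> g i \<in> S" "finite A"
  shows "f (sum g A) = (\<Oplus>i\<in>A. f (g i))"
  using assms(2,1)
proof (induction A rule: finite_induct)
  case (insert x A)
  then have "(\<Oplus>i\<in>insert x A. f (g i)) = f (g x) \<oplus> (\<Oplus>i\<in>A. f (g i))"
    by (intro finsum_insert) auto
  then show ?case using insert by (simp add: f_add S_sum)
qed (simp add: f_0)

lemma f_eq_iff: "a \<in> S \<Longrightarrow> b \<in> S \<Longrightarrow> f a = f b \<longleftrightarrow> f (a - b) = \<zero>"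
  using f_diff by (metis S_0 S_add S_uminus add_diff_cancel_left' diff_add_cancel f_add f_closed
      r_right_minus_eq)

end

section \<open>Evaluation of integral polynomials\<close>

text \<open>
  A type class ring as a structure with explicit carrier.
\<close>

definition class_ring :: "'c::comm_ring_1 ring" where
  "class_ring = \<lparr>carrier = UNIV, monoid.mult = (*), one = 1, zero = 0, add = (+)\<rparr>"

lemma class_ring_simps [simp]:
  "carrier class_ring = UNIV" "monoid.mult class_ring = (*)" "one class_ring = 1"
  "zero class_ring = 0" "add class_ring = (+)"
  by (simp_all add: class_ring_def)

lemma ring_image_class_ring: "ring_image UNIV (\<lambda>x. x) class_ring"
  by unfold_locales auto

lemma cring_class_ring: "cring class_ring"
  by (rule ring_image.is_cring[OF ring_image_class_ring])

lemma int_mpoly_var_power: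
  "int_mpoly_var v ^ n = Poly_Mapping.single (Poly_Mapping.single v n) 1"
  by (induction n) (auto simp: int_mpoly_var_def mult_single single_add [symmetric])

lemma int_mpoly_induct [case_names one var add uminus mult]:
  fixes P :: "'v int_mpoly \<Rightarrow> bool"
  assumes one: "P 1" and var: "\<And>v. P (int_mpoly_var v)"
    and add: "\<And>f g. P f \<Longrightarrow> P g \<Longrightarrow> P (f + g)"
    and uminus: "\<And>f. P f \<Longrightarrow> P (- f)"
    and mult: "\<And>f g. P f \<Longrightarrow> P g \<Longrightarrow> P (f * g)"
  shows "P f"
proof (induction f rule: poly_mapping_add_induct)
  case zero
  show ?case using add[OF one uminus[OF one]] by simp
next
  case (single M c)
  have nat: "P (of_nat n)" for n
    by (induction n) (use add one uminus[OF one] add[OF one uminus[OF one]] in auto)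
  have int: "P (of_int n)" for n
    by (cases n rule: int_cases2) (use nat uminus in auto)
  have "P (Poly_Mapping.single M 1)"
  proof (induction M rule: poly_mapping_add_induct)
    case zero
    show ?case using one by simp
  next
    case (single v n)
    have "P (int_mpoly_var v ^ n)" by (induction n) (use one var mult in auto)
    then show ?case by (simp add: int_mpoly_var_power)
  next
    case (add M N)
    then show ?case using mult[OF add] by (simp add: mult_single)
  qed
  then have "P (of_int c * Poly_Mapping.single M 1)" using int mult by blast
  moreover have "of_int c * Poly_Mapping.single M 1 = Poly_Mapping.single M c"
    using mult_single[of 0 "of_int c :: int" M 1] unfolding single_of_int by simp
  ultimately show ?case by simp
qed (use add in auto)

context cring
begin

lemma int_mpoly_eval_altdef:
  assumes "range x \<subseteq> carrier R" "finite K" "Poly_Mapping.keys P \<subseteq> K"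
  shows "int_mpoly_eval R x P = (\<Oplus>M\<in>K. [(Poly_Mapping.lookup P M)] \<cdot>
     (\<Otimes>v\<in>Poly_Mapping.keys M. x v [^] Poly_Mapping.lookup M v))"
  unfolding int_mpoly_eval_def using assms
  by (intro add.finprod_mono_neutral_cong_left) (auto simp: in_keys_iff add_pow_int_ge intro!:
    add.int_pow_closed finprod_closed)

lemma int_mpoly_eval_closed [simp]:
  assumes "range x \<subseteq> carrier R"
  shows "int_mpoly_eval R x P \<in> carrier R"
  unfolding int_mpoly_eval_def using assms
  by (auto intro!: finsum_closed add.int_pow_closed finprod_closed)

lemma int_mpoly_eval_0: "int_mpoly_eval R x 0 = \<zero>"
  by (simp add: int_mpoly_eval_def)

lemma int_mpoly_eval_single:
  assumes "range x \<subseteq> carrier R"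
  shows "int_mpoly_eval R x (Poly_Mapping.single M c) =
    [c] \<cdot> (\<Otimes>v\<in>Poly_Mapping.keys M. x v [^] Poly_Mapping.lookup M v)"
proof -
  have "(\<Otimes>v\<in>Poly_Mapping.keys M. x v [^] Poly_Mapping.lookup M v) \<in> carrier R"
    using assms by (auto intro!: finprod_closed)
  then show ?thesis
    using assms by (subst int_mpoly_eval_altdef[of x "{M}"]) (auto intro: add.int_pow_closed)
qed

lemma int_mpoly_eval_1: "range x \<subseteq> carrier R \<Longrightarrow> int_mpoly_eval R x 1 = \<one>"
  using int_mpoly_eval_single[of x 0 1] by (simp add: add_pow_int_ge)

lemma int_mpoly_eval_var: "range x \<subseteq> carrier R \<Longrightarrow> int_mpoly_eval R x (int_mpoly_var v) = x v"
  using int_mpoly_eval_single[of x "Poly_Mapping.single v 1" 1]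
  by (simp add: add_pow_int_ge int_mpoly_var_def range_subsetD)

lemma int_mpoly_eval_add:
  assumes x: "range x \<subseteq> carrier R"
  shows "int_mpoly_eval R x (P + Q) = int_mpoly_eval R x P \<oplus> int_mpoly_eval R x Q"
proof -
  let ?K = "Poly_Mapping.keys P \<union> Poly_Mapping.keys Q"
  let ?mon = "\<lambda>M. \<Otimes>v\<in>Poly_Mapping.keys M. x v [^] (Poly_Mapping.lookup M v :: nat)"
  have K: "finite ?K" "Poly_Mapping.keys P \<subseteq> ?K" "Poly_Mapping.keys Q \<subseteq> ?K"
      "Poly_Mapping.keys (P + Q) \<subseteq> ?K"
    using keys_add[of P Q] by auto
  have mon: "?mon M \<in> carrier R" for M using x by (auto intro!: finprod_closed nat_pow_closed simp:
    range_subsetD)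
  have "(\<Oplus>M\<in>?K. [(Poly_Mapping.lookup (P + Q) M)] \<cdot> ?mon M)
      = (\<Oplus>M\<in>?K. [(Poly_Mapping.lookup P M)] \<cdot> ?mon M \<oplus> [(Poly_Mapping.lookup Q M)] \<cdot> ?mon M)"
    using mon by (intro finsum_cong') (auto simp: lookup_add add.int_pow_mult intro!:
      add.int_pow_closed a_closed)
  also have "\<dots> = (\<Oplus>M\<in>?K. [(Poly_Mapping.lookup P M)] \<cdot> ?mon M) \<oplus>
    (\<Oplus>M\<in>?K. [(Poly_Mapping.lookup Q M)] \<cdot> ?mon M)"
    using mon by (intro finsum_addf) (auto intro!: add.int_pow_closed)
  finally show ?thesis
    unfolding int_mpoly_eval_altdef[OF x K(1,2)] int_mpoly_eval_altdef[OF x K(1,3)]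
      int_mpoly_eval_altdef[OF x K(1,4)] .
qed

lemma int_mpoly_eval_mult:
  assumes x: "range x \<subseteq> carrier R"
  shows "int_mpoly_eval R x (P * Q) = int_mpoly_eval R x P \<otimes> int_mpoly_eval R x Q"
proof -
  let ?mon = "\<lambda>M. \<Otimes>v\<in>Poly_Mapping.keys M. x v [^] (Poly_Mapping.lookup M v :: nat)"
  have mon: "?mon M \<in> carrier R" for M using x by (auto intro!: finprod_closed nat_pow_closed simp:
    range_subsetD)
  have mon_altdef: "?mon M = (\<Otimes>v\<in>K. x v [^] Poly_Mapping.lookup M v)"
    if "finite K" "Poly_Mapping.keys M \<subseteq> K" for K and M :: "_ \<Rightarrow>\<^sub>0 nat"
    using that x by (intro finprod_mono_neutral_cong_left) (auto simp: in_keys_iff range_subsetD)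
  have mon_add: "?mon (M + N) = ?mon M \<otimes> ?mon N" for M N :: "_ \<Rightarrow>\<^sub>0 nat"
  proof -
    let ?K = "Poly_Mapping.keys M \<union> Poly_Mapping.keys N"
    have K: "finite ?K" "Poly_Mapping.keys M \<subseteq> ?K" "Poly_Mapping.keys N \<subseteq> ?K"
        "Poly_Mapping.keys (M + N) \<subseteq> ?K"
      using keys_add[of M N] by auto
    have "(\<Otimes>v\<in>?K. x v [^] Poly_Mapping.lookup (M + N) v)
        = (\<Otimes>v\<in>?K. x v [^] Poly_Mapping.lookup M v \<otimes> x v [^] Poly_Mapping.lookup N v)"
      using x by (intro finprod_cong') (auto simp: lookup_add nat_pow_mult range_subsetD)
    also have "\<dots> = (\<Otimes>v\<in>?K. x v [^] Poly_Mapping.lookup M v) \<otimes>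
      (\<Otimes>v\<in>?K. x v [^] Poly_Mapping.lookup N v)"
      using x by (intro finprod_multf) (auto simp: range_subsetD)
    finally show ?thesis
      unfolding mon_altdef[OF K(1,2)] mon_altdef[OF K(1,3)] mon_altdef[OF K(1,4)] .
  qed
  show ?thesis
  proof (induction P rule: poly_mapping_add_induct)
    case (single M a)
    show ?case
    proof (induction Q rule: poly_mapping_add_induct)
      case (single N b)
      have "[(a * b)] \<cdot> (?mon M \<otimes> ?mon N) = [a] \<cdot> ?mon M \<otimes> [b] \<cdot> ?mon N"
        using mon by (simp add: add_pow_ldistr_int add_pow_rdistr_int add.int_pow_pow mult.commute
            add.int_pow_closed)
      then show ?case using x by (simp add: mult_single int_mpoly_eval_single mon_add)
    next
      case (add f g)
      then show ?case using x by (simp add: distrib_left int_mpoly_eval_add r_distr)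
    qed (use x in \<open>simp_all add: int_mpoly_eval_0\<close>)
  next
    case (add f g)
    then show ?case using x by (simp add: distrib_right int_mpoly_eval_add l_distr)
  qed (use x in \<open>simp_all add: int_mpoly_eval_0\<close>)
qed

lemma int_mpoly_eval_uminus:
  assumes x: "range x \<subseteq> carrier R"
  shows "int_mpoly_eval R x (- P) = \<ominus> int_mpoly_eval R x P"
  using int_mpoly_eval_add[OF x, of "- P" P] x
  by (intro minus_equality [symmetric]) (auto simp: int_mpoly_eval_0)

end

text \<open>
  Only the values at the variables that occur matter. In \<open>witt_ring\<close> the arguments \<open>nth xs\<close> are
  unspecified beyond the length of \<open>xs\<close>, so only \<open>y\<close> is assumed to take values in the carrier.
\<close>

lemma int_mpoly_eval_cong:
  assumes "\<And>M v. M \<in> Poly_Mapping.keys P \<Longrightarrow> v \<in> Poly_Mapping.keys M \<Longrightarrow> x v = y v"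
    and "cring R" "range y \<subseteq> carrier R"
  shows "int_mpoly_eval R x P = int_mpoly_eval R y P"
proof -
  interpret cring R by fact
  have mon: "(\<Otimes>\<^bsub>R\<^esub>v\<in>Poly_Mapping.keys M. x v [^]\<^bsub>R\<^esub> Poly_Mapping.lookup M v) =
      (\<Otimes>\<^bsub>R\<^esub>v\<in>Poly_Mapping.keys M. y v [^]\<^bsub>R\<^esub> Poly_Mapping.lookup M v)"
    if "M \<in> Poly_Mapping.keys P" for M
    using assms that by (intro finprod_cong') (auto intro!: nat_pow_closed simp: range_subsetD)
  show ?thesis
    unfolding int_mpoly_eval_def using mon assms(3)
    by (intro finsum_cong') (auto intro!: add.int_pow_closed finprod_closed simp: range_subsetD)
qed

lemma ring_hom_int_mpoly_eval:
  assumes "cring R" "cring R'" "range x \<subseteq> carrier R"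
    and closed: "h \<in> carrier R \<rightarrow> carrier R'"
    and add: "\<And>a b. a \<in> carrier R \<Longrightarrow> b \<in> carrier R \<Longrightarrow> h (a \<oplus>\<^bsub>R\<^esub> b) = h a \<oplus>\<^bsub>R'\<^esub> h b"
    and mult: "\<And>a b. a \<in> carrier R \<Longrightarrow> b \<in> carrier R \<Longrightarrow> h (a \<otimes>\<^bsub>R\<^esub> b) = h a \<otimes>\<^bsub>R'\<^esub> h b"
    and one: "h \<one>\<^bsub>R\<^esub> = \<one>\<^bsub>R'\<^esub>"
  shows "h (int_mpoly_eval R x P) = int_mpoly_eval R' (\<lambda>v. h (x v)) P"
proof -
  interpret R: cring R by fact
  interpret R': cring R' by fact
  interpret ring_hom_cring R R' h
    by (intro ring_hom_cring.intro ring_hom_cring_axioms.intro ring_hom_memI)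
      (use assms in \<open>auto intro: R.is_cring R'.is_cring\<close>)
  have x': "range (\<lambda>v. h (x v)) \<subseteq> carrier R'" using assms(3) closed by auto
  note x = assms(3)
  show ?thesis
    by (induction P rule: int_mpoly_induct)
       (simp_all add: R.int_mpoly_eval_1[OF x] R'.int_mpoly_eval_1[OF x']
          R.int_mpoly_eval_var[OF x] R'.int_mpoly_eval_var[OF x']
          R.int_mpoly_eval_add[OF x] R'.int_mpoly_eval_add[OF x']
          R.int_mpoly_eval_mult[OF x] R'.int_mpoly_eval_mult[OF x']
          R.int_mpoly_eval_uminus[OF x] R'.int_mpoly_eval_uminus[OF x']
          R.int_mpoly_eval_closed[OF x])
qed

text \<open>
  Substitution of polynomials for variables.
\<close>

definition int_mpoly_subst :: "('v \<Rightarrow> 'w int_mpoly) \<Rightarrow> 'v int_mpoly \<Rightarrow> 'w int_mpoly" where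
  "int_mpoly_subst y P = int_mpoly_eval class_ring y P"

lemma int_mpoly_subst_simps [simp]:
  fixes y :: "'v \<Rightarrow> 'w int_mpoly"
  shows "int_mpoly_subst y 0 = 0" "int_mpoly_subst y 1 = 1"
  "int_mpoly_subst y (int_mpoly_var v) = y v"
  "int_mpoly_subst y (P + Q) = int_mpoly_subst y P + int_mpoly_subst y Q"
  "int_mpoly_subst y (P * Q) = int_mpoly_subst y P * int_mpoly_subst y Q"
proof -
  interpret cring "class_ring :: 'w int_mpoly ring" by (rule cring_class_ring)
  show "int_mpoly_subst y 0 = 0" "int_mpoly_subst y 1 = 1"
    "int_mpoly_subst y (int_mpoly_var v) = y v"
    "int_mpoly_subst y (P + Q) = int_mpoly_subst y P + int_mpoly_subst y Q"
    "int_mpoly_subst y (P * Q) = int_mpoly_subst y P * int_mpoly_subst y Q"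
    unfolding int_mpoly_subst_def
    using int_mpoly_eval_0 int_mpoly_eval_1[of y] int_mpoly_eval_var[of y]
      int_mpoly_eval_add[of y] int_mpoly_eval_mult[of y] by simp_all
qed

lemma int_mpoly_subst_uminus [simp]: "int_mpoly_subst y (- P) = - int_mpoly_subst y P"
  using int_mpoly_subst_simps(4)[of y "- P" P] by (simp add: eq_neg_iff_add_eq_0)

lemma int_mpoly_subst_power [simp]: "int_mpoly_subst y (P ^ n) = int_mpoly_subst y P ^ n"
  by (induction n) auto

lemma int_mpoly_subst_of_nat [simp]: "int_mpoly_subst y (of_nat n) = of_nat n"
  by (induction n) auto

lemma int_mpoly_subst_sum [simp]: "int_mpoly_subst y (sum f A) = (\<Sum>i\<in>A. int_mpoly_subst y (f i))"
  by (induction A rule: infinite_finite_induct) auto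

lemma int_mpoly_eval_subst:
  assumes "cring R" "range x \<subseteq> carrier R"
  shows "int_mpoly_eval R x (int_mpoly_subst y P) = int_mpoly_eval R (\<lambda>v. int_mpoly_eval R x (y v)) P"
proof -
  interpret cring R by fact
  show ?thesis
    unfolding int_mpoly_subst_def using assms
    by (intro ring_hom_int_mpoly_eval cring_class_ring)
       (auto simp: int_mpoly_eval_add int_mpoly_eval_mult int_mpoly_eval_1)
qed

lemma int_mpoly_torsion_free:
  fixes P :: "'v int_mpoly"
  assumes "of_nat n * P = of_nat n * Q" "n > 0"
  shows "P = Q"
proof (rule poly_mapping_eqI)
  fix s
  have "lookup (of_nat n * P) s = lookup (of_nat n * Q) s" using assms(1) by simp
  then show "lookup P s = lookup Q s" using assms(2) by (simp add: lookup_of_nat_mult)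
qed

section \<open>Ghost sequences of integral polynomials and Dwork's lemma\<close>

lemma ghost_poly_eq_witt_ghost: "ghost_poly p n x = witt_ghost p (Suc n) x"
  by (simp add: ghost_poly_def witt_ghost_def lessThan_Suc_atMost del: sum.lessThan_Suc)

lemma witt_ghost_Suc_last:
  "witt_ghost p (Suc n) x = (\<Sum>i<n. of_nat p ^ i * x i ^ (p ^ (n - i))) + of_nat p ^ n * x n"
  by (simp add: witt_ghost_def)

lemma int_mpoly_subst_witt_ghost:
  "int_mpoly_subst y (witt_ghost p m x) = witt_ghost p m (\<lambda>i. int_mpoly_subst y (x i))"
  by (simp add: witt_ghost_def)

text \<open>
  The lift of the Frobenius to a polynomial ring over the integers that raises each variable to its
  \<open>p\<close>-th power.
\<close>

definition var_frob :: "nat \<Rightarrow> 'v int_mpoly \<Rightarrow> 'v int_mpoly" where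
  "var_frob p = int_mpoly_subst (\<lambda>v. int_mpoly_var v ^ p)"

lemma p_dvd_var_frob_diff:
  assumes "prime p"
  shows "of_nat p dvd var_frob p f - f ^ p"
proof (induction f rule: int_mpoly_induct)
  case (add f g)
  have "var_frob p (f + g) - (f + g) ^ p =
      (var_frob p f - f ^ p) + (var_frob p g - g ^ p) - ((f + g) ^ p - (f ^ p + g ^ p))"
    by (simp add: var_frob_def)
  then show ?case using add freshmans_dream[OF assms, of f g] by (metis dvd_add dvd_diff)
next
  case (uminus f)
  have "of_nat p dvd f ^ p + (- f) ^ p"
    using freshmans_dream[OF assms, of f "- f"] prime_gt_0_nat[OF assms] dvd_minus_iff[of _ "f ^ p +
      (- f) ^ p"]
    by (simp add: power_0_left)
  moreover have "var_frob p (- f) - (- f) ^ p = - (var_frob p f - f ^ p) - (f ^ p + (- f) ^ p)"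
    by (simp add: var_frob_def)
  ultimately show ?case using uminus by (metis dvd_diff dvd_minus_iff)
next
  case (mult f g)
  have "var_frob p (f * g) - (f * g) ^ p =
      (var_frob p f - f ^ p) * var_frob p g + f ^ p * (var_frob p g - g ^ p)"
    by (simp add: var_frob_def algebra_simps)
  then show ?case using mult by simp
qed (simp_all add: var_frob_def)

text \<open>
  Dwork's congruences, which characterize the sequences of ghost components. In this form it is plain
  that they define a subring of the ring of all sequences.
\<close>

definition ghost_sequences :: "nat \<Rightarrow> (nat \<Rightarrow> 'v int_mpoly) set" where
  "ghost_sequences p = {w. \<forall>n. of_nat p ^ Suc n dvd w (Suc n) - var_frob p (w n)}"

lemma p_power_dvd_witt_ghost_diff:
  assumes "prime p"
  shows "of_nat p ^ Suc n dvd (\<Sum>i<Suc n. of_nat p ^ i * x i ^ (p ^ (Suc n - i)))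
     - var_frob p (witt_ghost p (Suc n) x)"
proof -
  have "of_nat p ^ Suc n dvd of_nat p ^ i * x i ^ (p ^ (Suc n - i))
      - of_nat p ^ i * var_frob p (x i) ^ (p ^ (n - i))" if "i < Suc n" for i
  proof -
    have "of_nat p dvd x i ^ p - var_frob p (x i)"
      using p_dvd_var_frob_diff[OF assms, of "x i"] by (metis dvd_minus_iff minus_diff_eq)
    then have "of_nat p ^ Suc (n - i) dvd (x i ^ p) ^ (p ^ (n - i)) - var_frob p (x i) ^ (p ^
      (n - i))"
      by (rule p_power_dvd_power_diff)
    moreover have "(x i ^ p) ^ (p ^ (n - i)) = x i ^ (p ^ (Suc n - i))"
      using that by (simp add: power_mult [symmetric] Suc_diff_le)
    ultimately have "of_nat p ^ i * of_nat p ^ Suc (n - i) dvd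
        of_nat p ^ i * (x i ^ (p ^ (Suc n - i)) - var_frob p (x i) ^ (p ^ (n - i)))"
      by (intro mult_dvd_mono) auto
    then show ?thesis using that by (simp add: power_add [symmetric] right_diff_distrib del:
      power_Suc)
  qed
  then have "of_nat p ^ Suc n dvd (\<Sum>i<Suc n. of_nat p ^ i * x i ^ (p ^ (Suc n - i))
      - of_nat p ^ i * var_frob p (x i) ^ (p ^ (n - i)))"
    by (intro dvd_sum) auto
  then show ?thesis
    by (simp only: sum_subtractf witt_ghost_def var_frob_def int_mpoly_subst_sum int_mpoly_subst_simps
        int_mpoly_subst_power int_mpoly_subst_of_nat diff_Suc_1)
qed

lemma witt_ghost_in_ghost_sequences:
  assumes "prime p"
  shows "(\<lambda>n. witt_ghost p (Suc n) x) \<in> ghost_sequences p"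
  unfolding ghost_sequences_def mem_Collect_eq
proof
  fix n
  show "of_nat p ^ Suc n dvd witt_ghost p (Suc (Suc n)) x - var_frob p (witt_ghost p (Suc n) x)"
    using dvd_add[OF p_power_dvd_witt_ghost_diff[OF assms, of n x], of "of_nat p ^ Suc n * x (Suc n)"]
    unfolding witt_ghost_Suc_last[of p "Suc n"] by (simp only: dvd_triv_left diff_add_eq)
qed

text \<open>
  The Witt components of a ghost sequence \<open>w\<close>. Each is obtained from the previous ones by a division,
  which is possible by Dwork's congruences.
\<close>

fun witt_coords :: "nat \<Rightarrow> (nat \<Rightarrow> 'v int_mpoly) \<Rightarrow> nat \<Rightarrow> 'v int_mpoly" where
  "witt_coords p w n = (SOME b. of_nat p ^ n * b = w n - (\<Sum>i<n. of_nat p ^ i * witt_coords p w i ^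
    (p ^ (n - i))))"

declare witt_coords.simps [simp del]

lemma witt_ghost_witt_coords:
  assumes "prime p" "w \<in> ghost_sequences p"
  shows "witt_ghost p (Suc n) (witt_coords p w) = w n"
proof (induction n rule: less_induct)
  case (less n)
  let ?S = "\<Sum>i<n. of_nat p ^ i * witt_coords p w i ^ (p ^ (n - i))"
  have "of_nat p ^ n dvd w n - ?S"
  proof (cases n)
    case (Suc m)
    have "w n - ?S = (w (Suc m) - var_frob p (w m)) - (?S - var_frob p (w m))"
      by (simp add: Suc)
    moreover have "of_nat p ^ n dvd ?S - var_frob p (w m)"
      using p_power_dvd_witt_ghost_diff[OF assms(1), of m "witt_coords p w"] less[of m] Suc by simp
    moreover have "of_nat p ^ n dvd w (Suc m) - var_frob p (w m)"
      using assms(2) by (simp add: ghost_sequences_def Suc)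
    ultimately show ?thesis by (simp only: dvd_diff)
  qed simp
  then have "\<exists>b. of_nat p ^ n * b = w n - ?S" unfolding dvd_def eq_commute[of "w n - ?S"] .
  then have "of_nat p ^ n * witt_coords p w n = w n - ?S"
    by (subst witt_coords.simps) (rule someI_ex)
  then show ?case by (simp add: witt_ghost_Suc_last)
qed

text \<open>
  A version of the uniqueness of Witt components modulo \<open>p\<close>, from which the formula for the
  multiplication by \<open>p\<close> in characteristic \<open>p\<close> is derived.
\<close>

lemma witt_ghost_cong_imp_cong:
  fixes x y :: "nat \<Rightarrow> 'v int_mpoly"
  assumes "prime p"
    and "\<And>n. of_nat p ^ Suc n dvd witt_ghost p (Suc n) x - witt_ghost p (Suc n) y"
  shows "of_nat p dvd x n - y n"
proof (induction n rule: less_induct)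
  case (less n)
  have "of_nat p ^ Suc n dvd of_nat p ^ i * x i ^ (p ^ (n - i)) - of_nat p ^ i * y i ^ (p ^ (n - i))"
    if "i < n" for i
  proof -
    have "of_nat p ^ i * of_nat p ^ Suc (n - i) dvd of_nat p ^ i * (x i ^ (p ^ (n - i)) - y i ^ (p ^
      (n - i)))"
      using that by (intro mult_dvd_mono p_power_dvd_power_diff less) auto
    then show ?thesis using that by (simp add: power_add [symmetric] right_diff_distrib del:
      power_Suc)
  qed
  then have "of_nat p ^ Suc n dvd (\<Sum>i<n. of_nat p ^ i * x i ^ (p ^ (n - i)) - of_nat p ^ i * y i ^
    (p ^ (n - i)))"
    by (intro dvd_sum) auto
  moreover have "of_nat p ^ n * (x n - y n) = witt_ghost p (Suc n) x - witt_ghost p (Suc n) y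
     - (\<Sum>i<n. of_nat p ^ i * x i ^ (p ^ (n - i)) - of_nat p ^ i * y i ^ (p ^ (n - i)))"
    by (simp add: witt_ghost_Suc_last sum_subtractf algebra_simps)
  ultimately have "of_nat p ^ Suc n dvd of_nat p ^ n * (x n - y n)"
    using assms(2)[of n] by (simp only: dvd_diff)
  then obtain z where "of_nat (p ^ n) * (x n - y n) = of_nat (p ^ n) * (of_nat p * z)"
    by (auto simp: dvd_def mult_ac)
  then have "x n - y n = of_nat p * z"
    by (rule int_mpoly_torsion_free) (simp add: prime_gt_0_nat[OF assms(1)])
  then show ?case by simp
qed

lemma witt_ghost_inj:
  fixes x y :: "nat \<Rightarrow> 'v int_mpoly"
  assumes "prime p" "\<And>n. witt_ghost p (Suc n) x = witt_ghost p (Suc n) y"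
  shows "x = y"
proof
  fix n
  show "x n = y n"
  proof (induction n rule: less_induct)
    case (less n)
    then have "of_nat (p ^ n) * x n = of_nat (p ^ n) * y n"
      using assms(2)[of n] by (simp add: witt_ghost_Suc_last)
    then show ?case
      by (rule int_mpoly_torsion_free) (simp add: prime_gt_0_nat[OF assms(1)])
  qed
qed

lemma witt_coords_witt_ghost:
  assumes "prime p"
  shows "witt_coords p (\<lambda>n. witt_ghost p (Suc n) x) = x"
  by (rule witt_ghost_inj[OF assms witt_ghost_witt_coords[OF assms witt_ghost_in_ghost_sequences[OF
    assms]]])

lemma ghost_sequences_const: "(\<lambda>_. of_nat n) \<in> ghost_sequences p"
  by (simp add: ghost_sequences_def var_frob_def)

lemma ghost_sequences_add:
  "v \<in> ghost_sequences p \<Longrightarrow> w \<in> ghost_sequences p \<Longrightarrow> (\<lambda>n. v n + w n) \<in> ghost_sequences p"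
  by (simp add: ghost_sequences_def var_frob_def add_diff_add dvd_add)

lemma ghost_sequences_uminus:
  "w \<in> ghost_sequences p \<Longrightarrow> (\<lambda>n. - w n) \<in> ghost_sequences p"
proof -
  have "- w (Suc n) - var_frob p (- w n) = - (w (Suc n) - var_frob p (w n))" for n
    by (simp add: var_frob_def)
  then show "w \<in> ghost_sequences p \<Longrightarrow> (\<lambda>n. - w n) \<in> ghost_sequences p"
    by (simp only: ghost_sequences_def mem_Collect_eq dvd_minus_iff) simp
qed

lemma ghost_sequences_mult:
  assumes "v \<in> ghost_sequences p" "w \<in> ghost_sequences p"
  shows "(\<lambda>n. v n * w n) \<in> ghost_sequences p"
  unfolding ghost_sequences_def mem_Collect_eq
proof
  fix n
  have "v (Suc n) * w (Suc n) - var_frob p (v n * w n) =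
      (v (Suc n) - var_frob p (v n)) * w (Suc n) + var_frob p (v n) * (w (Suc n) - var_frob p (w n))"
    by (simp add: var_frob_def algebra_simps)
  then show "of_nat p ^ Suc n dvd v (Suc n) * w (Suc n) - var_frob p (v n * w n)"
    using assms by (simp add: ghost_sequences_def)
qed

lemma ex1_witt_ghost:
  assumes "prime p" "w \<in> ghost_sequences p"
  shows "\<exists>!x. \<forall>n. ghost_poly p n x = w n"
  unfolding ghost_poly_eq_witt_ghost
  using witt_ghost_witt_coords[OF assms] witt_ghost_inj[OF assms(1)] by metis

lemma witt_ghost_witt_sum_poly:
  assumes "prime p"
  shows "witt_ghost p (Suc n) (witt_sum_poly p) =
    witt_ghost p (Suc n) (\<lambda>i. int_mpoly_var (Inl i)) + witt_ghost p (Suc n) (\<lambda>i. int_mpoly_var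
      (Inr i))"
  using theI'[OF ex1_witt_ghost[OF assms ghost_sequences_add[OF witt_ghost_in_ghost_sequences[OF
    assms] witt_ghost_in_ghost_sequences[OF assms]]]]
  unfolding witt_sum_poly_def ghost_poly_eq_witt_ghost by blast

lemma witt_ghost_witt_prod_poly:
  assumes "prime p"
  shows "witt_ghost p (Suc n) (witt_prod_poly p) =
    witt_ghost p (Suc n) (\<lambda>i. int_mpoly_var (Inl i)) * witt_ghost p (Suc n) (\<lambda>i. int_mpoly_var
      (Inr i))"
  using theI'[OF ex1_witt_ghost[OF assms ghost_sequences_mult[OF witt_ghost_in_ghost_sequences[OF
    assms] witt_ghost_in_ghost_sequences[OF assms]]]]
  unfolding witt_prod_poly_def ghost_poly_eq_witt_ghost by blast

lemma witt_coords_add: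
  assumes "prime p" "v \<in> ghost_sequences p" "w \<in> ghost_sequences p"
  shows "witt_coords p (\<lambda>n. v n + w n) i =
    int_mpoly_subst (case_sum (witt_coords p v) (witt_coords p w)) (witt_sum_poly p i)"
proof -
  let ?y = "case_sum (witt_coords p v) (witt_coords p w)"
  have "witt_ghost p (Suc n) (\<lambda>i. int_mpoly_subst ?y (witt_sum_poly p i)) = v n + w n" for n
    unfolding int_mpoly_subst_witt_ghost [symmetric] witt_ghost_witt_sum_poly[OF assms(1)]
      int_mpoly_subst_simps
    unfolding int_mpoly_subst_witt_ghost
    using assms by (simp add: witt_ghost_witt_coords)
  then have "witt_coords p (\<lambda>n. v n + w n) = (\<lambda>i. int_mpoly_subst ?y (witt_sum_poly p i))"
    using assms by (intro witt_ghost_inj[OF assms(1)]) (simp add: witt_ghost_witt_coords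
      ghost_sequences_add)
  then show ?thesis by simp
qed

lemma witt_coords_mult:
  assumes "prime p" "v \<in> ghost_sequences p" "w \<in> ghost_sequences p"
  shows "witt_coords p (\<lambda>n. v n * w n) i =
    int_mpoly_subst (case_sum (witt_coords p v) (witt_coords p w)) (witt_prod_poly p i)"
proof -
  let ?y = "case_sum (witt_coords p v) (witt_coords p w)"
  have "witt_ghost p (Suc n) (\<lambda>i. int_mpoly_subst ?y (witt_prod_poly p i)) = v n * w n" for n
    unfolding int_mpoly_subst_witt_ghost [symmetric] witt_ghost_witt_prod_poly[OF assms(1)]
      int_mpoly_subst_simps
    unfolding int_mpoly_subst_witt_ghost
    using assms by (simp add: witt_ghost_witt_coords)
  then have "witt_coords p (\<lambda>n. v n * w n) = (\<lambda>i. int_mpoly_subst ?y (witt_prod_poly p i))"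
    using assms by (intro witt_ghost_inj[OF assms(1)]) (simp add: witt_ghost_witt_coords
      ghost_sequences_mult)
  then show ?thesis by simp
qed

text \<open>
  All variables of \<open>P\<close> belong to \<open>V\<close>.
\<close>

definition vars_in :: "'v set \<Rightarrow> 'v int_mpoly \<Rightarrow> bool" where
  "vars_in V P \<longleftrightarrow> (\<forall>M\<in>Poly_Mapping.keys P. Poly_Mapping.keys M \<subseteq> V)"

lemma vars_in_add: "vars_in V P \<Longrightarrow> vars_in V Q \<Longrightarrow> vars_in V (P + Q)"
  unfolding vars_in_def using keys_add[of P Q] by blast

lemma vars_in_diff: "vars_in V P \<Longrightarrow> vars_in V Q \<Longrightarrow> vars_in V (P - Q)"
  unfolding vars_in_def using keys_diff[of P Q] by blast

lemma vars_in_mult: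
  assumes "vars_in V P" "vars_in V Q"
  shows "vars_in V (P * Q)"
  unfolding vars_in_def
proof
  fix M assume "M \<in> Poly_Mapping.keys (P * Q)"
  then obtain A B where "M = A + B" "A \<in> Poly_Mapping.keys P" "B \<in> Poly_Mapping.keys Q"
    using keys_mult[of P Q] by blast
  then show "Poly_Mapping.keys M \<subseteq> V" using assms keys_add[of A B] unfolding vars_in_def by blast
qed

lemma vars_in_of_nat: "vars_in V (of_nat n)"
  using single_of_nat[of n, where 'a = "'a \<Rightarrow>\<^sub>0 nat" and 'b = int]
    by (auto simp: vars_in_def simp flip: single_of_nat)

lemma vars_in_power: "vars_in V P \<Longrightarrow> vars_in V (P ^ n)"
  by (induction n) (auto intro: vars_in_mult vars_in_of_nat[of _ 1, simplified])

lemma vars_in_sum: "(\<And>i. i \<in> A \<Longrightarrow> vars_in V (f i)) \<Longrightarrow> vars_in V (sum f A)"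
  by (induction A rule: infinite_finite_induct) (auto intro: vars_in_add vars_in_of_nat[of _ 0,
    simplified])

lemma vars_in_var: "v \<in> V \<Longrightarrow> vars_in V (int_mpoly_var v)"
  by (simp add: vars_in_def int_mpoly_var_def)

lemma vars_in_of_nat_mult_cancel:
  assumes "vars_in V (of_nat n * P)" "n > 0"
  shows "vars_in V P"
proof -
  have "Poly_Mapping.keys (of_nat n * P) = Poly_Mapping.keys P"
    using assms(2) by (auto simp: in_keys_iff lookup_of_nat_mult)
  then show ?thesis using assms(1) by (simp add: vars_in_def)
qed

lemma vars_in_mono: "vars_in V P \<Longrightarrow> V \<subseteq> W \<Longrightarrow> vars_in W P"
  by (auto simp: vars_in_def)

lemma vars_in_witt_ghost: "(\<And>i. i < m \<Longrightarrow> vars_in V (x i)) \<Longrightarrow> vars_in V (witt_ghost p m x)"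
  unfolding witt_ghost_def
  by (intro vars_in_sum vars_in_mult vars_in_power vars_in_of_nat) auto

text \<open>
  The components inherit the variables of the ghost components, since division by \<open>p\<^sup>n\<close> does not change
  the set of monomials.
\<close>

lemma vars_in_of_vars_in_witt_ghost:
  assumes "p > 0" "\<And>n. vars_in (V n) (witt_ghost p (Suc n) x)" "\<And>m n. m \<le> n \<Longrightarrow> V m \<subseteq> V n"
  shows "vars_in (V n) (x n)"
proof (induction n rule: less_induct)
  case (less n)
  have "of_nat (p ^ n) * x n = witt_ghost p (Suc n) x - (\<Sum>i<n. of_nat p ^ i * x i ^ (p ^ (n - i)))"
    by (simp add: witt_ghost_Suc_last)
  moreover have "vars_in (V n) \<dots>"
    using assms(3) less
    by (intro vars_in_diff assms(2) vars_in_sum vars_in_mult vars_in_power vars_in_of_nat)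
      (metis lessThan_iff less_imp_le vars_in_mono)
  ultimately show ?case using assms(1) vars_in_of_nat_mult_cancel[of "V n" "p ^ n"] by simp
qed

lemma vars_in_witt_sum_poly:
  assumes "prime p"
  shows "vars_in (Inl ` {..n} \<union> Inr ` {..n}) (witt_sum_poly p n)"
proof (rule vars_in_of_vars_in_witt_ghost[OF prime_gt_0_nat[OF assms]])
  show "vars_in (Inl ` {..n} \<union> Inr ` {..n}) (witt_ghost p (Suc n) (witt_sum_poly p))" for n
    unfolding witt_ghost_witt_sum_poly[OF assms]
    by (intro vars_in_add vars_in_witt_ghost vars_in_var) auto
qed auto

lemma vars_in_witt_prod_poly:
  assumes "prime p"
  shows "vars_in (Inl ` {..n} \<union> Inr ` {..n}) (witt_prod_poly p n)"
proof (rule vars_in_of_vars_in_witt_ghost[OF prime_gt_0_nat[OF assms]])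
  show "vars_in (Inl ` {..n} \<union> Inr ` {..n}) (witt_ghost p (Suc n) (witt_prod_poly p))" for n
    unfolding witt_ghost_witt_prod_poly[OF assms]
    by (intro vars_in_mult vars_in_witt_ghost vars_in_var) auto
qed auto

section \<open>The ring of truncated Witt vectors\<close>

locale witt_cring = cring R for R (structure) +
  fixes p :: nat
  assumes prime_p: "prime p"
begin

lemma p_pos: "p > 0"
  using prime_p prime_gt_0_nat by blast

text \<open>
  The elements of the type serve as variables, evaluated at themselves; those outside the carrier are
  sent to zero.
\<close>

definition elem_assignment :: "'a \<Rightarrow> 'a" where
  "elem_assignment c = (if c \<in> carrier R then c else \<zero>)"

lemma range_elem_assignment: "range elem_assignment \<subseteq> carrier R"
  by (auto simp: elem_assignment_def)

lemma ring_image_eval: "ring_image UNIV (int_mpoly_eval R elem_assignment) R"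
proof
  show "carrier R = range (int_mpoly_eval R elem_assignment)"
  proof
    show "carrier R \<subseteq> range (int_mpoly_eval R elem_assignment)"
    proof
      fix c assume "c \<in> carrier R"
      then have "c = int_mpoly_eval R elem_assignment (int_mpoly_var c)"
        using range_elem_assignment by (simp add: int_mpoly_eval_var elem_assignment_def)
      then show "c \<in> range (int_mpoly_eval R elem_assignment)" by blast
    qed
  qed (use range_elem_assignment in auto)
qed (use range_elem_assignment in \<open>auto simp: int_mpoly_eval_0 int_mpoly_eval_1 int_mpoly_eval_add
  int_mpoly_eval_mult\<close>)

sublocale eval: ring_image UNIV "int_mpoly_eval R elem_assignment" R
  by (rule ring_image_eval)

text \<open>
  The Witt components of a ghost sequence, evaluated in \<open>R\<close> and truncated.
\<close>

definition witt_eval :: "nat \<Rightarrow> (nat \<Rightarrow> 'a int_mpoly) \<Rightarrow> 'a list" where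
  "witt_eval m w = map (\<lambda>i. int_mpoly_eval R elem_assignment (witt_coords p w i)) [0..<m]"

lemma witt_nth_closed: "xs \<in> carrier (witt_ring p m R) \<Longrightarrow> i < m \<Longrightarrow> xs ! i \<in> carrier R"
  by (auto simp: witt_ring_def)

lemma witt_op_cong:
  assumes "vars_in (Inl ` {..i} \<union> Inr ` {..i}) P"
    and "\<And>j. j \<le> i \<Longrightarrow> x j = x' j" "\<And>j. j \<le> i \<Longrightarrow> y j = y' j" "range x' \<subseteq> carrier R" "range y' \<subseteq> carrier
      R"
  shows "int_mpoly_eval R (case_sum x y) P = int_mpoly_eval R (case_sum x' y') P"
proof (rule int_mpoly_eval_cong[OF _ is_cring])
  fix M v assume "M \<in> Poly_Mapping.keys P" "v \<in> Poly_Mapping.keys M"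
  then have "v \<in> Inl ` {..i} \<union> Inr ` {..i}" using assms(1) by (auto simp: vars_in_def)
  then show "case_sum x y v = case_sum x' y' v" using assms(2,3) by auto
next
  show "range (case_sum x' y') \<subseteq> carrier R" using assms(4,5)
    by (auto split: sum.split simp: range_subsetD)
qed

lemma witt_eval_op:
  assumes "i < m" "vars_in (Inl ` {..i} \<union> Inr ` {..i}) P"
  shows "int_mpoly_eval R elem_assignment (int_mpoly_subst (case_sum (witt_coords p v)
    (witt_coords p w)) P) =
    int_mpoly_eval R (case_sum (nth (witt_eval m v)) (nth (witt_eval m w))) P"
proof -
  have "int_mpoly_eval R (case_sum (nth (witt_eval m v)) (nth (witt_eval m w))) P =
      int_mpoly_eval R (case_sum (\<lambda>j. int_mpoly_eval R elem_assignment (witt_coords p v j))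
         (\<lambda>j. int_mpoly_eval R elem_assignment (witt_coords p w j))) P"
    using assms by (intro witt_op_cong[OF assms(2)]) (auto simp: witt_eval_def)
  also have "case_sum (\<lambda>j. int_mpoly_eval R elem_assignment (witt_coords p v j))
         (\<lambda>j. int_mpoly_eval R elem_assignment (witt_coords p w j)) =
      (\<lambda>u. int_mpoly_eval R elem_assignment (case_sum (witt_coords p v) (witt_coords p w) u))"
    by (auto split: sum.split)
  finally show ?thesis by (simp add: int_mpoly_eval_subst[OF is_cring range_elem_assignment])
qed

lemma ring_image_witt_eval: "ring_image (ghost_sequences p) (witt_eval m) (witt_ring p m R)"
proof
  show "0 \<in> ghost_sequences p" using ghost_sequences_const[of 0 p] by (simp add: zero_fun_def)
  show "1 \<in> ghost_sequences p" using ghost_sequences_const[of 1 p] by (simp add: one_fun_def)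
  show "v + w \<in> ghost_sequences p" "v * w \<in> ghost_sequences p" "- w \<in> ghost_sequences p"
    if "v \<in> ghost_sequences p" "w \<in> ghost_sequences p" for v w :: "nat \<Rightarrow> 'a int_mpoly"
    using that ghost_sequences_add ghost_sequences_mult ghost_sequences_uminus
    by (auto simp: plus_fun_def times_fun_def fun_Compl_def)
  have ghost0: "witt_ghost p n (\<lambda>_. 0) = (0 :: 'a int_mpoly)" for n
    using p_pos by (simp add: witt_ghost_def power_0_left)
  have "witt_coords p 0 = (\<lambda>_. 0 :: 'a int_mpoly)"
    using witt_coords_witt_ghost[OF prime_p, of "\<lambda>_. 0 :: 'a int_mpoly"]
      by (simp add: ghost0 zero_fun_def)
  then show "witt_eval m 0 = \<zero>\<^bsub>witt_ring p m R\<^esub>"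
    by (simp add: witt_eval_def witt_ring_def int_mpoly_eval_0 map_replicate_const)
  have "witt_coords p 1 = (\<lambda>i. if i = 0 then 1 else 0 :: 'a int_mpoly)"
    using witt_coords_witt_ghost[OF prime_p, of "\<lambda>i. if i = 0 then 1 else 0 :: 'a int_mpoly"]
    by (simp add: ghost0 one_fun_def witt_ghost_Suc)
  then show "witt_eval m 1 = \<one>\<^bsub>witt_ring p m R\<^esub>"
    by (simp add: witt_eval_def witt_ring_def eval.f_0 eval.f_1)
  fix v w :: "nat \<Rightarrow> 'a int_mpoly"
  assume vw: "v \<in> ghost_sequences p" "w \<in> ghost_sequences p"
  let ?x = "case_sum (nth (witt_eval m v)) (nth (witt_eval m w))"
  have "witt_eval m (\<lambda>n. v n + w n) = map (\<lambda>i. int_mpoly_eval R ?x (witt_sum_poly p i)) [0..<m]"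
    unfolding witt_eval_def[of m "\<lambda>n. v n + w n"] witt_coords_add[OF prime_p vw]
    using witt_eval_op[OF _ vars_in_witt_sum_poly[OF prime_p]] by simp
  then show "witt_eval m (v + w) = witt_eval m v \<oplus>\<^bsub>witt_ring p m R\<^esub> witt_eval m w"
    by (simp add: witt_ring_def plus_fun_def)
  have "witt_eval m (\<lambda>n. v n * w n) = map (\<lambda>i. int_mpoly_eval R ?x (witt_prod_poly p i)) [0..<m]"
    unfolding witt_eval_def[of m "\<lambda>n. v n * w n"] witt_coords_mult[OF prime_p vw]
    using witt_eval_op[OF _ vars_in_witt_prod_poly[OF prime_p]] by simp
  then show "witt_eval m (v * w) = witt_eval m v \<otimes>\<^bsub>witt_ring p m R\<^esub> witt_eval m w"
    by (simp add: witt_ring_def times_fun_def)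
next
  show "carrier (witt_ring p m R) = witt_eval m ` ghost_sequences p"
  proof
    show "witt_eval m ` ghost_sequences p \<subseteq> carrier (witt_ring p m R)"
      by (auto simp: witt_eval_def witt_ring_def)
    show "carrier (witt_ring p m R) \<subseteq> witt_eval m ` ghost_sequences p"
    proof
      fix xs assume xs: "xs \<in> carrier (witt_ring p m R)"
      define w where "w = (\<lambda>n. witt_ghost p (Suc n) (\<lambda>i. int_mpoly_var (xs ! i)))"
      have "int_mpoly_eval R elem_assignment (int_mpoly_var (xs ! i)) = xs ! i" if "i < m" for i
        using witt_nth_closed[OF xs that] by (simp add: int_mpoly_eval_var[OF range_elem_assignment]
          elem_assignment_def)
      then have "witt_eval m w = xs"
        using xs by (intro nth_equalityI) (auto simp: witt_eval_def w_def witt_coords_witt_ghost[OF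
          prime_p] witt_ring_def)
      moreover have "w \<in> ghost_sequences p"
        unfolding w_def by (rule witt_ghost_in_ghost_sequences[OF prime_p])
      ultimately show "xs \<in> witt_eval m ` ghost_sequences p" by blast
    qed
  qed
qed

lemma cring_witt_ring: "cring (witt_ring p m R)"
  by (rule ring_image.is_cring[OF ring_image_witt_eval])

lemma witt_sum_poly_0: "witt_sum_poly p 0 = int_mpoly_var (Inl 0) + int_mpoly_var (Inr 0)"
  using witt_ghost_witt_sum_poly[OF prime_p, of 0] by (simp add: witt_ghost_def)

lemma witt_prod_poly_0: "witt_prod_poly p 0 = int_mpoly_var (Inl 0) * int_mpoly_var (Inr 0)"
  using witt_ghost_witt_prod_poly[OF prime_p, of 0] by (simp add: witt_ghost_def)

lemma range_case_sum_nth: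
  assumes "xs \<in> carrier (witt_ring p m R)" "ys \<in> carrier (witt_ring p m R)"
  shows "range (case_sum (\<lambda>j. if j < m then xs ! j else \<zero>) (\<lambda>j.
    if j < m then ys ! j else \<zero>)) \<subseteq> carrier R"
  using assms by (auto simp: witt_nth_closed split: sum.splits)

lemma witt_op_nth:
  assumes "xs \<in> carrier (witt_ring p m R)" "ys \<in> carrier (witt_ring p m R)" "i < m"
    and "vars_in (Inl ` {..i} \<union> Inr ` {..i}) P"
  shows "int_mpoly_eval R (case_sum (nth xs) (nth ys)) P =
    int_mpoly_eval R (case_sum (\<lambda>j. if j < m then xs ! j else \<zero>) (\<lambda>j. if j < m then ys ! j else \<zero>)) P"
  using assms by (intro witt_op_cong[OF assms(4)]) (auto simp: witt_ring_def)

text \<open>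
  This lemma and the following ones show that the first component, the restriction and the map induced
  by an endomorphism are compatible with the ring operations.
\<close>

lemma hd_witt_ring:
  assumes "xs \<in> carrier (witt_ring p m R)" "ys \<in> carrier (witt_ring p m R)" "m > 0"
  shows "hd (xs \<oplus>\<^bsub>witt_ring p m R\<^esub> ys) = hd xs \<oplus> hd ys"
    and "hd (xs \<otimes>\<^bsub>witt_ring p m R\<^esub> ys) = hd xs \<otimes> hd ys"
    and "hd \<one>\<^bsub>witt_ring p m R\<^esub> = \<one>"
    and "hd xs \<in> carrier R"
proof -
  have r: "range (case_sum (\<lambda>j. if j < m then xs ! j else \<zero>) (\<lambda>j.
    if j < m then ys ! j else \<zero>)) \<subseteq> carrier R"
    by (rule range_case_sum_nth[OF assms(1,2)])
  have "xs \<noteq> []" "ys \<noteq> []" using assms by (auto simp: witt_ring_def)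
  then have hd: "xs ! 0 = hd xs" "ys ! 0 = hd ys" by (simp_all add: hd_conv_nth)
  have s: "\<And>xs. length xs = m \<Longrightarrow> hd xs = xs ! 0" using assms(3) by (auto simp: hd_conv_nth)
  show "hd (xs \<oplus>\<^bsub>witt_ring p m R\<^esub> ys) = hd xs \<oplus> hd ys"
    using witt_op_nth[OF assms vars_in_witt_sum_poly[OF prime_p, of 0]] assms(3)
    by (subst s) (simp_all add: witt_ring_def witt_sum_poly_0 int_mpoly_eval_add[OF r]
      int_mpoly_eval_var[OF r] hd)
  show "hd (xs \<otimes>\<^bsub>witt_ring p m R\<^esub> ys) = hd xs \<otimes> hd ys"
    using witt_op_nth[OF assms vars_in_witt_prod_poly[OF prime_p, of 0]] assms(3)
    by (subst s) (simp_all add: witt_ring_def witt_prod_poly_0 int_mpoly_eval_mult[OF r]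
      int_mpoly_eval_var[OF r] hd)
  show "hd \<one>\<^bsub>witt_ring p m R\<^esub> = \<one>"
    using assms(3) by (subst s) (simp_all add: witt_ring_def)
  show "hd xs \<in> carrier R"
    using assms by (auto simp: witt_ring_def simp flip: hd(1))
qed

lemma butlast_witt_ring:
  assumes "xs \<in> carrier (witt_ring p (Suc m) R)" "ys \<in> carrier (witt_ring p (Suc m) R)"
  shows "butlast (xs \<oplus>\<^bsub>witt_ring p (Suc m) R\<^esub> ys) = butlast xs \<oplus>\<^bsub>witt_ring p m R\<^esub> butlast ys"
    and "butlast (xs \<otimes>\<^bsub>witt_ring p (Suc m) R\<^esub> ys) = butlast xs \<otimes>\<^bsub>witt_ring p m R\<^esub> butlast ys"
    and "butlast xs \<in> carrier (witt_ring p m R)"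
proof -
  have op: "int_mpoly_eval R (case_sum (nth xs) (nth ys)) P =
    int_mpoly_eval R (case_sum (nth (butlast xs)) (nth (butlast ys))) P"
    if "i < m" "vars_in (Inl ` {..i} \<union> Inr ` {..i}) P" for i P
  proof -
    have "int_mpoly_eval R (case_sum (nth (butlast xs)) (nth (butlast ys))) P =
      int_mpoly_eval R (case_sum (\<lambda>j. if j < Suc m then xs ! j else \<zero>) (\<lambda>j.
        if j < Suc m then ys ! j else \<zero>)) P"
      using assms that by (intro witt_op_cong[OF that(2)]) (auto simp: witt_ring_def nth_butlast)
    then show ?thesis using witt_op_nth[OF assms _ that(2)] that(1) by simp
  qed
  show "butlast (xs \<oplus>\<^bsub>witt_ring p (Suc m) R\<^esub> ys) = butlast xs \<oplus>\<^bsub>witt_ring p m R\<^esub> butlast ys"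
    "butlast (xs \<otimes>\<^bsub>witt_ring p (Suc m) R\<^esub> ys) = butlast xs \<otimes>\<^bsub>witt_ring p m R\<^esub> butlast ys"
    using op vars_in_witt_sum_poly[OF prime_p] vars_in_witt_prod_poly[OF prime_p]
    by (auto simp: witt_ring_def simp flip: map_butlast)
  show "butlast xs \<in> carrier (witt_ring p m R)"
    using assms by (auto simp: witt_ring_def dest: in_set_butlastD)
qed

lemma butlast_witt_ring_one: "butlast \<one>\<^bsub>witt_ring p (Suc m) R\<^esub> = \<one>\<^bsub>witt_ring p m R\<^esub>"
  by (simp add: witt_ring_def)

lemma map_witt_ring:
  assumes xs: "xs \<in> carrier (witt_ring p m R)" and ys: "ys \<in> carrier (witt_ring p m R)"
    and h: "h \<in> ring_hom R R"
  shows "map h (xs \<oplus>\<^bsub>witt_ring p m R\<^esub> ys) = map h xs \<oplus>\<^bsub>witt_ring p m R\<^esub> map h ys"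
    and "map h (xs \<otimes>\<^bsub>witt_ring p m R\<^esub> ys) = map h xs \<otimes>\<^bsub>witt_ring p m R\<^esub> map h ys"
    and "map h xs \<in> carrier (witt_ring p m R)"
proof -
  interpret h: ring_hom_cring R R h
    by (intro ring_hom_cring.intro ring_hom_cring_axioms.intro h is_cring)
  show mem: "map h xs \<in> carrier (witt_ring p m R)" using xs by (auto simp: witt_ring_def)
  have mem': "map h ys \<in> carrier (witt_ring p m R)" using ys by (auto simp: witt_ring_def)
  have op: "h (int_mpoly_eval R (case_sum (nth xs) (nth ys)) P) =
    int_mpoly_eval R (case_sum (nth (map h xs)) (nth (map h ys))) P"
    if i: "i < m" and P: "vars_in (Inl ` {..i} \<union> Inr ` {..i}) P" for i P
  proof -
    let ?x = "\<lambda>xs. \<lambda>j. if j < m then xs ! j else \<zero>"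
    have r: "range (case_sum (?x xs) (?x ys)) \<subseteq> carrier R"
      by (rule range_case_sum_nth[OF xs ys])
    have "h (int_mpoly_eval R (case_sum (?x xs) (?x ys)) P) =
      int_mpoly_eval R (\<lambda>u. h (case_sum (?x xs) (?x ys) u)) P"
      by (rule ring_hom_int_mpoly_eval[OF is_cring is_cring r]) auto
    also have "(\<lambda>u. h (case_sum (?x xs) (?x ys) u)) = case_sum (?x (map h xs)) (?x (map h ys))"
      using xs ys by (auto simp: witt_ring_def intro: subsetD[OF _ nth_mem] split: sum.split)
    finally show ?thesis
      unfolding witt_op_nth[OF xs ys i P] witt_op_nth[OF mem mem' i P] .
  qed
  show "map h (xs \<oplus>\<^bsub>witt_ring p m R\<^esub> ys) = map h xs \<oplus>\<^bsub>witt_ring p m R\<^esub> map h ys"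
    "map h (xs \<otimes>\<^bsub>witt_ring p m R\<^esub> ys) = map h xs \<otimes>\<^bsub>witt_ring p m R\<^esub> map h ys"
    using op vars_in_witt_sum_poly[OF prime_p] vars_in_witt_prod_poly[OF prime_p]
    by (auto simp: witt_ring_def)
qed

lemma map_witt_ring_one: "h \<in> ring_hom R R \<Longrightarrow> map h \<one>\<^bsub>witt_ring p m R\<^esub> = \<one>\<^bsub>witt_ring p m R\<^esub>"
  using ring_hom_zero[OF _ ring_axioms ring_axioms] ring_hom_one[of h R R]
    by (auto simp: witt_ring_def)

end

locale witt_char_p = witt_cring +
  assumes char_p: "[p] \<cdot> \<one> = \<zero>"
begin

lemma eval_p_mult: "int_mpoly_eval R elem_assignment (of_nat p * a) = \<zero>"
proof -
  have "int_mpoly_eval R elem_assignment (of_nat p * a) =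
    [p] \<cdot> (\<one> \<otimes> int_mpoly_eval R elem_assignment a)"
    by (simp add: eval.f_of_nat_mult)
  also have "\<dots> = [p] \<cdot> \<one> \<otimes> int_mpoly_eval R elem_assignment a"
    by (simp only: add_pow_ldistr one_closed eval.f_closed UNIV_I)
  finally show ?thesis by (simp add: char_p)
qed

lemma eval_cong_p:
  assumes "of_nat p dvd a - b"
  shows "int_mpoly_eval R elem_assignment a = int_mpoly_eval R elem_assignment b"
  using assms eval_p_mult by (auto simp: eval.f_eq_iff dvd_def)

lemma frobenius_ring_hom: "(\<lambda>x. x [^] p) \<in> ring_hom R R"
proof (rule ring_hom_memI)
  fix x y assume xy: "x \<in> carrier R" "y \<in> carrier R"
  obtain a b where ab: "x = int_mpoly_eval R elem_assignment a" "y =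
    int_mpoly_eval R elem_assignment b"
    using xy unfolding eval.carrier_eq by blast
  have "int_mpoly_eval R elem_assignment ((a + b) ^ p) = int_mpoly_eval R elem_assignment
    (a ^ p + b ^ p)"
    by (rule eval_cong_p[OF freshmans_dream[OF prime_p]])
  then show "(x \<oplus> y) [^] p = x [^] p \<oplus> y [^] p"
    by (simp add: ab eval.f_add eval.f_power)
  show "(x \<otimes> y) [^] p = x [^] p \<otimes> y [^] p"
    using xy by (rule nat_pow_distrib)
qed auto

text \<open>
  The identity \<open>p = V F\<close>. Over a polynomial ring over the integers the two sides have congruent ghost
  components, hence congruent Witt components modulo \<open>p\<close>.
\<close>

lemma witt_p_mult:
  assumes "xs \<in> carrier (witt_ring p m R)"
  shows "[p] \<cdot>\<^bsub>witt_ring p m R\<^esub> xs = map (\<lambda>i. if i = 0 then \<zero> else (xs ! (i - 1)) [^] p) [0..<m]"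
proof -
  interpret W: ring_image "ghost_sequences p" "witt_eval m" "witt_ring p m R"
    by (rule ring_image_witt_eval)
  obtain w where w: "w \<in> ghost_sequences p" "xs = witt_eval m w"
    using assms unfolding W.carrier_eq by blast
  define a where "a = witt_coords p w"
  define b where "b = witt_coords p (of_nat p * w)"
  define c where "c = (\<lambda>i. if i = 0 then 0 else a (i - 1) ^ p)"
  have "of_nat p dvd b i - c i" for i
  proof (rule witt_ghost_cong_imp_cong[OF prime_p])
    fix n
    have ofn: "(of_nat p * w) n = of_nat p * w n" for n
      by (induction p) (auto simp: algebra_simps)
    have "witt_ghost p (Suc n) b = of_nat p * w n"
      unfolding b_def using witt_ghost_witt_coords[OF prime_p W.S_mult[OF W.S_of_nat w(1)]] ofn by
        simp
    also have "\<dots> = of_nat p * witt_ghost p (Suc n) a"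
      by (simp add: a_def witt_ghost_witt_coords[OF prime_p w(1)])
    also have "\<dots> = witt_ghost p (Suc n) c + of_nat p ^ Suc n * a n"
      using p_pos by (subst witt_ghost_Suc_powers, subst witt_ghost_Suc[of p n c])
        (simp add: c_def power_0_left algebra_simps)
    finally show "of_nat p ^ Suc n dvd witt_ghost p (Suc n) b - witt_ghost p (Suc n) c" by simp
  qed
  then have bc: "int_mpoly_eval R elem_assignment (b i) =
    int_mpoly_eval R elem_assignment (c i)" for i
    by (rule eval_cong_p)
  have "[p] \<cdot>\<^bsub>witt_ring p m R\<^esub> xs = witt_eval m (of_nat p * w)"
    using w by (simp add: W.f_of_nat_mult)
  also have "\<dots> = map (\<lambda>i. int_mpoly_eval R elem_assignment (c i)) [0..<m]"
    by (simp add: witt_eval_def bc flip: b_def)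
  also have "\<dots> = map (\<lambda>i. if i = 0 then \<zero> else (xs ! (i - 1)) [^] p) [0..<m]"
    by (auto simp: c_def w(2) witt_eval_def eval.f_0 eval.f_power a_def)
  finally show ?thesis .
qed

end

section \<open>Witt vectors of a perfect field as quotients of a torsion-free ring\<close>

locale witt_perfect = witt_char_p + field R +
  assumes perfect_R: "(\<lambda>x. x [^] p) ` carrier R = carrier R"
begin

lemma p_power_eq_zero_iff:
  assumes "x \<in> carrier R"
  shows "x [^] p = \<zero> \<longleftrightarrow> x = \<zero>"
proof
  assume x: "x [^] p = \<zero>"
  have "x [^] n = \<zero> \<longrightarrow> x = \<zero>" for n :: nat
    using assms by (induction n) (auto simp: integral_iff)
  then show "x = \<zero>" using x by blast
qed (use p_pos in \<open>simp add: nat_pow_zero\<close>)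

text \<open>
  The sequences of elements of the field serve as variables. The variable of a sequence is sent to the
  Witt vector with this sequence of components, truncated to length \<open>m\<close>.
\<close>

definition seq_assignment :: "nat \<Rightarrow> (nat \<Rightarrow> 'a) \<Rightarrow> 'a list" where
  "seq_assignment m c = map (\<lambda>i. elem_assignment (c i)) [0..<m]"

text \<open>
  The surjection of the polynomial ring onto the Witt vectors of length \<open>m\<close>.
\<close>

definition witt_lift :: "nat \<Rightarrow> (nat \<Rightarrow> 'a) int_mpoly \<Rightarrow> 'a list" where
  "witt_lift m = int_mpoly_eval (witt_ring p m R) (seq_assignment m)"

lemma range_seq_assignment: "range (seq_assignment m) \<subseteq> carrier (witt_ring p m R)"
  by (auto simp: seq_assignment_def witt_ring_def elem_assignment_def)

lemma witt_lift_var: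
  "witt_lift m (int_mpoly_var c) = seq_assignment m c"
  unfolding witt_lift_def by (rule cring.int_mpoly_eval_var[OF cring_witt_ring range_seq_assignment])

lemma seq_assignment_nth:
  assumes "xs \<in> carrier (witt_ring p m R)"
  shows "seq_assignment m (nth xs) = xs"
  using assms witt_nth_closed[OF assms]
  by (intro nth_equalityI) (auto simp: seq_assignment_def elem_assignment_def witt_ring_def)

sublocale lift: ring_image UNIV "witt_lift m" "witt_ring p m R" for m
proof
  note c = cring_witt_ring[of m] and r = range_seq_assignment[of m]
  show "witt_lift m 0 = \<zero>\<^bsub>witt_ring p m R\<^esub>" "witt_lift m 1 = \<one>\<^bsub>witt_ring p m R\<^esub>"
    "witt_lift m (a + b) = witt_lift m a \<oplus>\<^bsub>witt_ring p m R\<^esub> witt_lift m b"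
    "witt_lift m (a * b) = witt_lift m a \<otimes>\<^bsub>witt_ring p m R\<^esub> witt_lift m b" for a b
    unfolding witt_lift_def
    by (simp_all add: cring.int_mpoly_eval_0[OF c] cring.int_mpoly_eval_1[OF c r]
        cring.int_mpoly_eval_add[OF c r] cring.int_mpoly_eval_mult[OF c r])
  show "carrier (witt_ring p m R) = range (witt_lift m)"
  proof
    show "range (witt_lift m) \<subseteq> carrier (witt_ring p m R)"
      unfolding witt_lift_def using cring.int_mpoly_eval_closed[OF c r] by auto
    show "carrier (witt_ring p m R) \<subseteq> range (witt_lift m)"
      using seq_assignment_nth witt_lift_var by (metis rangeI subsetI)
  qed
qed auto

lemma witt_lift_closed: "witt_lift m a \<in> carrier (witt_ring p m R)"
  by simp

lemma length_witt_lift [simp]: "length (witt_lift m a) = m"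
  using witt_lift_closed[of m a] by (simp add: witt_ring_def)

lemma butlast_witt_lift: "butlast (witt_lift (Suc m) a) = witt_lift m a"
proof -
  have "butlast (witt_lift (Suc m) a) = int_mpoly_eval (witt_ring p m R) (\<lambda>c. butlast
    (seq_assignment (Suc m) c)) a"
    unfolding witt_lift_def
    by (rule ring_hom_int_mpoly_eval[OF cring_witt_ring cring_witt_ring range_seq_assignment])
       (auto simp: butlast_witt_ring butlast_witt_ring_one)
  also have "(\<lambda>c. butlast (seq_assignment (Suc m) c)) = seq_assignment m"
    by (auto simp: seq_assignment_def simp flip: map_butlast)
  finally show ?thesis by (simp add: witt_lift_def)
qed

lemma witt_lift_nth_Suc: "i < m \<Longrightarrow> witt_lift (Suc m) a ! i = witt_lift m a ! i"
  using butlast_witt_lift[of m a] nth_butlast[of i "witt_lift (Suc m) a"] by simp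

lemma hd_witt_lift:
  assumes "m > 0"
  shows "hd (witt_lift m a) = hd (witt_lift 1 a)"
proof -
  have "hd (witt_lift (Suc n) a) = hd (witt_lift 1 a)" for n
  proof (induction n)
    case (Suc n)
    have "hd (witt_lift (Suc (Suc n)) a) = hd (butlast (witt_lift (Suc (Suc n)) a))"
      by (metis butlast.simps(2) butlast_witt_lift hd_Cons_tl length_0_conv length_witt_lift
        list.sel(1) nat.distinct(1))
    then show ?case using Suc by (simp add: butlast_witt_lift)
  qed simp
  then show ?thesis using assms by (metis gr0_implies_Suc)
qed

text \<open>
  The first Witt component, a surjection onto the residue field.
\<close>

definition residue_lift :: "(nat \<Rightarrow> 'a) int_mpoly \<Rightarrow> 'a" where
  "residue_lift a = hd (witt_lift 1 a)"

lemma ring_image_residue_lift: "ring_image UNIV residue_lift R"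
proof
  note h = hd_witt_ring[OF witt_lift_closed witt_lift_closed zero_less_one]
  show "residue_lift 0 = \<zero>"
    by (simp add: residue_lift_def lift.f_0) (simp add: witt_ring_def)
  show "residue_lift 1 = \<one>" using h(3) by (simp only: residue_lift_def lift.f_1)
  show "residue_lift (a + b) = residue_lift a \<oplus> residue_lift b"
    "residue_lift (a * b) = residue_lift a \<otimes> residue_lift b" for a b
    using h(1,2) by (simp_all only: residue_lift_def lift.f_add lift.f_mult UNIV_I)
  show "carrier R = range residue_lift"
  proof
    show "range residue_lift \<subseteq> carrier R" using h(4) by (auto simp: residue_lift_def)
    show "carrier R \<subseteq> range residue_lift"
    proof
      fix c assume "c \<in> carrier R"
      then have "c = residue_lift (int_mpoly_var (\<lambda>_. c))"
        by (simp add: residue_lift_def witt_lift_var seq_assignment_def elem_assignment_def)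
      then show "c \<in> range residue_lift" by blast
    qed
  qed
qed auto

sublocale residue: ring_image UNIV residue_lift R
  by (rule ring_image_residue_lift)

text \<open>
  The kernels of the surjections onto the Witt vectors of length \<open>m\<close>; these are the ideals \<open>J m\<close>.
\<close>

definition witt_kernel :: "nat \<Rightarrow> (nat \<Rightarrow> 'a) int_mpoly set" where
  "witt_kernel m = {a. witt_lift m a = \<zero>\<^bsub>witt_ring p m R\<^esub>}"

lemma mem_witt_kernel_iff: "a \<in> witt_kernel m \<longleftrightarrow> (\<forall>i<m. witt_lift m a ! i = \<zero>)"
proof -
  have "a \<in> witt_kernel m \<longleftrightarrow> witt_lift m a = replicate m \<zero>"
    by (simp add: witt_kernel_def witt_ring_def)
  also have "\<dots> \<longleftrightarrow> (\<forall>i<m. witt_lift m a ! i = \<zero>)"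
    by (auto simp: list_eq_iff_nth_eq)
  finally show ?thesis .
qed

lemma diff_mem_witt_kernel_iff: "a - b \<in> witt_kernel m \<longleftrightarrow> witt_lift m a = witt_lift m b"
  using lift.f_eq_iff[of a b m] by (simp add: witt_kernel_def)

lemma diff_mem_witt_kernel_1_iff: "a - b \<in> witt_kernel 1 \<longleftrightarrow> residue_lift a = residue_lift b"
proof -
  have "xs = [hd xs]" if "length xs = 1" for xs :: "'a list"
    using that by (cases xs) auto
  then have "witt_lift 1 a = [residue_lift a]" for a
    unfolding residue_lift_def using length_witt_lift by blast
  then show ?thesis by (simp add: diff_mem_witt_kernel_iff)
qed

lemma witt_lift_p_mult:
  "witt_lift m (of_nat p * a) = map (\<lambda>i. if i = 0 then \<zero> else (witt_lift m a !
    (i - 1)) [^] p) [0..<m]"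
  using witt_p_mult[OF witt_lift_closed] by (simp add: lift.f_of_nat_mult)

text \<open>
  The componentwise \<open>p\<close>-th power of a sequence, and the endomorphism of the polynomial ring that it
  induces; the latter is the lift \<open>\<sigma>\<close> of the Frobenius.
\<close>

definition seq_frob :: "(nat \<Rightarrow> 'a) \<Rightarrow> nat \<Rightarrow> 'a" where
  "seq_frob c i = elem_assignment (c i) [^] p"

definition witt_lift_frob :: "(nat \<Rightarrow> 'a) int_mpoly \<Rightarrow> (nat \<Rightarrow> 'a) int_mpoly" where
  "witt_lift_frob = int_mpoly_subst (\<lambda>c. int_mpoly_var (seq_frob c))"

lemma witt_lift_witt_lift_frob: "witt_lift m (witt_lift_frob a) = map (\<lambda>x. x [^] p) (witt_lift m a)"
proof -
  have "witt_lift m (witt_lift_frob a) = int_mpoly_eval (witt_ring p m R) (\<lambda>c. witt_lift m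
    (int_mpoly_var (seq_frob c))) a"
    unfolding witt_lift_frob_def witt_lift_def
    by (rule int_mpoly_eval_subst[OF cring_witt_ring range_seq_assignment])
  also have "(\<lambda>c. witt_lift m (int_mpoly_var (seq_frob c))) =
    (\<lambda>c. map (\<lambda>x. x [^] p) (seq_assignment m c))"
    using range_elem_assignment by (auto simp: witt_lift_var seq_assignment_def seq_frob_def
      elem_assignment_def)
  also have "int_mpoly_eval (witt_ring p m R) \<dots> a = map (\<lambda>x. x [^] p) (witt_lift m a)"
    unfolding witt_lift_def
    by (rule ring_hom_int_mpoly_eval[OF cring_witt_ring cring_witt_ring range_seq_assignment,
      symmetric])
       (auto simp: map_witt_ring map_witt_ring_one frobenius_ring_hom)
  finally show ?thesis .
qed

lemma ex_p_root: "x \<in> carrier R \<Longrightarrow> \<exists>y. y \<in> carrier R \<and> y [^] p = x"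
  using perfect_R by (metis (no_types, lifting) imageE)

lemma frobenius_lift_witt: "frobenius_lift p witt_kernel witt_lift_frob"
proof
  show "prime p" by (rule prime_p)
  show "a = 0" if "of_nat p * a = 0" for a :: "(nat \<Rightarrow> 'a) int_mpoly"
    by (rule int_mpoly_torsion_free[of p]) (use that p_pos in auto)
  show "0 \<in> witt_kernel m" for m by (simp add: witt_kernel_def lift.f_0)
  show "a + b \<in> witt_kernel m" if "a \<in> witt_kernel m" "b \<in> witt_kernel m" for a b m
    using that by (simp add: witt_kernel_def lift.f_add)
  show "c * a \<in> witt_kernel m" if "a \<in> witt_kernel m" for a c m
    using that by (simp add: witt_kernel_def lift.f_mult)
  show "witt_kernel 0 = UNIV" by (auto simp: mem_witt_kernel_iff)
  show "witt_kernel (Suc m) \<subseteq> witt_kernel m" for m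
    unfolding subset_iff mem_witt_kernel_iff by (metis less_SucI witt_lift_nth_Suc)
  show "of_nat p * a \<in> witt_kernel (Suc m) \<longleftrightarrow> a \<in> witt_kernel m" for a m
  proof -
    have "of_nat p * a \<in> witt_kernel (Suc m) \<longleftrightarrow>
        (\<forall>i<Suc m. (if i = 0 then \<zero> else (witt_lift (Suc m) a ! (i - 1)) [^] p) = \<zero>)"
      unfolding mem_witt_kernel_iff witt_lift_p_mult by (auto simp del: upt_Suc)
    also have "\<dots> \<longleftrightarrow> (\<forall>i<m. (witt_lift (Suc m) a ! i) [^] p = \<zero>)"
      by (auto simp: less_Suc_eq_0_disj)
    also have "\<dots> \<longleftrightarrow> a \<in> witt_kernel m"
      using witt_nth_closed[OF witt_lift_closed]
      by (auto simp: mem_witt_kernel_iff p_power_eq_zero_iff witt_lift_nth_Suc)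
    finally show ?thesis .
  qed
  show "\<exists>b. a - of_nat p * b \<in> witt_kernel m" if "a \<in> witt_kernel 1" for a m
  proof (cases "m = 0")
    case True
    then show ?thesis by (auto simp: mem_witt_kernel_iff)
  next
    case False
    have "residue_lift a = \<zero>"
      using that diff_mem_witt_kernel_1_iff[of a 0] residue.f_0 by simp
    then have "hd (witt_lift m a) = \<zero>"
      using hd_witt_lift[of m a] False by (simp only: residue_lift_def neq0_conv)
    then have 0: "witt_lift m a ! 0 = \<zero>" using False length_witt_lift[of m a]
      by (metis hd_conv_nth list.size(3))
    \<comment> \<open>A Witt vector with first component zero is \<open>p\<close> times the vector of the \<open>p\<close>-th roots of its other
      components.\<close>
    have "\<forall>i. \<exists>y. y \<in> carrier R \<and> (Suc i < m \<longrightarrow> y [^] p = witt_lift m a ! Suc i)"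
      using ex_p_root witt_nth_closed[OF witt_lift_closed] by (metis zero_closed)
    then obtain c where c: "c i \<in> carrier R" "Suc i < m \<Longrightarrow> c i [^] p = witt_lift m a ! Suc i" for i
      by metis
    have "witt_lift m (of_nat p * int_mpoly_var c) = witt_lift m a"
    proof (rule nth_equalityI)
      fix i assume "i < length (witt_lift m (of_nat p * int_mpoly_var c))"
      then show "witt_lift m (of_nat p * int_mpoly_var c) ! i = witt_lift m a ! i"
        using 0 c by (cases i) (auto simp: witt_lift_p_mult witt_lift_var seq_assignment_def
          elem_assignment_def)
    qed simp
    then show ?thesis using diff_mem_witt_kernel_iff by metis
  qed
  show "witt_lift_frob (a + b) = witt_lift_frob a + witt_lift_frob b"
    "witt_lift_frob (a * b) = witt_lift_frob a * witt_lift_frob b" "witt_lift_frob 1 = 1" for a b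
    by (simp_all add: witt_lift_frob_def)
  show "witt_lift_frob a \<in> witt_kernel m \<longleftrightarrow> a \<in> witt_kernel m" for a m
    using witt_nth_closed[OF witt_lift_closed]
    by (auto simp: mem_witt_kernel_iff witt_lift_witt_lift_frob p_power_eq_zero_iff)
  have res: "residue_lift (witt_lift_frob a) = residue_lift a [^] p" for a
    unfolding residue_lift_def witt_lift_witt_lift_frob
    by (rule list.map_sel(1)) (metis length_witt_lift list.size(3) zero_neq_one)
  show "witt_lift_frob a - a ^ p \<in> witt_kernel 1" for a
    by (simp only: diff_mem_witt_kernel_1_iff res residue.f_power UNIV_I)
  show "\<exists>b. a - b ^ p \<in> witt_kernel 1" for a
  proof -
    obtain y where y: "y \<in> carrier R" "y [^] p = residue_lift a"
      using ex_p_root[of "residue_lift a"] by auto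
    then obtain b where "y = residue_lift b" unfolding residue.carrier_eq by blast
    then have "residue_lift a = residue_lift (b ^ p)" using y(2) by (simp add: residue.f_power)
    then show ?thesis using diff_mem_witt_kernel_1_iff by blast
  qed
qed

sublocale frobenius_lift p witt_kernel witt_lift_frob
  by (rule frobenius_lift_witt)

end

section \<open>Polynomial rings over images of commutative rings\<close>

text \<open>
  The map of polynomials that applies \<open>e\<close> to the coefficients.
\<close>

definition mpoly_map :: "('c::zero \<Rightarrow> 'x) \<Rightarrow> ('v multiset \<Rightarrow>\<^sub>0 'c) \<Rightarrow> 'v multiset \<Rightarrow> 'x" where
  "mpoly_map e f = (\<lambda>s. e (lookup f s))"

lemma ring_image_mpoly_map:
  fixes e :: "'c::comm_ring_1 \<Rightarrow> 'x" and I :: "'v set"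
  assumes "ring_image UNIV e R"
  shows "ring_image {f. supported_in I f} (mpoly_map e) (mpoly_ring R I)"
proof -
  interpret ring_image UNIV e R by fact
  have const: "mpoly_map e (Poly_Mapping.single {#} c) = indexed_const (e c)" for c
    by (auto simp: mpoly_map_def indexed_const_def lookup_single when_def f_0)
  have add: "mpoly_map e (f + g) = indexed_padd (mpoly_map e f) (mpoly_map e g)"
    for f g :: "'v multiset \<Rightarrow>\<^sub>0 'c"
    by (auto simp: mpoly_map_def indexed_padd_def lookup_add f_add)
  have pmult: "mpoly_map e (f * Poly_Mapping.single {#i#} 1) =
    indexed_pmult (mpoly_map e f) i" for f :: "'v multiset \<Rightarrow>\<^sub>0 'c" and i
  proof
    fix M
    have "lookup (f * Poly_Mapping.single {#i#} 1) M = (\<Sum>N\<in>{N. N \<subseteq># M}. if N =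
      M - {#i#} \<and> i \<in># M then lookup f N else 0)"
      unfolding lookup_times_mset
    proof (intro sum.cong refl)
      fix N assume "N \<in> {N. N \<subseteq># M}"
      then have "M - N = {#i#} \<longleftrightarrow> N = M - {#i#} \<and> i \<in># M"
        by (metis (mono_tags, lifting) add_mset_add_single diff_add_mset_swap insert_DiffM2
          mem_Collect_eq
            subset_mset.add_diff_inverse subset_mset.diff_add_assoc2 add_diff_cancel_left'
              add_diff_cancel_right' multi_member_this)
      then show "lookup f N * lookup (Poly_Mapping.single {#i#} 1) (M - N) = (if N =
        M - {#i#} \<and> i \<in># M then lookup f N else 0)"
        by (auto simp: lookup_single when_def)
    qed
    also have "\<dots> = (if i \<in># M then lookup f (M - {#i#}) else 0)"
      by (auto simp: finite_submultisets)
    finally show "mpoly_map e (f * Poly_Mapping.single {#i#} 1) M = indexed_pmult (mpoly_map e f) i M"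
      by (simp add: mpoly_map_def indexed_pmult_def f_0)
  qed
  have closed: "mpoly_map e f \<in> indexed_pset I (carrier R)"
    if "supported_in I f" for f :: "'v multiset \<Rightarrow>\<^sub>0 'c"
  proof -
    have single: "mpoly_map e (Poly_Mapping.single s c) \<in> indexed_pset I (carrier R)"
      if "set_mset s \<subseteq> I" for s c
      using that
    proof (induction s)
      case empty
      show ?case unfolding const by (rule indexed_pset.indexed_const) simp
    next
      case (add i s)
      have "Poly_Mapping.single (add_mset i s) c = Poly_Mapping.single s c * Poly_Mapping.single
        {#i#} 1"
        by (simp add: mult_single)
      then show ?case using add by (auto simp: pmult intro: indexed_pset.indexed_pmult)
    qed
    have sum: "(\<And>s. s \<in> A \<Longrightarrow> mpoly_map e (h s) \<in> indexed_pset I (carrier R)) \<Longrightarrow>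
        mpoly_map e (\<Sum>s\<in>A. h s) \<in> indexed_pset I (carrier R)"
          if "finite A" for A and h :: "'v multiset \<Rightarrow> 'v multiset \<Rightarrow>\<^sub>0 'c"
      using that
    proof (induction A rule: finite_induct)
      case empty
      then show ?case using single[of "{#}" 0] by simp
    qed (auto simp: add intro: indexed_pset.indexed_padd)
    have "f = (\<Sum>s\<in>Poly_Mapping.keys f. Poly_Mapping.single s (lookup f s))"
      by (intro poly_mapping_eqI) (auto simp: lookup_sum lookup_single when_def in_keys_iff)
    moreover have "mpoly_map e (\<Sum>s\<in>Poly_Mapping.keys f. Poly_Mapping.single s (lookup f s)) \<in>
      indexed_pset I (carrier R)"
      using that by (intro sum single) (auto simp: supported_in_def in_keys_iff)
    ultimately show ?thesis by simp
  qed
  have surj: "\<exists>f. supported_in I f \<and> mpoly_map e f = g"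
    if "g \<in> indexed_pset I (carrier R)" for g :: "'v multiset \<Rightarrow> 'x"
    using that
  proof (induction g rule: indexed_pset.induct)
    case (indexed_const c)
    then obtain a where "c = e a" unfolding carrier_eq by blast
    then show ?case using const[of a] supported_in_single[of "{#}" I a] by auto
  next
    case (indexed_padd P Q)
    then show ?case using add supported_in_add by metis
  next
    case (indexed_pmult P i)
    then show ?case using pmult supported_in_mult supported_in_single[of "{#i#}" I 1] by fastforce
  qed
  show ?thesis
  proof
    show "mpoly_map e 0 = \<zero>\<^bsub>mpoly_ring R I\<^esub>" "mpoly_map e 1 = \<one>\<^bsub>mpoly_ring R I\<^esub>"
      using const[of 0] const[of 1] by (simp_all add: mpoly_ring_def f_0 f_1 flip: zero_multiset_def)
    show "mpoly_map e (f * g) = mpoly_map e f \<otimes>\<^bsub>mpoly_ring R I\<^esub> mpoly_map e g" for f g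
      by (simp add: mpoly_ring_def mpoly_map_def lookup_times_mset f_sum finite_submultisets f_mult)
    show "carrier (mpoly_ring R I) = mpoly_map e ` {f. supported_in I f}"
      using closed surj by (auto simp: mpoly_ring_def)
  qed (auto simp: mpoly_ring_def add intro: supported_in_add supported_in_mult supported_in_uminus)
qed

section \<open>Divided power operators on Witt vectors of a polynomial ring\<close>

(* Keeps the index set {1..d} of the variables in its original form. *)
declare One_nat_def [simp del]

context witt_perfect
begin

lemma mpoly_map_residue_eq_iff: "mpoly_map residue_lift f = mpoly_map residue_lift g \<longleftrightarrow> mcong 1 f g"
  unfolding mcong_def mpoly_map_def diff_mem_witt_kernel_1_iff by (auto simp: fun_eq_iff)

lemma mpoly_map_witt_lift_eq_iff: "mpoly_map (witt_lift m) f = mpoly_map (witt_lift m) g \<longleftrightarrow>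
  mcong m f g"
  unfolding mcong_def mpoly_map_def diff_mem_witt_kernel_iff by (auto simp: fun_eq_iff)

lemma supported_in_mpoly_frob:
  assumes "supported_in I f"
  shows "supported_in I (mpoly_frob f)"
  unfolding supported_in_def
proof (intro allI impI)
  fix s assume s: "\<not> set_mset s \<subseteq> I"
  show "lookup (mpoly_frob f) s = 0"
  proof (cases "\<exists>t. s = repeat_mset p t")
    case True
    then obtain t where t: "s = repeat_mset p t" ..
    have "set_mset s \<subseteq> set_mset t" unfolding t by (auto simp flip: count_greater_zero_iff)
    then show ?thesis
      using assms s unfolding supported_in_def t lookup_mpoly_frob_repeat by (metis \<sigma>_0 order_trans)
  qed (simp add: lookup_mpoly_frob_eq_0)
qed

sublocale poly_A: ring_image "{f. supported_in {1..d} f}" "mpoly_map residue_lift" "poly_A R d"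
  for d :: nat
  by (rule ring_image_mpoly_map[OF residue.ring_image_axioms])

sublocale poly_W: ring_image "{f. supported_in {1..d} f}" "mpoly_map (witt_lift m)" "poly_W p R d m"
  for d m :: nat
  by (rule ring_image_mpoly_map[OF lift.ring_image_axioms])

text \<open>
  The components of the Witt vector \<open>x\<close> over \<open>k[t\<^sub>1, \<dots>, t\<^sub>d]\<close> are the reductions of the polynomials
  \<open>g 0, \<dots>, g (m - 1)\<close> in the variables \<open>t\<^sub>1, \<dots>, t\<^sub>d\<close> over the torsion-free ring.
\<close>

definition represents :: "nat \<Rightarrow> nat \<Rightarrow> (nat multiset \<Rightarrow> 'a) list \<Rightarrow> (nat \<Rightarrow> nat multiset \<Rightarrow>\<^sub>0
  (nat \<Rightarrow> 'a) int_mpoly) \<Rightarrow> bool" where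
  "represents d m x g \<longleftrightarrow> length x = m \<and>
     (\<forall>i<m. supported_in {1..d} (g i) \<and> mpoly_map residue_lift (g i) = x ! i)"

lemma represents_closed:
  assumes "represents d m x g"
  shows "x \<in> carrier (witt_A p R d m)"
proof -
  have "x ! i \<in> carrier (poly_A R d)" if "i < m" for i
    using assms that poly_A.f_closed[of "g i" d] by (simp add: represents_def)
  then show ?thesis using assms by (auto simp: represents_def witt_ring_def in_set_conv_nth)
qed

lemma ex_represents:
  assumes "x \<in> carrier (witt_A p R d m)"
  obtains g where "represents d m x g"
proof -
  have x: "length x = m" "set x \<subseteq> carrier (poly_A R d)" using assms by (auto simp: witt_ring_def)
  have "\<forall>i. \<exists>f. i < m \<longrightarrow> supported_in {1..d} f \<and> mpoly_map residue_lift f = x ! i"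
  proof (intro allI)
    fix i
    show "\<exists>f. i < m \<longrightarrow> supported_in {1..d} f \<and> mpoly_map residue_lift f = x ! i"
    proof (cases "i < m")
      case True
      then have "x ! i \<in> carrier (poly_A R d)" using x nth_mem by blast
      then show ?thesis unfolding poly_A.carrier_eq by auto
    qed simp
  qed
  then obtain g where "\<And>i. i < m \<Longrightarrow> supported_in {1..d} (g i) \<and> mpoly_map residue_lift (g i) = x ! i"
    by metis
  then show ?thesis using that[of g] x(1) by (simp add: represents_def)
qed

lemma represents_mapI:
  assumes "\<And>i. i < m \<Longrightarrow> supported_in {1..d} (g i)"
  shows "represents d m (map (\<lambda>i. mpoly_map residue_lift (g i)) [0..<m]) g"
  using assms by (simp add: represents_def)

text \<open>
  The ghost map does not depend on the lifts, so it can be computed from any representatives.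
\<close>

lemma ghost_lift_represents:
  assumes "represents d m x g" "m > 0"
  shows "ghost_lift p R d m x = mpoly_map (witt_lift m) (witt_ghost p m g)"
proof -
  have "\<exists>u. supported_in {1..d} u \<and> mcong 1 u (g i) \<and>
      poly_lift p R d m (x ! i) = mpoly_map (witt_lift m) u" if "i < m" for i
  proof -
    have hd: "hd (mpoly_map (witt_lift m) f M) = mpoly_map residue_lift f M" for f M
      using hd_witt_lift[OF assms(2)] by (simp only: mpoly_map_def residue_lift_def)
    let ?Q = "\<lambda>G. G \<in> carrier (poly_W p R d m) \<and> (\<forall>M. hd (G M) = (x ! i) M)"
    have gi: "supported_in {1..d} (g i)" "mpoly_map residue_lift (g i) = x ! i"
      using assms(1) that by (auto simp: represents_def)
    have "hd (mpoly_map (witt_lift m) (g i) M) = (x ! i) M" for M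
      unfolding hd gi(2) ..
    then have "?Q (mpoly_map (witt_lift m) (g i))"
      using gi(1) by (auto simp: poly_W.carrier_eq)
    then have Q: "?Q (poly_lift p R d m (x ! i))"
      unfolding poly_lift_def by (rule someI[of ?Q])
    then obtain u where u: "supported_in {1..d} u" "poly_lift p R d m (x ! i) =
      mpoly_map (witt_lift m) u"
      unfolding poly_W.carrier_eq by blast
    have "mpoly_map residue_lift u = mpoly_map residue_lift (g i)"
      using Q unfolding u(2) hd gi(2) by (intro ext) blast
    then show ?thesis using u by (auto simp: mpoly_map_residue_eq_iff)
  qed
  then obtain u where u: "\<And>i. i < m \<Longrightarrow> supported_in {1..d} (u i)" "\<And>i. i < m \<Longrightarrow> mcong 1 (u i) (g i)"
      "\<And>i. i < m \<Longrightarrow> poly_lift p R d m (x ! i) = mpoly_map (witt_lift m) (u i)"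
    by metis
  have supp: "supported_in {1..d} (of_nat p ^ i * u i ^ n)" if "i < m" for i n
    using u(1)[OF that] by (intro supported_in_mult supported_in_power supported_in_of_nat)
  have "[(p ^ i)] \<cdot>\<^bsub>poly_W p R d m\<^esub> (poly_lift p R d m (x ! i) [^]\<^bsub>poly_W p R d m\<^esub> n)
      = mpoly_map (witt_lift m) (of_nat p ^ i * u i ^ n)" if "i < m" for i n :: nat
    using u(1)[OF that] poly_W.f_of_nat_mult[of "u i ^ n" d m "p ^ i"]
    by (simp add: u(3)[OF that] poly_W.f_power supported_in_power)
  then have "ghost_lift p R d m x = (\<Oplus>\<^bsub>poly_W p R d m\<^esub>i\<in>{..<m}.
      mpoly_map (witt_lift m) (of_nat p ^ i * u i ^ (p ^ (m - 1 - i))))"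
    unfolding ghost_lift_def using supp by (intro poly_W.finsum_cong') (auto simp: poly_W.carrier_eq)
  also have "\<dots> = mpoly_map (witt_lift m) (witt_ghost p m u)"
    unfolding witt_ghost_def using supp by (subst poly_W.f_sum) auto
  also have "\<dots> = mpoly_map (witt_lift m) (witt_ghost p m g)"
    unfolding mpoly_map_witt_lift_eq_iff using u(2) by (rule mcong_witt_ghost)
  finally show ?thesis .
qed

lemma hasse_deriv_mpoly_map:
  "hasse_deriv (witt_ring p m R) j r (mpoly_map (witt_lift m) f) =
    mpoly_map (witt_lift m) (mpoly_hasse j r f)"
  by (auto simp: hasse_deriv_def mpoly_map_def lookup_mpoly_hasse lift.f_of_nat_mult)

lemma represents_unique:
  assumes "represents d m x g" "represents d m y h" "mcong m (witt_ghost p m g) (witt_ghost p m h)"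
  shows "x = y"
proof (rule nth_equalityI)
  fix i assume "i < length x"
  then have i: "i < m" using assms(1) by (simp add: represents_def)
  have "mcong 1 (g i) (h i)" using mcong_witt_ghost_inj[OF assms(3) i] .
  then show "x ! i = y ! i"
    using assms(1,2) i unfolding represents_def by (metis mpoly_map_residue_eq_iff)
qed (use assms in \<open>simp add: represents_def\<close>)

lemma ghost_lift_inj:
  assumes "x \<in> carrier (witt_A p R d m)" "y \<in> carrier (witt_A p R d m)" "m > 0"
    and "ghost_lift p R d m x = ghost_lift p R d m y"
  shows "x = y"
proof -
  obtain g h where gh: "represents d m x g" "represents d m y h"
    using assms(1,2) ex_represents by metis
  then have "mcong m (witt_ghost p m g) (witt_ghost p m h)"
    using assms(4) by (simp add: ghost_lift_represents[OF _ assms(3)] mpoly_map_witt_lift_eq_iff)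
  then show ?thesis using gh represents_unique by blast
qed

lemma ex_witt_deriv_value:
  assumes "represents d m x g" "m > 0"
  obtains y h where "represents d m y h" "ghost_deriv_rel m j r g h"
    "ghost_lift p R d m y = hasse_deriv (witt_ring p m R) j r (ghost_lift p R d m x)"
proof -
  obtain h where h: "\<And>i. supported_in {1..d} (h i)" "ghost_deriv_rel m j r g h"
    using ex_ghost_deriv_rel[of m "{1..d}" g j r] assms(1) by (auto simp: represents_def)
  define y where "y = map (\<lambda>i. mpoly_map residue_lift (h i)) [0..<m]"
  have y: "represents d m y h" unfolding y_def using h(1) by (intro represents_mapI)
  have "ghost_lift p R d m y = hasse_deriv (witt_ring p m R) j r (ghost_lift p R d m x)"
    using h(2) unfolding ghost_lift_represents[OF y assms(2)] ghost_lift_represents[OF assms]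
      hasse_deriv_mpoly_map mpoly_map_witt_lift_eq_iff by (simp only: ghost_deriv_rel_def)
  then show ?thesis using that y h(2) by blast
qed

lemma witt_deriv_spec:
  assumes "m > 0"
  shows "witt_deriv p R d m j r \<in> carrier (witt_A p R d m) \<rightarrow>\<^sub>E carrier (witt_A p R d m) \<and>
    (\<forall>x \<in> carrier (witt_A p R d m). ghost_lift p R d m (witt_deriv p R d m j r x) =
       hasse_deriv (witt_ring p m R) j r (ghost_lift p R d m x))"
proof -
  let ?W = "carrier (witt_A p R d m)"
  let ?Q = "\<lambda>x y. y \<in> ?W \<and> ghost_lift p R d m y = hasse_deriv (witt_ring p m R) j r
    (ghost_lift p R d m x)"
  have "\<exists>y. ?Q x y" if x: "x \<in> ?W" for x
  proof -
    obtain g where "represents d m x g" using ex_represents[OF x] .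
    then show ?thesis using ex_witt_deriv_value[OF _ assms] represents_closed by metis
  qed
  then obtain D where D: "\<And>x. x \<in> ?W \<Longrightarrow> ?Q x (D x)" by metis
  \<comment> \<open>On the carrier the values are forced by the injectivity of the ghost map, outside of it by
    extensionality.\<close>
  have "\<exists>!D. D \<in> ?W \<rightarrow>\<^sub>E ?W \<and>
      (\<forall>x\<in>?W. ghost_lift p R d m (D x) = hasse_deriv (witt_ring p m R) j r (ghost_lift p R d m x))"
  proof (rule ex1I)
    show "restrict D ?W \<in> ?W \<rightarrow>\<^sub>E ?W \<and>
      (\<forall>x\<in>?W. ghost_lift p R d m (restrict D ?W x) = hasse_deriv (witt_ring p m R) j r
        (ghost_lift p R d m x))"
      using D by auto
  next
    fix D' assume D': "D' \<in> ?W \<rightarrow>\<^sub>E ?W \<and>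
      (\<forall>x\<in>?W. ghost_lift p R d m (D' x) = hasse_deriv (witt_ring p m R) j r (ghost_lift p R d m x))"
    show "D' = restrict D ?W"
    proof (rule PiE_ext[of _ ?W "\<lambda>_. ?W" _])
      fix x assume x: "x \<in> ?W"
      then show "D' x = restrict D ?W x"
        using D' D[OF x] by (intro ghost_lift_inj[OF _ _ assms]) auto
    qed (use D D' in auto)
  qed
  from theI'[OF this] show ?thesis unfolding witt_deriv_def .
qed

lemma witt_deriv_closed:
  "m > 0 \<Longrightarrow> x \<in> carrier (witt_A p R d m) \<Longrightarrow> witt_deriv p R d m j r x \<in> carrier (witt_A p R d m)"
  using witt_deriv_spec by blast

lemma represents_witt_deriv:
  assumes "m > 0" "represents d m x g"
  obtains h where "represents d m (witt_deriv p R d m j r x) h" "ghost_deriv_rel m j r g h"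
proof -
  have x: "x \<in> carrier (witt_A p R d m)" using assms(2) by (rule represents_closed)
  obtain y h where y: "represents d m y h" "ghost_deriv_rel m j r g h"
    "ghost_lift p R d m y = hasse_deriv (witt_ring p m R) j r (ghost_lift p R d m x)"
    using ex_witt_deriv_value[OF assms(2,1)] .
  have "ghost_lift p R d m (witt_deriv p R d m j r x) = ghost_lift p R d m y"
    using witt_deriv_spec[OF assms(1)] x y(3) by simp
  then have "witt_deriv p R d m j r x = y"
    by (intro ghost_lift_inj[OF witt_deriv_closed[OF assms(1) x] represents_closed[OF y(1)] assms(1)])
  then show ?thesis using that y by blast
qed

lemma witt_deriv_eqI:
  assumes "m > 0" "represents d m x g" "represents d m y h" "ghost_deriv_rel m j r g h"
  shows "witt_deriv p R d m j r x = y"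
proof -
  obtain h' where h': "represents d m (witt_deriv p R d m j r x) h'" "ghost_deriv_rel m j r g h'"
    using represents_witt_deriv[OF assms(1,2)] .
  have "mcong m (witt_ghost p m h') (witt_ghost p m h)"
    using h'(2) assms(4) mcong_trans mcong_sym unfolding ghost_deriv_rel_def by blast
  then show ?thesis using represents_unique h'(1) assms(3) by blast
qed

lemma represents_zero: "represents d m \<zero>\<^bsub>witt_A p R d m\<^esub> (\<lambda>_. 0)"
  using poly_A.f_0 by (simp add: represents_def witt_ring_def)

lemma witt_ghost_zero: "witt_ghost p m (\<lambda>_. 0 :: 'v multiset \<Rightarrow>\<^sub>0 (nat \<Rightarrow> 'a) int_mpoly) = 0"
  using prime_gt_0_nat[OF prime_p] by (simp add: witt_ghost_def power_0_left)

lemma witt_deriv_zero: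
  "m > 0 \<Longrightarrow> witt_deriv p R d m j r \<zero>\<^bsub>witt_A p R d m\<^esub> = \<zero>\<^bsub>witt_A p R d m\<^esub>"
  by (rule witt_deriv_eqI[OF _ represents_zero represents_zero])
     (simp_all add: ghost_deriv_rel_def witt_ghost_zero)

lemma represents_restriction:
  "represents d (Suc m) x g \<Longrightarrow> represents d m (witt_restriction x) g"
  by (auto simp: represents_def witt_restriction_def nth_butlast)

lemma witt_deriv_div_restriction:
  assumes "n > 0" "x \<in> carrier (witt_A p R d (Suc n))"
  shows "witt_deriv_div p R d n j r (witt_restriction x) =
    witt_restriction (witt_deriv p R d (Suc n) j r x)"
proof -
  obtain g where g: "represents d (Suc n) x g" using ex_represents[OF assms(2)] .
  obtain h where h: "represents d (Suc n) (witt_deriv p R d (Suc n) j r x) h" "ghost_deriv_rel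
    (Suc n) j r g h"
    using represents_witt_deriv[OF _ g] by blast
  note g' = represents_restriction[OF g] and h' = represents_restriction[OF h(1)]
  show ?thesis
  proof (cases "p dvd r")
    case True
    then have "r = p * (r div p)" by simp
    then have "ghost_deriv_rel n j (r div p) g h"
      using ghost_deriv_rel_restrict_dvd h(2) assms(1) by metis
    then show ?thesis using True witt_deriv_eqI[OF assms(1) g' h'] by (simp add: witt_deriv_div_def)
  next
    case False
    have "mcong n (witt_ghost p n (\<lambda>_. 0)) (witt_ghost p n h)"
      using ghost_deriv_rel_restrict_not_dvd[OF h(2) False assms(1)] mcong_sym
        by (simp add: witt_ghost_zero)
    then have "\<zero>\<^bsub>witt_A p R d n\<^esub> = witt_restriction (witt_deriv p R d (Suc n) j r x)"
      by (rule represents_unique[OF represents_zero h'])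
    then show ?thesis using False by (simp add: witt_deriv_div_def)
  qed
qed

lemma represents_frobenius:
  assumes "represents d m x g"
  shows "represents d m (witt_frobenius p (poly_A R d) x) (\<lambda>i. mpoly_frob (g i))"
proof -
  have "mpoly_map residue_lift (mpoly_frob f) = mpoly_map residue_lift f [^]\<^bsub>poly_A R d\<^esub> p"
    if "supported_in {1..d} f" for f :: "nat multiset \<Rightarrow>\<^sub>0 (nat \<Rightarrow> 'a) int_mpoly"
    using that mcong_1_mpoly_frob[of f] by (simp add: poly_A.f_power flip: mpoly_map_residue_eq_iff)
  then show ?thesis
    using assms by (simp add: represents_def witt_frobenius_def supported_in_mpoly_frob)
qed

lemma frobenius_zero:
  "witt_frobenius p (poly_A R d) \<zero>\<^bsub>witt_A p R d m\<^esub> = \<zero>\<^bsub>witt_A p R d m\<^esub>"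
  using represents_frobenius[OF represents_zero] represents_zero
  by (rule represents_unique) simp

lemma witt_deriv_frobenius:
  assumes "m > 0" "x \<in> carrier (witt_A p R d m)"
  shows "witt_deriv p R d m j r (witt_frobenius p (poly_A R d) x) =
    witt_frobenius p (poly_A R d) (witt_deriv_div p R d m j r x)"
proof -
  obtain g where g: "represents d m x g" using ex_represents[OF assms(2)] .
  note g' = represents_frobenius[OF g]
  show ?thesis
  proof (cases "p dvd r")
    case True
    obtain h where h: "represents d m (witt_deriv p R d m j (r div p) x) h" "ghost_deriv_rel m j
      (r div p) g h"
      using represents_witt_deriv[OF assms(1) g] .
    have "ghost_deriv_rel m j r (\<lambda>i. mpoly_frob (g i)) (\<lambda>i. mpoly_frob (h i))"
      using ghost_deriv_rel_frob_dvd[OF h(2) assms(1)] True by simp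
    then show ?thesis
      using True witt_deriv_eqI[OF assms(1) g' represents_frobenius[OF h(1)]]
        by (simp add: witt_deriv_div_def)
  next
    case False
    then show ?thesis
      using witt_deriv_eqI[OF assms(1) g' represents_zero ghost_deriv_rel_frob_not_dvd[OF False
        assms(1)]]
      by (simp add: witt_deriv_div_def frobenius_zero)
  qed
qed

lemma represents_verschiebung:
  "represents d m x g \<Longrightarrow> represents d (Suc m) (witt_verschiebung (poly_A R d) x) (case_nat 0 g)"
  using poly_A.f_0 by (auto simp: represents_def witt_verschiebung_def less_Suc_eq_0_disj)

lemma witt_deriv_verschiebung:
  assumes "m > 0" "x \<in> carrier (witt_A p R d m)"
  shows "witt_deriv p R d (Suc m) j r (witt_verschiebung (poly_A R d) x) =
    witt_verschiebung (poly_A R d) (witt_deriv p R d m j r x)"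
proof -
  obtain g where g: "represents d m x g" using ex_represents[OF assms(2)] .
  obtain h where h: "represents d m (witt_deriv p R d m j r x) h" "ghost_deriv_rel m j r g h"
    using represents_witt_deriv[OF assms(1) g] .
  show ?thesis
    by (rule witt_deriv_eqI[OF _ represents_verschiebung[OF g] represents_verschiebung[OF h(1)]
          ghost_deriv_rel_shift[OF h(2)]]) simp
qed

lemma verschiebung_closed:
  "x \<in> carrier (witt_A p R d m) \<Longrightarrow> witt_verschiebung (poly_A R d) x \<in> carrier (witt_A p R d (Suc m))"
  using ex_represents represents_verschiebung represents_closed by metis

lemma witt_deriv_V_ideal:
  assumes "i < m" "x \<in> witt_V_ideal p m (poly_A R d) i"
  shows "witt_deriv p R d m j r x \<in> witt_V_ideal p m (poly_A R d) i"
  using assms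
proof (induction i arbitrary: m x)
  case 0
  then show ?case by (auto simp: witt_V_ideal_def witt_deriv_closed)
next
  case (Suc i)
  obtain m' where m': "m = Suc m'" "i < m'" "m' > 0" using Suc.prems(1) by (cases m) auto
  obtain x' where x': "x = \<zero>\<^bsub>poly_A R d\<^esub> # x'"
    using Suc.prems m'(1) by (cases x) (auto simp: witt_V_ideal_def witt_ring_def)
  have "x' \<in> witt_V_ideal p m' (poly_A R d) i"
    using Suc.prems(2) unfolding x' m'(1) by (auto simp: witt_V_ideal_def witt_ring_def dest:
      spec[of _ "Suc _"])
  then have "witt_deriv p R d m' j r x' \<in> witt_V_ideal p m' (poly_A R d) i" and "x' \<in>
    carrier (witt_A p R d m')"
    using Suc.IH m'(2) by (auto simp: witt_V_ideal_def)
  then show ?case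
    using witt_deriv_verschiebung[OF m'(3), of x' d j r] verschiebung_closed[of "witt_deriv p R d m'
      j r x'" m' d]
    unfolding m'(1) x' by (auto simp: witt_V_ideal_def witt_verschiebung_def less_Suc_eq_0_disj)
qed

text \<open>
  The composition of the operators \<open>\<partial>\<^sub>j\<^bsup>[r j]\<^esup>\<close> for \<open>j\<close> in a list. For lists the relations follow by
  induction; the multi-index operators are the case of the list \<open>1, \<dots>, d\<close>.
\<close>

definition iterated_deriv :: "nat \<Rightarrow> nat \<Rightarrow> (nat \<Rightarrow> nat) \<Rightarrow> nat list \<Rightarrow> (nat multiset \<Rightarrow> 'a) list \<Rightarrow>
  (nat multiset \<Rightarrow> 'a) list" where
  "iterated_deriv d m r js = foldr (\<lambda>j D. witt_deriv p R d m j (r j) \<circ> D) js id"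

lemma iterated_deriv_simps [simp]:
  "iterated_deriv d m r [] x = x"
  "iterated_deriv d m r (j # js) x = witt_deriv p R d m j (r j) (iterated_deriv d m r js x)"
  by (simp_all add: iterated_deriv_def)

lemma iterated_deriv_closed:
  "m > 0 \<Longrightarrow> x \<in> carrier (witt_A p R d m) \<Longrightarrow> iterated_deriv d m r js x \<in> carrier (witt_A p R d m)"
  by (induction js) (auto intro: witt_deriv_closed)

lemma iterated_deriv_restriction:
  assumes "n > 0" "x \<in> carrier (witt_A p R d (Suc n))"
  shows "witt_restriction (iterated_deriv d (Suc n) r js x) =
    (if \<forall>j\<in>set js. p dvd r j then iterated_deriv d n (\<lambda>j. r j div p) js (witt_restriction x)
     else \<zero>\<^bsub>witt_A p R d n\<^esub>)"
proof (induction js)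
  case (Cons j js)
  have "iterated_deriv d (Suc n) r js x \<in> carrier (witt_A p R d (Suc n))"
    using assms(2) by (intro iterated_deriv_closed) auto
  then show ?case
    using witt_deriv_div_restriction[OF assms(1), of "iterated_deriv d
      (Suc n) r js x" d j "r j"] Cons assms(1)
    by (auto simp: witt_deriv_div_def witt_deriv_zero split: if_splits)
qed simp

lemma iterated_deriv_frobenius:
  assumes "m > 0" "x \<in> carrier (witt_A p R d m)"
  shows "iterated_deriv d m r js (witt_frobenius p (poly_A R d) x) =
    (if \<forall>j\<in>set js. p dvd r j
     then witt_frobenius p (poly_A R d) (iterated_deriv d m (\<lambda>j. r j div p) js x)
     else \<zero>\<^bsub>witt_A p R d m\<^esub>)"
proof (induction js)
  case (Cons j js)
  have "iterated_deriv d m (\<lambda>j. r j div p) js x \<in> carrier (witt_A p R d m)"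
    using assms by (intro iterated_deriv_closed) auto
  then show ?case
    using witt_deriv_frobenius[OF assms(1), of "iterated_deriv d m
      (\<lambda>j. r j div p) js x" d j "r j"] Cons assms(1)
    by (auto simp: witt_deriv_div_def witt_deriv_zero frobenius_zero)
qed simp

lemma iterated_deriv_verschiebung:
  assumes "m > 0" "x \<in> carrier (witt_A p R d m)"
  shows "iterated_deriv d (Suc m) r js (witt_verschiebung (poly_A R d) x) =
    witt_verschiebung (poly_A R d) (iterated_deriv d m r js x)"
  by (induction js) (simp_all add: witt_deriv_verschiebung iterated_deriv_closed assms)

lemma iterated_deriv_V_ideal:
  "i < m \<Longrightarrow> x \<in> witt_V_ideal p m (poly_A R d) i \<Longrightarrow>
    iterated_deriv d m r js x \<in> witt_V_ideal p m (poly_A R d) i"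
  by (induction js) (auto intro: witt_deriv_V_ideal)

lemma witt_multi_deriv_eq: "witt_multi_deriv p R d m r = iterated_deriv d m r [1..<Suc d]"
  by (simp add: witt_multi_deriv_def iterated_deriv_def)

end

theorem proposition5p18:
  fixes k :: "('a, 'b) ring_scheme" and p d n :: nat
  assumes "field k"
    and "prime p"
    and char: "\<forall>m::nat. [m] \<cdot>\<^bsub>k\<^esub> \<one>\<^bsub>k\<^esub> = \<zero>\<^bsub>k\<^esub> \<longleftrightarrow> p dvd m"
    and perfect: "(\<lambda>x. x [^]\<^bsub>k\<^esub> p) ` carrier k = carrier k"
    and "d \<ge> 1"
    and "n \<ge> 1"
  shows
    "(\<forall>(r::nat). \<forall>j\<in>{1..d}.
        (\<forall>x\<in>carrier (witt_A p k d (n + 1)).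
           witt_deriv_div p k d n j r (witt_restriction x) =
           witt_restriction (witt_deriv p k d (n + 1) j r x)) \<and>
        (\<forall>x\<in>carrier (witt_A p k d (n + 1)).
           witt_deriv p k d (n + 1) j r (witt_frobenius p (poly_A k d) x) =
           witt_frobenius p (poly_A k d) (witt_deriv_div p k d (n + 1) j r x)) \<and>
        (\<forall>x\<in>carrier (witt_A p k d n).
           witt_deriv p k d (n + 1) j r (witt_verschiebung (poly_A k d) x) =
           witt_verschiebung (poly_A k d) (witt_deriv p k d n j r x)) \<and>
        (\<forall>i<n + 1.
           witt_deriv p k d (n + 1) j r ` witt_V_ideal p (n + 1) (poly_A k d) i
             \<subseteq> witt_V_ideal p (n + 1) (poly_A k d) i)) \<and>
     (\<forall>r::nat \<Rightarrow> nat.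
        (\<forall>x\<in>carrier (witt_A p k d (n + 1)).
           witt_multi_deriv_div p k d n r (witt_restriction x) =
           witt_restriction (witt_multi_deriv p k d (n + 1) r x)) \<and>
        (\<forall>x\<in>carrier (witt_A p k d (n + 1)).
           witt_multi_deriv p k d (n + 1) r (witt_frobenius p (poly_A k d) x) =
           witt_frobenius p (poly_A k d) (witt_multi_deriv_div p k d (n + 1) r x)) \<and>
        (\<forall>x\<in>carrier (witt_A p k d n).
           witt_multi_deriv p k d (n + 1) r (witt_verschiebung (poly_A k d) x) =
           witt_verschiebung (poly_A k d) (witt_multi_deriv p k d n r x)) \<and>
        (\<forall>i<n + 1.
           witt_multi_deriv p k d (n + 1) r ` witt_V_ideal p (n + 1) (poly_A k d) i
             \<subseteq> witt_V_ideal p (n + 1) (poly_A k d) i))"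
proof -
  interpret field k by fact
  interpret witt_perfect k p
  proof
    show "prime p" by fact
    show "[p] \<cdot>\<^bsub>k\<^esub> \<one>\<^bsub>k\<^esub> = \<zero>\<^bsub>k\<^esub>" using char[rule_format, of p] by simp
    show "(\<lambda>x. x [^]\<^bsub>k\<^esub> p) ` carrier k = carrier k" by fact
  qed
  have n: "n > 0" using \<open>n \<ge> 1\<close> by simp
  have set: "set [1..<Suc d] = {1..d}" by auto
  have "witt_multi_deriv_div p k d n r (witt_restriction x) =
      witt_restriction (witt_multi_deriv p k d (Suc n) r x)"
    if "x \<in> carrier (witt_A p k d (Suc n))" for r x
    unfolding witt_multi_deriv_div_def witt_multi_deriv_eq iterated_deriv_restriction[OF n that] set
    by (simp only: if_distribR split: if_splits)
  moreover have "witt_multi_deriv p k d (Suc n) r (witt_frobenius p (poly_A k d) x) =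
      witt_frobenius p (poly_A k d) (witt_multi_deriv_div p k d (Suc n) r x)"
    if "x \<in> carrier (witt_A p k d (Suc n))" for r x
    unfolding witt_multi_deriv_div_def witt_multi_deriv_eq iterated_deriv_frobenius[OF zero_less_Suc that] set
    by (simp add: frobenius_zero)
  moreover have "witt_multi_deriv p k d (Suc n) r (witt_verschiebung (poly_A k d) x) =
      witt_verschiebung (poly_A k d) (witt_multi_deriv p k d n r x)"
    if "x \<in> carrier (witt_A p k d n)" for r x
    unfolding witt_multi_deriv_eq by (rule iterated_deriv_verschiebung[OF n that])
  moreover have "witt_multi_deriv p k d (Suc n) r x \<in> witt_V_ideal p (Suc n) (poly_A k d) i"
    if "i < Suc n" "x \<in> witt_V_ideal p (Suc n) (poly_A k d) i" for r i x
    unfolding witt_multi_deriv_eq using that by (rule iterated_deriv_V_ideal)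
  ultimately show ?thesis
    unfolding Suc_eq_plus1 [symmetric]
    using witt_deriv_div_restriction[OF n] witt_deriv_frobenius[OF zero_less_Suc]
      witt_deriv_verschiebung[OF n] witt_deriv_V_ideal
    by (intro conjI allI ballI impI image_subsetI) blast+
qed

end
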